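(* Let $\Omega\subset\mathbb{R}^n$ be a bounded open set with smooth non-empty boundary, and let $\Sigma\subset\partial\Omega$ be an arbitrary non-empty subset of the boundary. Then there exist $\epsilon>0$ and $c>0$ such that for any $\varphi\in Diff^1(\partial\Omega)$ satisfying $\|\varphi-id\|_{C^1(\partial\Omega)}<\epsilon$, the estimate $$|H(\Omega,\varphi(\Sigma))-H(\Omega,\Sigma)|\le c\,H(\Omega,\Sigma)\,\|\varphi-id\|_{C^1(\partial\Omega)}$$ holds.
   Context: For an open set $\Omega\subset\mathbb{R}^n$ and non-empty $\Sigma\subset\partial\Omega$, put $d_\Sigma(x)=\mathrm{dist}(x,\Sigma)$ (Euclidean distance). The Hardy constant is $$H(\Omega,\Sigma)=\inf_{u\in H^1_0(\Omega),\,u\ne0}\frac{\int_\Omega|\nabla u|^2dx}{\int_\Omega u^2/d_\Sigma^2\,dx},$$ the quotient being $0$ when the denominator is $+\infty$. $Diff^1(\partial\Omega)$ is the group of $C^1$ diffeomorphisms of the compact manifold $\partial\Omega$; $id$ is the identity of $\partial\Omega$, and $\|\varphi-id\|_{C^1(\partial\Omega)}$ is the $C^1$ norm of $\varphi-id$ regarded as an $\mathbb{R}^n$-valued map on $\partial\Omega$ (sup of its values plus sup of its first derivatives). *)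

theory Defs
  imports "HOL-Analysis.Analysis"
begin

text \<open>The classes \<open>C\<^sup>k(S)\<close> and \<open>C\<^sup>\<infinity>(S)\<close>, meant for open \<open>S\<close> only, since derivatives are taken in
  the whole space.\<close>

primrec higher_differentiable_on ::
  "'a::euclidean_space set \<Rightarrow> ('a \<Rightarrow> 'b::real_normed_vector) \<Rightarrow> nat \<Rightarrow> bool" where
  "higher_differentiable_on S f 0 \<longleftrightarrow> continuous_on S f"
| "higher_differentiable_on S f (Suc k) \<longleftrightarrow>
     (\<forall>x\<in>S. f differentiable (at x)) \<and>
     (\<forall>v. higher_differentiable_on S (\<lambda>x. frechet_derivative f (at x) v) k)"

definition smooth_on :: "'a::euclidean_space set \<Rightarrow> ('a \<Rightarrow> 'b::real_normed_vector) \<Rightarrow> bool" where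
  "smooth_on S f \<longleftrightarrow> (\<forall>k. higher_differentiable_on S f k)"

text \<open>
  Near each boundary point, in suitably rotated coordinates, \<open>\<Omega>\<close> is the region strictly above
  the graph of a smooth function \<open>\<gamma>\<close>. The unit vector \<open>\<nu>\<close> is the last coordinate direction; the
  remaining coordinates of \<open>x\<close> are its projection \<open>x - (x \<bullet> \<nu>) *\<^sub>R \<nu>\<close> to the hyperplane orthogonal to
  \<open>\<nu>\<close>, so only the restriction of \<open>\<gamma>\<close> to this hyperplane matters.
\<close>

definition smooth_boundary :: "'a::euclidean_space set \<Rightarrow> bool" where
  "smooth_boundary \<Omega> \<longleftrightarrow>
     (\<forall>p\<in>frontier \<Omega>. \<exists>r>0. \<exists>\<nu> (\<gamma> :: 'a \<Rightarrow> real). norm \<nu> = 1 \<and> smooth_on UNIV \<gamma> \<and>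
        \<Omega> \<inter> ball p r = {x \<in> ball p r. \<gamma> (x - (x \<bullet> \<nu>) *\<^sub>R \<nu>) < x \<bullet> \<nu>})"

text \<open>
  Functions on \<open>\<Omega>\<close> are total functions whose values outside \<open>\<Omega>\<close> are irrelevant; elements of
  \<open>L\<^sup>2(\<Omega>)\<close> are represented by functions, not by classes modulo equality almost everywhere.
\<close>

definition L2_on :: "'a::euclidean_space set \<Rightarrow> ('a \<Rightarrow> 'b::euclidean_space) \<Rightarrow> bool" where
  "L2_on \<Omega> f \<longleftrightarrow> f \<in> borel_measurable (lebesgue_on \<Omega>) \<and>
     integrable (lebesgue_on \<Omega>) (\<lambda>x. (norm (f x))\<^sup>2)"

definition test_functions :: "'a::euclidean_space set \<Rightarrow> ('a \<Rightarrow> real) set" where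
  "test_functions \<Omega> =
     {\<eta>. smooth_on UNIV \<eta> \<and> compact (closure {x. \<eta> x \<noteq> 0}) \<and> closure {x. \<eta> x \<noteq> 0} \<subseteq> \<Omega>}"

definition classical_gradient :: "('a::euclidean_space \<Rightarrow> real) \<Rightarrow> 'a \<Rightarrow> 'a" where
  "classical_gradient f x = (\<Sum>i\<in>Basis. frechet_derivative f (at x) i *\<^sub>R i)"

text \<open>\<open>u\<close> lies in \<open>H\<^sup>1(\<Omega>)\<close>, and \<open>g\<close> is (a representative of) its weak gradient.\<close>

definition has_H1_gradient ::
  "'a::euclidean_space set \<Rightarrow> ('a \<Rightarrow> real) \<Rightarrow> ('a \<Rightarrow> 'a) \<Rightarrow> bool" where
  "has_H1_gradient \<Omega> u g \<longleftrightarrow> L2_on \<Omega> u \<and> L2_on \<Omega> g \<and>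
     (\<forall>\<eta>\<in>test_functions \<Omega>. \<forall>i\<in>Basis.
        (LINT x|lebesgue_on \<Omega>. u x * (classical_gradient \<eta> x \<bullet> i)) =
        - (LINT x|lebesgue_on \<Omega>. (g x \<bullet> i) * \<eta> x))"

definition H10 :: "'a::euclidean_space set \<Rightarrow> ('a \<Rightarrow> real) set" where
  "H10 \<Omega> = {u. \<exists>g. has_H1_gradient \<Omega> u g \<and>
     (\<forall>e>0. \<exists>\<eta>\<in>test_functions \<Omega>.
        sqrt ((LINT x|lebesgue_on \<Omega>. (u x - \<eta> x)\<^sup>2) +
              (LINT x|lebesgue_on \<Omega>. (norm (g x - classical_gradient \<eta> x))\<^sup>2)) < e)}"

definition hardy_quotient ::
  "'a::euclidean_space set \<Rightarrow> 'a set \<Rightarrow> ('a \<Rightarrow> real) \<Rightarrow> ('a \<Rightarrow> 'a) \<Rightarrow> real" where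
  "hardy_quotient \<Omega> \<Sigma> u g =
     (let D = (\<integral>\<^sup>+ x. ennreal ((u x)\<^sup>2 / (infdist x \<Sigma>)\<^sup>2) \<partial>lebesgue_on \<Omega>)
      in if D = \<infinity> then 0
         else (LINT x|lebesgue_on \<Omega>. (norm (g x))\<^sup>2) / enn2real D)"

text \<open>The weak gradient \<open>g\<close> is determined by \<open>u\<close> up to null sets, so \<open>u\<close> is the only genuine
  variable of the infimum.\<close>

definition hardy_constant :: "'a::euclidean_space set \<Rightarrow> 'a set \<Rightarrow> real" where
  "hardy_constant \<Omega> \<Sigma> =
     Inf {hardy_quotient \<Omega> \<Sigma> u g | u g.
            u \<in> H10 \<Omega> \<and> has_H1_gradient \<Omega> u g \<and> \<not> (AE x in lebesgue_on \<Omega>. u x = 0)}"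

text \<open>From here on \<open>M\<close> is a smooth submanifold of Euclidean space; \<open>C\<^sup>1\<close> maps on it are those that
  locally extend to \<open>C\<^sup>1\<close> maps on open sets.\<close>

definition C1_on :: "'a::euclidean_space set \<Rightarrow> ('a \<Rightarrow> 'b::real_normed_vector) \<Rightarrow> bool" where
  "C1_on M f \<longleftrightarrow>
     (\<forall>p\<in>M. \<exists>U F. open U \<and> p \<in> U \<and> higher_differentiable_on U F 1 \<and> (\<forall>x\<in>M \<inter> U. F x = f x))"

definition C1_diffeos :: "'a::euclidean_space set \<Rightarrow> ('a \<Rightarrow> 'a) set" where
  "C1_diffeos M = {\<phi>. bij_betw \<phi> M M \<and> C1_on M \<phi> \<and> C1_on M (inv_into M \<phi>)}"

definition curve_through ::
  "'a::euclidean_space set \<Rightarrow> 'a \<Rightarrow> 'a \<Rightarrow> (real \<Rightarrow> 'a) \<Rightarrow> bool" where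
  "curve_through M p v c \<longleftrightarrow>
     c 0 = p \<and> (c has_vector_derivative v) (at 0) \<and>
     (\<exists>e>0. smooth_on {-e<..<e} c \<and> c ` {-e<..<e} \<subseteq> M)"

definition tangent_space :: "'a::euclidean_space set \<Rightarrow> 'a \<Rightarrow> 'a set" where
  "tangent_space M p = {v. \<exists>c. curve_through M p v c}"

text \<open>The differential of \<open>f\<close> at \<open>p\<close> applied to a tangent vector \<open>v\<close>. For \<open>f\<close> of class \<open>C\<^sup>1\<close> it
  does not depend on the chosen curve.\<close>

definition tangential_derivative ::
  "'a::euclidean_space set \<Rightarrow> ('a \<Rightarrow> 'b::real_normed_vector) \<Rightarrow> 'a \<Rightarrow> 'a \<Rightarrow> 'b" where
  "tangential_derivative M f p v =
     (THE w. \<exists>c. curve_through M p v c \<and> ((\<lambda>t. f (c t)) has_vector_derivative w) (at 0))"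

text \<open>
  The second supremum is that of the operator norms of the differentials. Taking \<open>norm v \<le> 1\<close>
  instead of \<open>norm v = 1\<close> keeps the set non-empty in dimension one, where the tangent spaces of
  the boundary are trivial.
\<close>

definition C1_norm :: "'a::euclidean_space set \<Rightarrow> ('a \<Rightarrow> 'b::real_normed_vector) \<Rightarrow> real" where
  "C1_norm M f =
     (SUP p\<in>M. norm (f p)) +
     Sup {norm (tangential_derivative M f p v) | p v. p \<in> M \<and> v \<in> tangent_space M p \<and> norm v \<le> 1}"

end

theory Submission
  imports Defs "HOL-Computational_Algebra.Polynomial"
begin

text \<open>
  The Hardy constant is an infimum over functions on a fixed domain, so a displacement of \<open>\<Sigma>\<close> can
  be compensated by a change of variables. Suppose that \<open>F\<close> is a homeomorphism of the whole space
  which maps \<open>\<Omega>\<close> onto itself, agrees with \<open>\<phi>\<close> on the boundary, and has a \<open>\<kappa>\<close>-Lipschitz displacement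
  \<open>F - id\<close>. Passing from \<open>\<eta>\<close> to \<open>\<eta> \<circ> F\<close> changes the Dirichlet energy at most by a factor \<open>1 + O(\<kappa>)\<close>,
  and the distance from \<open>F x\<close> to \<open>\<phi>(\<Sigma>)\<close> is that from \<open>x\<close> to \<open>\<Sigma>\<close> up to such a factor. Hence
  \<open>H(\<Omega>,\<Sigma>) \<le> (1 + O(\<kappa>)) H(\<Omega>,\<phi>(\<Sigma>))\<close>, and the inverse of \<open>F\<close> yields the opposite inequality
  (\<open>hardy_constant_transfer\<close>). It remains to find \<open>F\<close> with \<open>\<kappa>\<close> of the order of the \<open>C\<^sup>1\<close> norm of
  \<open>\<phi> - id\<close>.

  Integration along curves inside the boundary shows that \<open>\<phi> - id\<close> is Lipschitz on the boundary,
  with a constant of that order with respect to the Euclidean distance (\<open>frontier_C1_lipschitz\<close>).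
  McShane's formula extends it to a Lipschitz map \<open>Z\<close> of the whole space, and \<open>F = id + Z\<close> is a
  bi-Lipschitz homeomorphism because \<open>Z\<close> is a contraction. It preserves the boundary, so it
  permutes the components of the complement of the boundary. Smoothness of the boundary makes the
  components of \<open>\<Omega>\<close> finite in number, so each contains a point at a definite distance from the
  boundary, and a small displacement cannot move these points out of \<open>\<Omega>\<close>
  (\<open>near_identity_preserves_domain\<close>).

  Although \<open>F\<close> is merely Lipschitz, no chain rule for Sobolev functions is involved. By density
  and Fatou's lemma a number \<open>h \<ge> 0\<close> is a lower bound for the Hardy constant as soon as
  \<open>h \<integral> \<eta>\<^sup>2/d\<^sup>2 \<le> \<integral> |\<nabla>\<eta>|\<^sup>2\<close> for all test functions \<open>\<eta>\<close> (\<open>hardy_constant_ge\<close>). As the support of \<open>\<eta>\<close>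
  keeps a positive distance from the boundary, one may replace \<open>F\<close> by a mollification, chosen in
  dependence on \<open>\<eta>\<close>, without leaving \<open>\<Omega>\<close>; then \<open>\<eta> \<circ> F\<close> is again a test function. In place of a Jacobian
  determinant the change of variables uses the fact that an \<open>L\<close>-Lipschitz map enlarges volumes at most
  by \<open>L\<^sup>n\<close>, which Vitali's covering theorem reduces to balls (\<open>nn_integral_lipschitz_le\<close>).
\<close>

section \<open>Calculus of higher derivatives\<close>

lemma higher_differentiable_on_subset:
  assumes "higher_differentiable_on T f k" "S \<subseteq> T"
  shows "higher_differentiable_on S f k"
  using assms by (induction k arbitrary: f) (auto intro: continuous_on_subset)

lemma higher_differentiable_on_cong:
  assumes "open S" "\<And>x. x \<in> S \<Longrightarrow> f x = g x"
  shows "higher_differentiable_on S f k \<longleftrightarrow> higher_differentiable_on S g k"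
  using assms(2)
proof (induction k arbitrary: f g)
  case 0
  then show ?case by (auto cong: continuous_on_cong)
next
  case (Suc k)
  have ev: "(f has_derivative D) (at x) \<longleftrightarrow> (g has_derivative D) (at x)" if "x \<in> S" for x D
    using has_derivative_transform_within_open[OF _ assms(1) that, of f D UNIV g]
      has_derivative_transform_within_open[OF _ assms(1) that, of g D UNIV f] Suc.prems by auto
  have "frechet_derivative f (at x) v = frechet_derivative g (at x) v" if "x \<in> S" for x v
    using ev[OF that] by (simp add: frechet_derivative_def)
  then have "higher_differentiable_on S (\<lambda>x. frechet_derivative f (at x) v) k \<longleftrightarrow>
      higher_differentiable_on S (\<lambda>x. frechet_derivative g (at x) v) k" for v
    by (intro Suc.IH) auto
  moreover have "f differentiable (at x) \<longleftrightarrow> g differentiable (at x)" if "x \<in> S" for x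
    using ev[OF that] by (simp add: differentiable_def)
  ultimately show ?case by auto
qed

lemma higher_differentiable_on_lower:
  assumes "higher_differentiable_on S f (Suc k)"
  shows "higher_differentiable_on S f k"
  using assms
proof (induction k arbitrary: f)
  case 0
  then show ?case
    by (auto intro!: continuous_at_imp_continuous_on differentiable_imp_continuous_within)
next
  case (Suc k)
  then show ?case by auto
qed

text \<open>To prove a function \<open>C\<^sup>k\<^sup>+\<^sup>1\<close> one names its derivative and proves that the latter is
  \<open>C\<^sup>k\<close> in each direction; this spares the explicit Frechet derivative in what follows.\<close>

lemma higher_differentiable_on_SucI:
  assumes "open S" "\<And>x. x \<in> S \<Longrightarrow> (f has_derivative f' x) (at x)"
    and "\<And>v. higher_differentiable_on S (\<lambda>x. f' x v) k"
  shows "higher_differentiable_on S f (Suc k)"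
proof -
  have "frechet_derivative f (at x) v = f' x v" if "x \<in> S" for x v
    using frechet_derivative_at[OF assms(2)[OF that]] by simp
  then have "higher_differentiable_on S (\<lambda>x. frechet_derivative f (at x) v) k" for v
    by (rule iffD2[OF higher_differentiable_on_cong[OF assms(1)] assms(3)])
  then show ?thesis using assms(2) by (auto simp: differentiable_def)
qed

lemma higher_differentiable_on_SucD:
  assumes "higher_differentiable_on S f (Suc k)"
  shows "\<And>x. x \<in> S \<Longrightarrow> (f has_derivative frechet_derivative f (at x)) (at x)"
    and "\<And>v. higher_differentiable_on S (\<lambda>x. frechet_derivative f (at x) v) k"
  using assms by (auto simp: frechet_derivative_works)

lemma higher_differentiable_on_const:
  assumes "open S"
  shows "higher_differentiable_on S (\<lambda>x. c) k"
proof (induction k arbitrary: c)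
  case (Suc k)
  show ?case
    by (rule higher_differentiable_on_SucI[OF assms, where f'="\<lambda>x v. 0"]) (auto intro: Suc)
qed simp

lemma higher_differentiable_on_bounded_linear:
  assumes "open S" "bounded_linear L"
  shows "higher_differentiable_on S L k"
proof (cases k)
  case 0
  then show ?thesis using assms(2) by (simp add: linear_continuous_on)
next
  case (Suc m)
  show ?thesis unfolding Suc
    by (rule higher_differentiable_on_SucI[OF assms(1), where f'="\<lambda>x. L"])
      (auto intro: bounded_linear_imp_has_derivative assms higher_differentiable_on_const)
qed

lemma higher_differentiable_on_linear_comp:
  assumes "open S" "bounded_linear L" "higher_differentiable_on S f k"
  shows "higher_differentiable_on S (\<lambda>x. L (f x)) k"
  using assms(3)
proof (induction k arbitrary: f)
  case 0
  then show ?case using assms(2) by (auto intro: bounded_linear.continuous_on)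
next
  case (Suc k)
  note D = higher_differentiable_on_SucD[OF Suc.prems]
  show ?case
    by (rule higher_differentiable_on_SucI[OF assms(1)
        bounded_linear.has_derivative[OF assms(2) D(1)] Suc.IH[OF D(2)]])
qed

lemma higher_differentiable_on_add:
  assumes "open S" "higher_differentiable_on S f k" "higher_differentiable_on S g k"
  shows "higher_differentiable_on S (\<lambda>x. f x + g x) k"
  using assms(2,3)
proof (induction k arbitrary: f g)
  case 0
  then show ?case by (auto intro: continuous_intros)
next
  case (Suc k)
  note D = higher_differentiable_on_SucD[OF Suc.prems(1)]
  note E = higher_differentiable_on_SucD[OF Suc.prems(2)]
  show ?case
    by (rule higher_differentiable_on_SucI[OF assms(1) has_derivative_add[OF D(1) E(1)]
          Suc.IH[OF D(2) E(2)]])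
qed

lemma higher_differentiable_on_sum:
  assumes "open S" "\<And>i. i \<in> I \<Longrightarrow> higher_differentiable_on S (f i) k"
  shows "higher_differentiable_on S (\<lambda>x. \<Sum>i\<in>I. f i x) k"
  using assms(2)
  by (induction I rule: infinite_finite_induct)
    (auto intro: higher_differentiable_on_const higher_differentiable_on_add assms(1))

lemma higher_differentiable_on_scaleR:
  assumes "open S" "higher_differentiable_on S f k" "higher_differentiable_on S g k"
  shows "higher_differentiable_on S (\<lambda>x. f x *\<^sub>R g x) k"
  using assms(2,3)
proof (induction k arbitrary: f g)
  case 0
  then show ?case by (auto intro: continuous_intros)
next
  case (Suc k)
  note D = higher_differentiable_on_SucD[OF Suc.prems(1)]
  note E = higher_differentiable_on_SucD[OF Suc.prems(2)]
  note L = higher_differentiable_on_lower[OF Suc.prems(1)] higher_differentiable_on_lower[OF Suc.prems(2)]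
  show ?case
    by (rule higher_differentiable_on_SucI[OF assms(1) has_derivative_scaleR[OF D(1) E(1)]])
      (assumption | intro higher_differentiable_on_add assms(1) Suc.IH D(2) E(2) L)+
qed

text \<open>The chain rule is expanded in a basis, so that the derivative of the composite is a finite sum of
  products to which the induction hypothesis applies, with the partial derivatives of \<open>f\<close> in the
  place of \<open>f\<close>.\<close>

lemma higher_differentiable_on_compose:
  fixes g :: "'a::euclidean_space \<Rightarrow> 'b::euclidean_space"
  assumes "open S" "open T" "g ` S \<subseteq> T"
    and "higher_differentiable_on T f k" "higher_differentiable_on S g k"
  shows "higher_differentiable_on S (\<lambda>x. f (g x)) k"
  using assms(4,5)
proof (induction k arbitrary: f)
  case 0
  then show ?case using assms(3) by (auto intro: continuous_on_compose2)
next
  case (Suc k)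
  note D = higher_differentiable_on_SucD[OF Suc.prems(1)]
  note E = higher_differentiable_on_SucD[OF Suc.prems(2)]
  have der: "((\<lambda>x. f (g x)) has_derivative
      (\<lambda>v. \<Sum>i\<in>Basis. (frechet_derivative g (at x) v \<bullet> i) *\<^sub>R frechet_derivative f (at (g x)) i)) (at x)"
    if "x \<in> S" for x
  proof -
    have fd: "(f has_derivative frechet_derivative f (at (g x))) (at (g x))"
      using D(1) that assms(3) by auto
    have chain: "((\<lambda>x. f (g x)) has_derivative
        (\<lambda>v. frechet_derivative f (at (g x)) (frechet_derivative g (at x) v))) (at x)"
      by (rule has_derivative_compose[OF E(1)[OF that] fd])
    have expand: "frechet_derivative f (at (g x)) w =
        (\<Sum>i\<in>Basis. (w \<bullet> i) *\<^sub>R frechet_derivative f (at (g x)) i)" for w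
      using arg_cong[OF euclidean_representation[of w], of "frechet_derivative f (at (g x))"]
      by (simp add: linear_sum[OF has_derivative_linear[OF fd]] linear_cmul[OF has_derivative_linear[OF fd]])
    show ?thesis by (rule has_derivative_eq_rhs[OF chain]) (rule ext, rule expand)
  qed
  show ?case
    by (rule higher_differentiable_on_SucI[OF assms(1) der])
      (assumption | intro higher_differentiable_on_sum higher_differentiable_on_scaleR assms(1)
        higher_differentiable_on_linear_comp[OF assms(1) bounded_linear_inner_left] E(2)
        Suc.IH D(2) higher_differentiable_on_lower[OF Suc.prems(2)])+
qed

lemma smooth_on_const: "open S \<Longrightarrow> smooth_on S (\<lambda>x. c)"
  and smooth_on_bounded_linear: "open S \<Longrightarrow> bounded_linear L \<Longrightarrow> smooth_on S L"
  and smooth_on_add: "open S \<Longrightarrow> smooth_on S f \<Longrightarrow> smooth_on S g \<Longrightarrow> smooth_on S (\<lambda>x. f x + g x)"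
  and smooth_on_scaleR: "open S \<Longrightarrow> smooth_on S a \<Longrightarrow> smooth_on S f \<Longrightarrow> smooth_on S (\<lambda>x. a x *\<^sub>R f x)"
  and smooth_on_sum: "open S \<Longrightarrow> (\<And>i. i \<in> I \<Longrightarrow> smooth_on S (F i)) \<Longrightarrow> smooth_on S (\<lambda>x. \<Sum>i\<in>I. F i x)"
  by (auto simp: smooth_on_def intro: higher_differentiable_on_const
      higher_differentiable_on_bounded_linear higher_differentiable_on_add
      higher_differentiable_on_scaleR higher_differentiable_on_sum)

lemma smooth_on_compose:
  fixes g :: "'a::euclidean_space \<Rightarrow> 'b::euclidean_space"
  assumes "open S" "open T" "g ` S \<subseteq> T" "smooth_on T f" "smooth_on S g"
  shows "smooth_on S (\<lambda>x. f (g x))"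
  using assms higher_differentiable_on_compose unfolding smooth_on_def by blast

lemma smooth_on_subset: "smooth_on T f \<Longrightarrow> S \<subseteq> T \<Longrightarrow> smooth_on S f"
  by (auto simp: smooth_on_def intro: higher_differentiable_on_subset)

lemma smooth_on_has_derivative:
  assumes "smooth_on S f" "x \<in> S"
  shows "(f has_derivative frechet_derivative f (at x)) (at x)"
  using assms higher_differentiable_on_SucD(1)[of S f 0] unfolding smooth_on_def by blast

lemma smooth_on_frechet:
  assumes "smooth_on S f"
  shows "smooth_on S (\<lambda>x. frechet_derivative f (at x) v)"
  using assms higher_differentiable_on_SucD(2)[of S f] unfolding smooth_on_def by blast

lemma smooth_on_continuous_on: "smooth_on S f \<Longrightarrow> continuous_on S f"
  using higher_differentiable_on.simps(1) unfolding smooth_on_def by blast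

section \<open>Bump functions\<close>

text \<open>The functions \<open>p(1/x) e\<^bsup>-1/x\<^esup>\<close>, extended by zero, form a class that is closed under differentiation;
  this makes the flat function \<open>e\<^bsup>-1/x\<^esup>\<close> smooth, and with it the bump functions below.\<close>

definition exp_flat :: "real poly \<Rightarrow> real \<Rightarrow> real" where
  "exp_flat p x = (if x > 0 then poly p (1/x) * exp (- (1/x)) else 0)"

lemma tendsto_poly_exp_at_top:
  fixes p :: "real poly"
  shows "((\<lambda>y. poly p y * exp (- y)) \<longlongrightarrow> 0) at_top"
proof -
  have "((\<lambda>y. \<Sum>i\<le>degree p. coeff p i * (y ^ i / exp y)) \<longlongrightarrow> (\<Sum>i\<le>degree p. coeff p i * 0)) at_top"
    by (intro tendsto_intros tendsto_power_div_exp_0)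
  moreover have "(\<Sum>i\<le>degree p. coeff p i * (y ^ i / exp y)) = poly p y * exp (- y)" for y
    by (simp add: poly_altdef exp_minus sum_distrib_right divide_inverse mult.assoc)
  ultimately show ?thesis by simp
qed

lemma tendsto_exp_flat_0: "(exp_flat p \<longlongrightarrow> 0) (at 0)"
proof -
  have "((\<lambda>x. poly p (inverse x) * exp (- inverse x)) \<longlongrightarrow> 0) (at_right (0::real))"
    by (rule filterlim_compose[OF tendsto_poly_exp_at_top filterlim_inverse_at_top_right])
  then have r: "(exp_flat p \<longlongrightarrow> 0) (at_right 0)"
    by (rule Lim_transform_eventually)
      (auto simp: exp_flat_def eventually_at_right_less inverse_eq_divide intro!: eventually_mono[OF eventually_at_right_less])
  have l: "(exp_flat p \<longlongrightarrow> 0) (at_left 0)"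
    by (rule Lim_transform_eventually[OF tendsto_const])
      (auto simp: exp_flat_def eventually_at intro!: exI[of _ 1])
  show ?thesis using l r by (simp add: filterlim_split_at)
qed

text \<open>In the variable \<open>y = 1/x\<close> the polynomial on the right is \<open>y\<^sup>2 (p - p')\<close>, since \<open>dy/dx = - y\<^sup>2\<close>.\<close>

lemma exp_flat_deriv:
  "(exp_flat p has_field_derivative exp_flat ([:0,0,1:] * (p - pderiv p)) x) (at x)"
proof -
  consider "x > 0" | "x < 0" | "x = 0" by linarith
  then show ?thesis
  proof cases
    case 1
    have "((\<lambda>x. poly p (1/x) * exp (- (1/x))) has_field_derivative
        exp_flat ([:0,0,1:] * (p - pderiv p)) x) (at x)"
      using 1 by (auto intro!: derivative_eq_intros DERIV_chain2[where f="poly p"] poly_DERIV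
          simp: exp_flat_def field_simps power2_eq_square)
    then show ?thesis
      by (rule has_field_derivative_transform_within_open[of _ _ _ "{0<..}"])
        (use 1 in \<open>auto simp: exp_flat_def\<close>)
  next
    case 2
    have "((\<lambda>x. 0) has_field_derivative exp_flat ([:0,0,1:] * (p - pderiv p)) x) (at x)"
      using 2 by (auto simp: exp_flat_def)
    then show ?thesis
      by (rule has_field_derivative_transform_within_open[of _ _ _ "{..<0}"])
        (use 2 in \<open>auto simp: exp_flat_def\<close>)
  next
    case 3
    \<comment> \<open>The difference quotient at the origin is again a function of the class, for the polynomial \<open>y p\<close>.\<close>
    have "((\<lambda>h. exp_flat (pCons 0 p) h) \<longlongrightarrow> 0) (at 0)" by (rule tendsto_exp_flat_0)
    then have "((\<lambda>h. (exp_flat p (0 + h) - exp_flat p 0) / h) \<longlongrightarrow> 0) (at 0)"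
      by (rule Lim_transform_eventually)
        (auto simp: exp_flat_def eventually_at field_simps intro!: exI[of _ 1])
    then show ?thesis using 3 by (simp add: DERIV_def exp_flat_def)
  qed
qed

lemma smooth_on_exp_flat: "smooth_on UNIV (exp_flat p)"
proof -
  have "higher_differentiable_on UNIV (exp_flat p) k" for k
  proof (induction k arbitrary: p)
    case 0
    show ?case
      using DERIV_isCont[OF exp_flat_deriv[of p]] by (simp add: continuous_at_imp_continuous_on)
  next
    case (Suc k)
    have "higher_differentiable_on UNIV (\<lambda>x. exp_flat ([:0,0,1:] * (p - pderiv p)) x * v) k" for v
      using higher_differentiable_on_linear_comp[OF open_UNIV bounded_linear_mult_left Suc.IH] .
    then show ?case
      by (intro higher_differentiable_on_SucI[OF open_UNIV
            exp_flat_deriv[unfolded has_field_derivative_def]]) auto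
  qed
  then show ?thesis by (simp add: smooth_on_def)
qed

definition bump :: "'a::euclidean_space \<Rightarrow> real \<Rightarrow> 'a \<Rightarrow> real" where
  "bump a r x = exp_flat 1 (r\<^sup>2 - (x - a) \<bullet> (x - a))"

lemma bump_pos_iff:
  assumes "r > 0" shows "bump a r x > 0 \<longleftrightarrow> x \<in> ball a r"
  using assms norm_lt_square[of "x - a" r]
  by (auto simp: bump_def exp_flat_def dist_norm norm_minus_commute)

lemma bump_nonneg: "bump a r x \<ge> 0"
  by (simp add: bump_def exp_flat_def)

lemma smooth_on_bump: "smooth_on UNIV (bump a r)"
proof -
  have "r\<^sup>2 - (x - a) \<bullet> (x - a) = r\<^sup>2 + (\<Sum>i\<in>Basis. (x \<bullet> i + - (a \<bullet> i)) *\<^sub>R (- (x \<bullet> i) + (a \<bullet> i)))" for x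
    by (subst euclidean_inner)
      (simp add: inner_diff_left algebra_simps sum.distrib sum_subtractf sum_negf)
  moreover have "smooth_on UNIV (\<lambda>x::'a. r\<^sup>2 + (\<Sum>i\<in>Basis. (x \<bullet> i + - (a \<bullet> i)) *\<^sub>R (- (x \<bullet> i) + (a \<bullet> i))))"
    by (intro smooth_on_add smooth_on_sum smooth_on_scaleR smooth_on_const smooth_on_bounded_linear
        open_UNIV bounded_linear_inner_left bounded_linear_minus)
  ultimately have "smooth_on UNIV (\<lambda>x. r\<^sup>2 - (x - a) \<bullet> (x - a))"
    by (simp only:)
  from smooth_on_compose[OF open_UNIV open_UNIV _ smooth_on_exp_flat this]
  show ?thesis by (auto simp: bump_def[abs_def])
qed

section \<open>Mollification of Lipschitz maps\<close>

lemma frechet_derivative_zero: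
  assumes "open U" "x \<in> U" "\<And>y. y \<in> U \<Longrightarrow> f y = 0"
  shows "frechet_derivative f (at x) = (\<lambda>v. 0)"
proof -
  have "(f has_derivative (\<lambda>v. 0)) (at x)"
    by (rule has_derivative_transform_within_open[OF has_derivative_const assms(1,2), of 0])
      (simp add: assms(3))
  then show ?thesis by (rule frechet_derivative_at[symmetric])
qed

lemma integrable_lborel_compact_support:
  fixes f :: "'a::euclidean_space \<Rightarrow> 'b::euclidean_space"
  assumes "continuous_on UNIV f" "compact K" "\<And>x. x \<notin> K \<Longrightarrow> f x = 0"
  shows "integrable lborel f"
proof -
  have "integrable lborel (\<lambda>x. indicator K x *\<^sub>R f x)"
    using assms by (intro borel_integrable_compact) (auto intro: continuous_on_subset)
  moreover have "(\<lambda>x. indicator K x *\<^sub>R f x) = f"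
    using assms(3) by (auto simp: indicator_def)
  ultimately show ?thesis by simp
qed

text \<open>Near any \<open>x\<close> the integrand vanishes outside a fixed box, which reduces the claim to
  differentiation under the integral sign over a box.\<close>

lemma has_derivative_convolution:
  fixes X :: "'a::euclidean_space \<Rightarrow> 'b::euclidean_space" and \<psi> :: "'a \<Rightarrow> real"
  assumes \<psi>: "smooth_on UNIV \<psi>" and supp: "\<And>z. z \<notin> cball 0 e \<Longrightarrow> \<psi> z = 0"
    and X: "continuous_on UNIV X"
  shows "((\<lambda>x. \<integral>y. \<psi> (y - x) *\<^sub>R X y \<partial>lborel) has_derivative
          (\<lambda>v. \<integral>y. frechet_derivative \<psi> (at (y - x)) (- v) *\<^sub>R X y \<partial>lborel)) (at x)"
proof -
  note d\<psi> = smooth_on_has_derivative[OF \<psi> UNIV_I]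
  have c\<psi>: "continuous_on UNIV \<psi>" by (rule smooth_on_continuous_on[OF \<psi>])
  have cd: "continuous_on UNIV (\<lambda>z. frechet_derivative \<psi> (at z) v)" for v
    by (rule smooth_on_continuous_on[OF smooth_on_frechet[OF \<psi>]])
  have suppd: "frechet_derivative \<psi> (at z) v = 0" if "z \<notin> cball 0 e" for z v
    using frechet_derivative_zero[of "- cball 0 e" z \<psi>] that supp open_Compl[OF closed_cball[of "0::'a" e]] by auto
  have cpl: "\<exists>K. compact K \<and> K \<subseteq> cball x0 (e + 1) \<and> (\<forall>y. y \<notin> K \<longrightarrow> y - z \<notin> cball 0 e)"
    if "z \<in> ball x0 1" for z x0 :: 'a
    using that dist_triangle[of x0 _ z]
    by (intro exI[of _ "cball z e"])
      (auto simp: dist_norm norm_minus_commute; smt (verit) dist_norm dist_triangle norm_minus_commute)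
  obtain a :: 'a where "cball x (e + 1) \<subseteq> cbox (- a) a"
    using bounded_subset_cbox_symmetric[OF bounded_cball] by blast
  then obtain a b :: 'a where ab: "cball x (e + 1) \<subseteq> cbox a b" by blast
  have toHK: "(\<integral>y. q (y - z) *\<^sub>R X y \<partial>lborel) = integral (cbox a b) (\<lambda>y. q (y - z) *\<^sub>R X y)"
    if q: "continuous_on UNIV q" and q0: "\<And>w. w \<notin> cball 0 e \<Longrightarrow> q w = 0" and z: "z \<in> ball x 1"
    for q :: "'a \<Rightarrow> real" and z
  proof -
    obtain K where K: "compact K" "K \<subseteq> cball x (e + 1)" "\<And>y. y \<notin> K \<Longrightarrow> y - z \<notin> cball 0 e"
      using cpl[OF z] by blast
    have "continuous_on UNIV (\<lambda>y. q (y - z) *\<^sub>R X y)"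
      by (intro continuous_intros X continuous_on_compose2[OF q]) auto
    then have "integrable lborel (\<lambda>y. q (y - z) *\<^sub>R X y)"
      by (rule integrable_lborel_compact_support[OF _ K(1)]) (use K(3) q0 in auto)
    then have "(\<integral>y. q (y - z) *\<^sub>R X y \<partial>lborel) = integral UNIV (\<lambda>y. q (y - z) *\<^sub>R X y)"
      by (rule integral_lborel[symmetric])
    also have "\<dots> = integral UNIV (\<lambda>y. if y \<in> cbox a b then q (y - z) *\<^sub>R X y else 0)"
      using K(2,3) ab q0 by (intro arg_cong[where f="integral UNIV"] ext) (metis scaleR_zero_left subsetD)
    finally show ?thesis by (simp add: Henstock_Kurzweil_Integration.integral_restrict_UNIV)
  qed
  define D where "D z y = Blinfun (\<lambda>v. frechet_derivative \<psi> (at (y - z)) (- v) *\<^sub>R X y)" for z y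
  have der: "((\<lambda>z. \<psi> (y - z) *\<^sub>R X y) has_derivative
      (\<lambda>v. frechet_derivative \<psi> (at (y - z)) (- v) *\<^sub>R X y)) (at z within U)" for y z U
  proof -
    have "((\<lambda>z. y - z) has_derivative uminus) (at z within U)"
      by (auto intro!: derivative_eq_intros)
    from has_derivative_compose[OF this d\<psi>] show ?thesis
      by (rule has_derivative_scaleR_left)
  qed
  have Dapp: "blinfun_apply (D z y) = (\<lambda>v. frechet_derivative \<psi> (at (y - z)) (- v) *\<^sub>R X y)" for z y
    unfolding D_def by (rule bounded_linear_Blinfun_apply) (rule has_derivative_bounded_linear[OF der])
  have contD: "continuous_on S (\<lambda>(z, y). D z y)" for S
    unfolding split_beta
    by (rule continuous_on_blinfun_componentwise)
      (auto simp: Dapp intro!: continuous_intros continuous_on_compose2[OF X] continuous_on_compose2[OF cd])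
  have cpsi: "continuous_on (cbox a b) (\<lambda>y. \<psi> (y - z) *\<^sub>R X y)" for z
    by (intro continuous_intros continuous_on_compose2[OF X] continuous_on_compose2[OF c\<psi>]) auto
  have "((\<lambda>z. integral (cbox a b) (\<lambda>y. \<psi> (y - z) *\<^sub>R X y)) has_derivative
      integral (cbox a b) (D x)) (at x within ball x 1)"
    by (rule leibniz_rule)
      (auto simp: Dapp intro!: der contD integrable_continuous cpsi)
  then have 1: "((\<lambda>z. integral (cbox a b) (\<lambda>y. \<psi> (y - z) *\<^sub>R X y)) has_derivative
      integral (cbox a b) (D x)) (at x)"
    by (simp add: at_within_open[of x "ball x 1"])
  have "D x integrable_on cbox a b"
    using continuous_on_compose2[OF contD[of UNIV]
        continuous_on_Pair[OF continuous_on_const[of "cbox a b" x] continuous_on_id]]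
    by (intro integrable_continuous) auto
  then have 2: "blinfun_apply (integral (cbox a b) (D x)) v =
      (\<integral>y. frechet_derivative \<psi> (at (y - x)) (- v) *\<^sub>R X y \<partial>lborel)" for v
    using toHK[of "\<lambda>z. frechet_derivative \<psi> (at z) (- v)" x] cd suppd
    by (simp add: blinfun_apply_integral Dapp)
  have 3: "((\<lambda>x. \<integral>y. \<psi> (y - x) *\<^sub>R X y \<partial>lborel) has_derivative integral (cbox a b) (D x)) (at x)"
    by (rule has_derivative_transform_within_open[OF 1 open_ball[of x 1]])
      (use toHK[OF c\<psi> supp] in auto)
  show ?thesis
    by (rule has_derivative_eq_rhs[OF 3]) (auto simp: 2)
qed

lemma smooth_on_convolution:
  fixes X :: "'a::euclidean_space \<Rightarrow> 'b::euclidean_space" and \<psi> :: "'a \<Rightarrow> real"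
  assumes "smooth_on UNIV \<psi>" and "\<And>z. z \<notin> cball 0 e \<Longrightarrow> \<psi> z = 0"
    and X: "continuous_on UNIV X"
  shows "smooth_on UNIV (\<lambda>x. \<integral>y. \<psi> (y - x) *\<^sub>R X y \<partial>lborel)"
proof -
  have "higher_differentiable_on UNIV (\<lambda>x. \<integral>y. \<psi> (y - x) *\<^sub>R X y \<partial>lborel) k" for k
    using assms(1,2)
  proof (induction k arbitrary: \<psi>)
    case 0
    show ?case
      using has_derivative_continuous[OF has_derivative_convolution[OF 0 X]]
      by (simp add: continuous_at_imp_continuous_on)
  next
    case (Suc k)
    have "frechet_derivative \<psi> (at z) v = 0" if "z \<notin> cball 0 e" for z v
      using frechet_derivative_zero[of "- cball 0 e" z \<psi>] that Suc.prems open_Compl[OF closed_cball[of "0::'a" e]]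
      by auto
    then show ?case
      by (intro higher_differentiable_on_SucI[OF open_UNIV has_derivative_convolution[OF Suc.prems X]]
          Suc.IH smooth_on_frechet Suc.prems)
  qed
  then show ?thesis by (simp add: smooth_on_def)
qed

lemma ball_not_null:
  assumes "r > 0" shows "\<not> (AE x in lborel. x \<notin> ball (a::'a::euclidean_space) r)"
proof
  assume "AE x in lborel. x \<notin> ball a r"
  then have "emeasure lborel (ball a r) = 0"
    by (subst (asm) AE_iff_measurable[where N="ball a r"]) auto
  moreover have "emeasure lborel (ball a r) > 0"
    using assms by (simp add: emeasure_ball unit_ball_vol_pos)
  ultimately show False by simp
qed

lemma integral_lborel_shift:
  fixes f :: "'a::euclidean_space \<Rightarrow> 'b::euclidean_space"
  assumes "f \<in> borel_measurable borel"
  shows "(\<integral>y. f (c + y) \<partial>lborel) = (\<integral>y. f y \<partial>lborel)"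
proof -
  have "(\<integral>y. f y \<partial>lborel) = (\<integral>y. f y \<partial>distr lborel borel ((+) c))"
    by (simp add: lborel_distr_plus)
  also have "\<dots> = (\<integral>y. f (c + y) \<partial>lborel)"
    using assms by (intro integral_distr) auto
  finally show ?thesis ..
qed

text \<open>The value \<open>Y x\<close> is a weighted average of the values \<open>X (x + z)\<close> with \<open>|z| \<le> e\<close>. Averaging preserves
  the Lipschitz constant, and it moves each value by at most \<open>\<kappa> e\<close>.\<close>

lemma lipschitz_mollification:
  fixes X :: "'a::euclidean_space \<Rightarrow> 'b::euclidean_space"
  assumes lip: "\<kappa>-lipschitz_on UNIV X" and e: "e > 0"
  obtains Y where "smooth_on UNIV Y" "\<kappa>-lipschitz_on UNIV Y" "\<And>x. norm (Y x - X x) \<le> \<kappa> * e"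
proof -
  define \<psi> :: "'a \<Rightarrow> real" where "\<psi> = bump 0 e"
  define c where "c = (\<integral>z. \<psi> z \<partial>lborel)"
  have \<kappa>: "\<kappa> \<ge> 0" by (rule lipschitz_on_nonneg[OF lip])
  have \<psi>: "smooth_on UNIV \<psi>" and \<psi>0: "\<psi> z \<ge> 0" and \<psi>s: "z \<notin> cball 0 e \<Longrightarrow> \<psi> z = 0" for z
    using smooth_on_bump bump_nonneg bump_pos_iff[OF e, of 0 z] bump_nonneg[of 0 e z]
    by (auto simp: \<psi>_def)
  have c\<psi>: "continuous_on UNIV \<psi>" by (rule smooth_on_continuous_on[OF \<psi>])
  have X: "continuous_on UNIV X" by (rule lipschitz_on_continuous_on[OF lip])
  have int\<psi>: "integrable lborel \<psi>"
    by (rule integrable_lborel_compact_support[OF c\<psi> compact_cball \<psi>s])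
  have intZ: "integrable lborel (\<lambda>z. \<psi> z *\<^sub>R Z z)" if "continuous_on UNIV Z" for Z :: "'a \<Rightarrow> 'b"
    using that by (intro integrable_lborel_compact_support[where K="cball 0 e"] continuous_intros c\<psi>)
      (auto simp: \<psi>s)
  have "c \<noteq> 0"
  proof
    assume "c = 0"
    then have "AE z in lborel. \<psi> z = 0"
      using integral_nonneg_eq_0_iff_AE[OF int\<psi>] \<psi>0 by (simp add: c_def)
    then have "AE z in lborel. z \<notin> ball (0::'a) e"
    proof eventually_elim
      case (elim z)
      then show ?case using bump_pos_iff[OF e, of 0 z] by (simp add: \<psi>_def)
    qed
    then show False using ball_not_null[OF e] by blast
  qed
  moreover have "c \<ge> 0" unfolding c_def by (rule integral_nonneg_AE) (simp add: \<psi>0)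
  ultimately have c: "c > 0" by simp
  define Y where "Y x = (1/c) *\<^sub>R (\<integral>y. \<psi> (y - x) *\<^sub>R X y \<partial>lborel)" for x
  have contX: "continuous_on UNIV (\<lambda>z. X (x + z))" for x
    by (intro continuous_on_compose2[OF X] continuous_intros) auto
  have Y: "Y x = (1/c) *\<^sub>R (\<integral>z. \<psi> z *\<^sub>R X (x + z) \<partial>lborel)" for x
  proof -
    have "continuous_on UNIV (\<lambda>y. \<psi> (y - x) *\<^sub>R X y)"
      by (intro continuous_intros X continuous_on_compose2[OF c\<psi>]) auto
    from integral_lborel_shift[OF borel_measurable_continuous_onI[OF this], of x]
    show ?thesis by (simp add: Y_def)
  qed
  \<comment> \<open>Both estimates compare two averages with the same weight \<open>\<psi> / c\<close>.\<close>
  have avg: "norm ((1/c) *\<^sub>R (\<integral>z. \<psi> z *\<^sub>R Z z \<partial>lborel) - (1/c) *\<^sub>R (\<integral>z. \<psi> z *\<^sub>R Z' z \<partial>lborel)) \<le> B"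
    if Z: "continuous_on UNIV Z" "continuous_on UNIV Z'"
      and B: "\<And>z. z \<in> cball 0 e \<Longrightarrow> norm (Z z - Z' z) \<le> B" for Z Z' :: "'a \<Rightarrow> 'b" and B
  proof -
    have eq: "(\<integral>z. \<psi> z *\<^sub>R Z z \<partial>lborel) - (\<integral>z. \<psi> z *\<^sub>R Z' z \<partial>lborel) =
        (\<integral>z. \<psi> z *\<^sub>R (Z z - Z' z) \<partial>lborel)"
      by (simp add: Bochner_Integration.integral_diff[OF intZ[OF Z(1)] intZ[OF Z(2)], symmetric]
          scaleR_diff_right)
    have bnd: "norm (\<integral>z. \<psi> z *\<^sub>R (Z z - Z' z) \<partial>lborel) \<le> (\<integral>z. \<psi> z * B \<partial>lborel)"
    proof (rule order_trans[OF integral_norm_bound], rule integral_mono)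
      show "integrable lborel (\<lambda>z. norm (\<psi> z *\<^sub>R (Z z - Z' z)))"
        by (intro integrable_norm intZ continuous_intros Z)
      show "integrable lborel (\<lambda>z. \<psi> z * B)" using int\<psi> by simp
      show "norm (\<psi> z *\<^sub>R (Z z - Z' z)) \<le> \<psi> z * B" for z
        using B[of z] \<psi>s[of z] \<psi>0[of z] by (cases "z \<in> cball 0 e") (auto intro: mult_left_mono)
    qed
    have "norm (\<integral>z. \<psi> z *\<^sub>R (Z z - Z' z) \<partial>lborel) \<le> c * B"
      using bnd by (simp add: c_def mult.commute)
    then have "norm (\<integral>z. \<psi> z *\<^sub>R (Z z - Z' z) \<partial>lborel) / c \<le> B"
      using c by (simp add: divide_le_eq mult.commute)
    then show ?thesis
      using c by (simp flip: scaleR_diff_right eq)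
  qed
  have one: "X x = (1/c) *\<^sub>R (\<integral>z. \<psi> z *\<^sub>R X x \<partial>lborel)" for x
  proof -
    have "(\<integral>z. \<psi> z *\<^sub>R X x \<partial>lborel) = c *\<^sub>R X x"
      using int\<psi> by (simp add: c_def)
    then show ?thesis using c by simp
  qed
  show thesis
  proof
    show "smooth_on UNIV Y"
      unfolding Y_def
      by (intro smooth_on_scaleR smooth_on_const smooth_on_convolution[OF \<psi> \<psi>s X] open_UNIV) auto
    show "\<kappa>-lipschitz_on UNIV Y"
    proof (rule lipschitz_onI[OF _ \<kappa>])
      fix x y
      have "norm (Y x - Y y) \<le> \<kappa> * norm (x - y)"
        unfolding Y by (rule avg[OF contX contX]) 
          (use lipschitz_on_normD[OF lip UNIV_I UNIV_I, of "x + z" "y + z" for z] in simp)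
      then show "dist (Y x) (Y y) \<le> \<kappa> * dist x y" by (simp add: dist_norm)
    qed
    show "norm (Y x - X x) \<le> \<kappa> * e" for x
    proof (subst one, unfold Y, rule avg[OF contX continuous_on_const])
      fix z :: 'a assume "z \<in> cball 0 e"
      then have "\<kappa> * norm z \<le> \<kappa> * e" using \<kappa> by (intro mult_left_mono) auto
      then show "norm (X (x + z) - X x) \<le> \<kappa> * e"
        using lipschitz_on_normD[OF lip UNIV_I UNIV_I, of "x + z" x] by simp
    qed
  qed
qed

section \<open>Volume distortion of Lipschitz maps\<close>

text \<open>Up to a null set, \<open>S\<close> is a disjoint union of balls. Each of them is mapped into a ball whose radius
  is larger at most by the factor \<open>L\<close>, and Lipschitz maps preserve null sets.\<close>

lemma emeasure_lipschitz_image_open: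
  fixes G :: "'a::euclidean_space \<Rightarrow> 'a"
  assumes lip: "L-lipschitz_on UNIV G" and S: "open S" and GS: "G ` S \<in> sets borel"
  shows "emeasure lborel (G ` S) \<le> ennreal (L ^ DIM('a)) * emeasure lborel S"
proof -
  have L: "L \<ge> 0" by (rule lipschitz_on_nonneg[OF lip])
  define K where "K = {(x, r). 0 < r \<and> cball x r \<subseteq> S}"
  have K_pos: "0 < snd i" if "i \<in> K" for i using that by (auto simp: K_def)
  have K_fine: "\<exists>i. i \<in> K \<and> x \<in> cball (fst i) (snd i) \<and> snd i < d" if "x \<in> S" "(0::real) < d" for x d
  proof -
    obtain r where r: "r > 0" "cball x r \<subseteq> S" using S \<open>x \<in> S\<close> open_contains_cball by blast
    then have "cball x (min r (d/2)) \<subseteq> S" by auto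
    then show ?thesis
      using r \<open>d > 0\<close> by (intro exI[of _ "(x, min r (d/2))"]) (auto simp: K_def)
  qed
  obtain C where C: "countable C" "C \<subseteq> K"
    "pairwise (\<lambda>i j. disjnt (cball (fst i) (snd i)) (cball (fst j) (snd j))) C"
    "negligible (S - (\<Union>i\<in>C. cball (fst i) (snd i)))"
    by (rule Vitali_covering_theorem_cballs[of K snd S fst, OF K_pos K_fine])
  \<comment> \<open>The countable family is re-indexed by the natural numbers, with empty sets for the unused indices.\<close>
  define I where "I = to_nat_on C ` C"
  define i where "i = inv_into C (to_nat_on C)"
  have i: "i n \<in> C" if "n \<in> I" for n using that by (auto simp: i_def I_def inv_into_into)
  have i_inj: "i m \<noteq> i n" if "m \<in> I" "n \<in> I" "m \<noteq> n" for m n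
    using that inv_into_injective[of C "to_nat_on C" m n] unfolding i_def I_def by blast
  have i_surj: "\<exists>n\<in>I. i n = p" if "p \<in> C" for p
    using inv_into_f_f[OF inj_on_to_nat_on[OF C(1)] that] that by (auto simp: i_def I_def)
  define A where "A n = (if n \<in> I then cball (fst (i n)) (snd (i n)) else {})" for n
  define B where "B n = (if n \<in> I then cball (G (fst (i n))) (L * snd (i n)) else {})" for n
  have disj: "disjoint_family A"
    using C(3) i i_inj by (auto simp: disjoint_family_on_def A_def pairwise_def disjnt_def)
  have AB: "emeasure lborel (B n) = ennreal (L ^ DIM('a)) * emeasure lborel (A n)" for n
  proof (cases "n \<in> I")
    case True
    then have "0 < snd (i n)" using i C(2) by (force simp: K_def)
    then show ?thesis using True L
      by (simp add: A_def B_def emeasure_cball power_mult_distrib ennreal_mult[symmetric] mult_ac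
          unit_ball_vol_nonneg)
  qed (simp add: A_def B_def)
  have AS: "(\<Union>n. A n) \<subseteq> S" using i C(2) by (fastforce simp: A_def K_def split: if_splits)
  have "negligible (G ` (S - (\<Union>i\<in>C. cball (fst i) (snd i))))"
    by (rule negligible_locally_Lipschitz_image[OF order_refl C(4)])
      (use lipschitz_on_normD[OF lip] in \<open>auto intro!: exI[of _ UNIV] exI[of _ L]\<close>)
  then obtain N where N: "N \<in> null_sets lborel" "G ` (S - (\<Union>i\<in>C. cball (fst i) (snd i))) \<subseteq> N"
    by (auto simp: negligible_iff_null_sets null_sets_completion_iff2)
  have "G ` S \<subseteq> (\<Union>n. B n) \<union> N"
  proof
    fix y assume "y \<in> G ` S"
    then obtain x where x: "x \<in> S" "y = G x" by blast
    show "y \<in> (\<Union>n. B n) \<union> N"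
    proof (cases "x \<in> (\<Union>i\<in>C. cball (fst i) (snd i))")
      case True
      then obtain p where p: "p \<in> C" "dist (fst p) x \<le> snd p" by auto
      obtain n where n: "n \<in> I" "i n = p" using i_surj[OF p(1)] by blast
      have "dist (G (fst p)) (G x) \<le> L * dist (fst p) x" by (rule lipschitz_onD[OF lip]) auto
      also have "\<dots> \<le> L * snd p" using p(2) L by (rule mult_left_mono)
      finally have "y \<in> B n" using n x by (simp add: B_def)
      then show ?thesis by blast
    qed (use N(2) x in blast)
  qed
  then have "emeasure lborel (G ` S) \<le> emeasure lborel ((\<Union>n. B n) \<union> N)"
    using N(1) by (intro emeasure_mono) (auto simp: B_def)
  also have "\<dots> = emeasure lborel (\<Union>n. B n)"
    using N(1) by (intro emeasure_Un_null_set) (auto simp: B_def)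
  also have "\<dots> \<le> (\<Sum>n. emeasure lborel (B n))"
    by (intro emeasure_subadditive_countably) (auto simp: B_def)
  also have "\<dots> = ennreal (L ^ DIM('a)) * (\<Sum>n. emeasure lborel (A n))"
    by (simp add: AB)
  also have "(\<Sum>n. emeasure lborel (A n)) = emeasure lborel (\<Union>n. A n)"
    by (rule suminf_emeasure[OF _ disj]) (auto simp: A_def)
  also have "\<dots> \<le> emeasure lborel S"
    using AS S by (intro emeasure_mono) auto
  finally show ?thesis by (simp add: mult_left_mono)
qed

text \<open>The image of Lebesgue measure under \<open>F\<close> assigns to a set the volume of its image under the inverse
  \<open>G\<close>, so this is the bound for open sets, extended to Borel sets by outer regularity.\<close>

lemma nn_integral_lipschitz_le:
  fixes F G :: "'a::euclidean_space \<Rightarrow> 'a"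
  assumes F: "continuous_on UNIV F" and lip: "L-lipschitz_on UNIV G"
    and GF: "\<And>x. G (F x) = x" and FG: "\<And>y. F (G y) = y"
    and h: "h \<in> borel_measurable borel"
  shows "(\<integral>\<^sup>+x. h (F x) \<partial>lborel) \<le> ennreal (L ^ DIM('a)) * (\<integral>\<^sup>+y. h y \<partial>lborel)"
proof -
  let ?c = "ennreal (L ^ DIM('a))"
  have Fm[measurable]: "F \<in> borel_measurable borel" by (rule borel_measurable_continuous_onI[OF F])
  have img: "G ` A = F -` A" for A
  proof
    show "G ` A \<subseteq> F -` A" by (auto simp: FG)
    show "F -` A \<subseteq> G ` A"
    proof
      fix x assume "x \<in> F -` A"
      then show "x \<in> G ` A" using image_eqI[of x G "F x" A] by (simp add: GF)
    qed
  qed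
  have emF: "emeasure (distr lborel borel F) A = emeasure lborel (G ` A)" if "A \<in> sets borel" for A
    using that by (subst emeasure_distr) (auto simp: img)
  have Gs: "G ` A \<in> sets borel" if "A \<in> sets borel" for A
    unfolding img using measurable_sets[OF Fm that] by simp
  have le: "emeasure lborel (G ` A) \<le> ?c * emeasure lborel A" if A: "A \<in> sets borel" for A
  proof (rule ennreal_le_epsilon)
    fix e :: real assume e: "e > 0"
    have L: "L ^ DIM('a) \<ge> 0" using lipschitz_on_nonneg[OF lip] by simp
    define d where "d = e / (L ^ DIM('a) + 1)"
    have d: "d > 0" "L ^ DIM('a) * d \<le> e" using e L by (auto simp: d_def field_simps add_pos_nonneg)
    obtain U where U: "open U" "A \<subseteq> U" "emeasure lborel (U - A) < ennreal d"
      using outer_regular_lborel[OF A d(1)] by blast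
    have "emeasure lborel (G ` A) \<le> emeasure lborel (G ` U)"
      using U by (intro emeasure_mono) (auto intro: Gs)
    also have "\<dots> \<le> ?c * emeasure lborel U"
      using U(1) by (intro emeasure_lipschitz_image_open[OF lip] Gs) auto
    also have "emeasure lborel U = emeasure lborel A + emeasure lborel (U - A)"
      using U A by (subst plus_emeasure) (auto intro!: arg_cong[where f="emeasure lborel"])
    also have "?c * \<dots> \<le> ?c * emeasure lborel A + ?c * ennreal d"
      using U(3) by (simp add: distrib_left mult_left_mono)
    also have "\<dots> \<le> ?c * emeasure lborel A + ennreal e"
      using d L by (intro add_left_mono) (simp add: ennreal_mult[symmetric] ennreal_leI)
    finally show "emeasure lborel (G ` A) \<le> ?c * emeasure lborel A + ennreal e" .
  qed
  have "(\<integral>\<^sup>+x. h (F x) \<partial>lborel) = (\<integral>\<^sup>+x. h x \<partial>distr lborel borel F)"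
    using h by (simp add: nn_integral_distr)
  also have "\<dots> \<le> (\<integral>\<^sup>+x. h x \<partial>scale_measure ?c lborel)"
  proof (rule nn_integral_mono_measure)
    show "distr lborel borel F \<le> scale_measure ?c lborel"
      by (subst le_measure) (auto simp: emF le)
  qed simp
  also have "\<dots> = ?c * (\<integral>\<^sup>+y. h y \<partial>lborel)"
    using h by (simp add: nn_integral_scale_measure)
  finally show ?thesis .
qed

section \<open>Test functions and weak gradients\<close>

lemma test_functionsD:
  assumes "\<eta> \<in> test_functions \<Omega>"
  obtains K where "compact K" "K \<subseteq> \<Omega>" "smooth_on UNIV \<eta>"
    "\<And>x. x \<notin> K \<Longrightarrow> \<eta> x = 0" "\<And>x. x \<notin> K \<Longrightarrow> frechet_derivative \<eta> (at x) = (\<lambda>v. 0)"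
proof
  let ?K = "closure {x. \<eta> x \<noteq> 0}"
  show "compact ?K" "?K \<subseteq> \<Omega>" "smooth_on UNIV \<eta>"
    using assms by (auto simp: test_functions_def)
  show zero: "\<eta> x = 0" if "x \<notin> ?K" for x
    using that closure_subset[of "{x. \<eta> x \<noteq> 0}"] by blast
  show "frechet_derivative \<eta> (at x) = (\<lambda>v. 0)" if "x \<notin> ?K" for x
    by (rule frechet_derivative_zero[OF open_Compl[OF closed_closure]]) (use that zero in blast)+
qed

lemma test_functionsI:
  assumes "smooth_on UNIV \<eta>" "compact K" "K \<subseteq> \<Omega>" "\<And>x. x \<notin> K \<Longrightarrow> \<eta> x = 0"
  shows "\<eta> \<in> test_functions \<Omega>"
proof -
  have "closure {x. \<eta> x \<noteq> 0} \<subseteq> K"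
    using assms(4) by (intro closure_minimal compact_imp_closed[OF assms(2)]) auto
  then show ?thesis
    using assms compact_closure bounded_subset[OF compact_imp_bounded[OF assms(2)]]
      closure_subset[of "{x. \<eta> x \<noteq> 0}"]
    by (simp add: test_functions_def)
qed

lemma test_functions_frechet:
  assumes "\<eta> \<in> test_functions \<Omega>"
  shows "(\<lambda>x. frechet_derivative \<eta> (at x) v) \<in> test_functions \<Omega>"
proof -
  obtain K where K: "compact K" "K \<subseteq> \<Omega>" "smooth_on UNIV \<eta>"
    "\<And>x. x \<notin> K \<Longrightarrow> frechet_derivative \<eta> (at x) = (\<lambda>v. 0)"
    using test_functionsD[OF assms] by metis
  show ?thesis
    by (rule test_functionsI[OF smooth_on_frechet[OF K(3)] K(1,2)]) (simp add: K(4))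
qed

lemma classical_gradient_inner_Basis:
  "i \<in> Basis \<Longrightarrow> classical_gradient f x \<bullet> i = frechet_derivative f (at x) i"
  by (simp add: classical_gradient_def)

lemma classical_gradient_inner:
  assumes "f differentiable (at x)"
  shows "classical_gradient f x \<bullet> v = frechet_derivative f (at x) v"
proof -
  have lin: "linear (frechet_derivative f (at x))" by (rule linear_frechet_derivative[OF assms])
  have "frechet_derivative f (at x) v = frechet_derivative f (at x) (\<Sum>i\<in>Basis. (v \<bullet> i) *\<^sub>R i)"
    by (simp add: euclidean_representation)
  also have "\<dots> = (\<Sum>i\<in>Basis. (v \<bullet> i) * frechet_derivative f (at x) i)"
    by (simp add: linear_sum[OF lin] linear_cmul[OF lin])
  also have "\<dots> = (\<Sum>i\<in>Basis. (v \<bullet> i) * (classical_gradient f x \<bullet> i))"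
    by (intro sum.cong) (simp_all add: classical_gradient_inner_Basis)
  also have "\<dots> = classical_gradient f x \<bullet> v"
    by (subst euclidean_inner) (simp add: mult.commute)
  finally show ?thesis ..
qed

lemma continuous_on_classical_gradient:
  assumes "smooth_on UNIV \<eta>" shows "continuous_on UNIV (classical_gradient \<eta>)"
  unfolding classical_gradient_def[abs_def]
  by (intro continuous_intros smooth_on_continuous_on[OF smooth_on_frechet[OF assms]])

lemma test_functions_gradientD:
  assumes "\<eta> \<in> test_functions \<Omega>"
  obtains K where "compact K" "K \<subseteq> \<Omega>" "smooth_on UNIV \<eta>" "\<And>x. x \<notin> K \<Longrightarrow> \<eta> x = 0"
    "\<And>x. x \<notin> K \<Longrightarrow> classical_gradient \<eta> x = 0"
proof -
  obtain K where K: "compact K" "K \<subseteq> \<Omega>" "smooth_on UNIV \<eta>" "\<And>x. x \<notin> K \<Longrightarrow> \<eta> x = 0"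
    "\<And>x. x \<notin> K \<Longrightarrow> frechet_derivative \<eta> (at x) = (\<lambda>v. 0)"
    using test_functionsD[OF assms] by metis
  show thesis by (rule that[OF K(1-4)]) (simp_all add: classical_gradient_def K(5))
qed

lemma borel_measurable_lebesgue_on:
  "f \<in> borel_measurable borel \<Longrightarrow> f \<in> borel_measurable (lebesgue_on \<Omega>)"
  by (intro measurable_restrict_space1 measurable_completion) simp

lemma nn_integral_lebesgue_on:
  fixes f :: "'a::euclidean_space \<Rightarrow> ennreal"
  assumes "open \<Omega>" "\<And>x. x \<notin> \<Omega> \<Longrightarrow> f x = 0"
  shows "(\<integral>\<^sup>+x. f x \<partial>lebesgue_on \<Omega>) = (\<integral>\<^sup>+x. f x \<partial>lborel)"
proof -
  have "(\<integral>\<^sup>+x. f x \<partial>lebesgue_on \<Omega>) = (\<integral>\<^sup>+x. f x * indicator \<Omega> x \<partial>lebesgue)"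
    using assms(1) by (intro nn_integral_restrict_space) simp
  also have "(\<lambda>x. f x * indicator \<Omega> x) = f"
    using assms(2) by (auto simp: indicator_def)
  finally show ?thesis by (simp add: nn_integral_completion)
qed

lemma lebesgue_on_integral:
  fixes f :: "'a::euclidean_space \<Rightarrow> 'b::euclidean_space"
  assumes "open \<Omega>" "\<And>x. x \<notin> \<Omega> \<Longrightarrow> f x = 0" "f \<in> borel_measurable borel"
  shows "(\<integral>x. f x \<partial>lebesgue_on \<Omega>) = (\<integral>x. f x \<partial>lborel)"
    and "integrable (lebesgue_on \<Omega>) f \<longleftrightarrow> integrable lborel f"
proof -
  have eq: "(\<lambda>x. indicator \<Omega> x *\<^sub>R f x) = f"
    using assms(2) by (auto simp: indicator_def)
  show "(\<integral>x. f x \<partial>lebesgue_on \<Omega>) = (\<integral>x. f x \<partial>lborel)"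
    using assms(1,3) by (subst integral_restrict_space) (simp_all add: eq integral_completion)
  show "integrable (lebesgue_on \<Omega>) f \<longleftrightarrow> integrable lborel f"
    using assms(1,3) by (subst integrable_restrict_space) (simp_all add: eq integrable_completion)
qed

lemma lebesgue_on_compact_support:
  fixes f :: "'a::euclidean_space \<Rightarrow> 'b::euclidean_space"
  assumes "open \<Omega>" "compact K" "K \<subseteq> \<Omega>" "continuous_on UNIV f" "\<And>x. x \<notin> K \<Longrightarrow> f x = 0"
  shows "integrable (lebesgue_on \<Omega>) f" "(\<integral>x. f x \<partial>lebesgue_on \<Omega>) = (\<integral>x. f x \<partial>lborel)"
proof -
  have "f x = 0" if "x \<notin> \<Omega>" for x using that assms(3,5) by blast
  note f = lebesgue_on_integral[OF assms(1) this borel_measurable_continuous_onI[OF assms(4)]]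
  show "integrable (lebesgue_on \<Omega>) f"
    using integrable_lborel_compact_support[OF assms(4,2,5)] f(2) by blast
  show "(\<integral>x. f x \<partial>lebesgue_on \<Omega>) = (\<integral>x. f x \<partial>lborel)" by (rule f(1))
qed

text \<open>By translation invariance the convolution of \<open>\<psi>\<close> with the constant \<open>1\<close> is constant. Its derivative,
  which therefore vanishes, is the integral in question up to
  sign.\<close>

lemma integral_derivative_eq_0:
  fixes \<psi> :: "'a::euclidean_space \<Rightarrow> real"
  assumes \<psi>: "smooth_on UNIV \<psi>" and "compact K" "\<And>z. z \<notin> K \<Longrightarrow> \<psi> z = 0"
  shows "(\<integral>y. frechet_derivative \<psi> (at y) v \<partial>lborel) = 0"
proof -
  obtain e where "K \<subseteq> cball 0 e"
    using bounded_subset_ballD[OF compact_imp_bounded[OF assms(2)], of 0] ball_subset_cball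
    by (meson order_trans)
  then have supp: "\<psi> z = 0" if "z \<notin> cball 0 e" for z using assms(3) that by blast
  have "((\<lambda>x. \<integral>y. \<psi> (y - x) *\<^sub>R (1::real) \<partial>lborel) has_derivative
      (\<lambda>v. \<integral>y. frechet_derivative \<psi> (at (y - 0)) (- v) *\<^sub>R 1 \<partial>lborel)) (at 0)"
    by (rule has_derivative_convolution[OF \<psi> supp continuous_on_const])
  moreover have "(\<integral>y. \<psi> (y - x) *\<^sub>R (1::real) \<partial>lborel) = (\<integral>y. \<psi> y \<partial>lborel)" for x
  proof -
    have "\<psi> \<in> borel_measurable borel"
      by (rule borel_measurable_continuous_onI[OF smooth_on_continuous_on[OF \<psi>]])
    from integral_lborel_shift[OF this, of "- x"] show ?thesis by simp
  qed
  ultimately have "((\<lambda>x::'a. \<integral>y. \<psi> y \<partial>lborel) has_derivative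
      (\<lambda>v. \<integral>y. frechet_derivative \<psi> (at y) (- v) \<partial>lborel)) (at 0)"
    by simp
  then have "(\<lambda>v. \<integral>y. frechet_derivative \<psi> (at y) (- v) \<partial>lborel) = (\<lambda>v. 0)"
    by (rule has_derivative_unique) (rule has_derivative_const)
  from fun_cong[OF this, of "- v"] show ?thesis by simp
qed

lemma test_function_integration_by_parts:
  assumes \<eta>: "\<eta> \<in> test_functions \<Omega>" and \<psi>: "\<psi> \<in> test_functions \<Omega>"
  shows "(\<integral>x. \<eta> x * frechet_derivative \<psi> (at x) v \<partial>lborel) =
    - (\<integral>x. frechet_derivative \<eta> (at x) v * \<psi> x \<partial>lborel)"
proof -
  obtain K where K: "compact K" "smooth_on UNIV \<eta>" "\<And>x. x \<notin> K \<Longrightarrow> \<eta> x = 0"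
    "\<And>x. x \<notin> K \<Longrightarrow> frechet_derivative \<eta> (at x) = (\<lambda>v. 0)"
    using test_functionsD[OF \<eta>] by metis
  have s\<psi>: "smooth_on UNIV \<psi>" using test_functionsD[OF \<psi>] by metis
  note d = smooth_on_has_derivative[OF K(2) UNIV_I] smooth_on_has_derivative[OF s\<psi> UNIV_I]
  have D: "((\<lambda>x. \<eta> x * \<psi> x) has_derivative (\<lambda>v. \<eta> x * frechet_derivative \<psi> (at x) v +
      frechet_derivative \<eta> (at x) v * \<psi> x)) (at x)" for x
    by (rule has_derivative_mult[OF d])
  have eq: "frechet_derivative (\<lambda>x. \<eta> x * \<psi> x) (at x) v =
      \<eta> x * frechet_derivative \<psi> (at x) v + frechet_derivative \<eta> (at x) v * \<psi> x" for x
    using fun_cong[OF frechet_derivative_at[OF D[of x]], where x=v] by simp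
  have "smooth_on UNIV (\<lambda>x. \<eta> x *\<^sub>R \<psi> x)"
    by (intro smooth_on_scaleR open_UNIV K(2) s\<psi>)
  then have "(\<integral>x. frechet_derivative (\<lambda>x. \<eta> x * \<psi> x) (at x) v \<partial>lborel) = 0"
    using K(1) by (intro integral_derivative_eq_0[of _ K]) (simp_all add: K(3))
  then have "(\<integral>x. \<eta> x * frechet_derivative \<psi> (at x) v + frechet_derivative \<eta> (at x) v * \<psi> x \<partial>lborel) = 0"
    by (simp add: eq)
  moreover have "integrable lborel (\<lambda>x. \<eta> x * frechet_derivative \<psi> (at x) v)"
    "integrable lborel (\<lambda>x. frechet_derivative \<eta> (at x) v * \<psi> x)"
    by (intro integrable_lborel_compact_support[OF _ K(1)] continuous_intros
        smooth_on_continuous_on[OF K(2)] smooth_on_continuous_on[OF s\<psi>]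
        smooth_on_continuous_on[OF smooth_on_frechet[OF K(2)]]
        smooth_on_continuous_on[OF smooth_on_frechet[OF s\<psi>]]; simp add: K(3,4))+
  ultimately show ?thesis by simp
qed

lemma L2_on_continuous_compact:
  fixes f :: "'a::euclidean_space \<Rightarrow> 'b::euclidean_space"
  assumes "open \<Omega>" "compact K" "K \<subseteq> \<Omega>" "continuous_on UNIV f" "\<And>x. x \<notin> K \<Longrightarrow> f x = 0"
  shows "L2_on \<Omega> f"
  unfolding L2_on_def
proof
  show "f \<in> borel_measurable (lebesgue_on \<Omega>)"
    by (intro borel_measurable_lebesgue_on borel_measurable_continuous_onI assms)
  show "integrable (lebesgue_on \<Omega>) (\<lambda>x. (norm (f x))\<^sup>2)"
    by (rule lebesgue_on_compact_support[OF assms(1,2,3)])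
      (auto intro!: continuous_intros assms simp: assms(5))
qed

text \<open>In particular the classical gradient is a weak gradient, so that test functions are admissible in
  the infimum that defines the Hardy constant.\<close>

lemma test_function_in_H10:
  assumes "open \<Omega>" and \<eta>: "\<eta> \<in> test_functions \<Omega>"
  shows "has_H1_gradient \<Omega> \<eta> (classical_gradient \<eta>)" "\<eta> \<in> H10 \<Omega>"
proof -
  obtain K where K: "compact K" "K \<subseteq> \<Omega>" "smooth_on UNIV \<eta>" "\<And>x. x \<notin> K \<Longrightarrow> \<eta> x = 0"
    "\<And>x. x \<notin> K \<Longrightarrow> classical_gradient \<eta> x = 0"
    using test_functions_gradientD[OF \<eta>] by metis
  note cont = smooth_on_continuous_on[OF K(3)] continuous_on_classical_gradient[OF K(3)]
  show H: "has_H1_gradient \<Omega> \<eta> (classical_gradient \<eta>)"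
    unfolding has_H1_gradient_def
  proof (intro conjI ballI)
    show "L2_on \<Omega> \<eta>" by (rule L2_on_continuous_compact[OF assms(1) K(1,2) cont(1) K(4)])
    show "L2_on \<Omega> (classical_gradient \<eta>)"
      by (rule L2_on_continuous_compact[OF assms(1) K(1,2) cont(2) K(5)])
    fix \<psi> i assume \<psi>: "\<psi> \<in> test_functions \<Omega>" and i: "i \<in> (Basis :: 'a set)"
    have "smooth_on UNIV \<psi>" using test_functionsD[OF \<psi>] by metis
    note cont\<psi> = smooth_on_continuous_on[OF this] continuous_on_classical_gradient[OF this]
    have "(LINT x|lebesgue_on \<Omega>. \<eta> x * (classical_gradient \<psi> x \<bullet> i)) =
        (LINT x|lborel. \<eta> x * (classical_gradient \<psi> x \<bullet> i))"
      by (rule lebesgue_on_compact_support[OF assms(1) K(1,2)])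
        (auto intro!: continuous_intros cont cont\<psi> simp: K)
    moreover have "(LINT x|lebesgue_on \<Omega>. (classical_gradient \<eta> x \<bullet> i) * \<psi> x) =
        (LINT x|lborel. (classical_gradient \<eta> x \<bullet> i) * \<psi> x)"
      by (rule lebesgue_on_compact_support[OF assms(1) K(1,2)])
        (auto intro!: continuous_intros cont cont\<psi> simp: K)
    ultimately show "(LINT x|lebesgue_on \<Omega>. \<eta> x * (classical_gradient \<psi> x \<bullet> i)) =
        - (LINT x|lebesgue_on \<Omega>. (classical_gradient \<eta> x \<bullet> i) * \<psi> x)"
      using test_function_integration_by_parts[OF \<eta> \<psi>, of i]
      by (simp add: classical_gradient_inner_Basis[OF i])
  qed
  show "\<eta> \<in> H10 \<Omega>"
    unfolding H10_def
    by (rule CollectI, rule exI[of _ "classical_gradient \<eta>"]) (use H \<eta> in \<open>auto intro!: bexI[of _ \<eta>]\<close>)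
qed

lemma L2_on_inner_integrable:
  fixes f g :: "'a::euclidean_space \<Rightarrow> 'b::euclidean_space"
  assumes "L2_on \<Omega> f" "L2_on \<Omega> g"
  shows "integrable (lebesgue_on \<Omega>) (\<lambda>x. f x \<bullet> g x)"
proof (rule Bochner_Integration.integrable_bound)
  show "integrable (lebesgue_on \<Omega>) (\<lambda>x. (norm (f x))\<^sup>2 + (norm (g x))\<^sup>2)"
    using assms by (auto simp: L2_on_def)
  show "(\<lambda>x. f x \<bullet> g x) \<in> borel_measurable (lebesgue_on \<Omega>)"
    using assms by (auto simp: L2_on_def)
  have "\<bar>a \<bullet> b\<bar> \<le> (norm a)\<^sup>2 + (norm b)\<^sup>2" for a b :: 'b
  proof -
    have "\<bar>a \<bullet> b\<bar> \<le> norm a * norm b" by (rule Cauchy_Schwarz_ineq2)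
    also have "\<dots> \<le> (norm a)\<^sup>2 + (norm b)\<^sup>2"
      using sum_squares_bound[of "norm a" "norm b"] mult_nonneg_nonneg[OF norm_ge_zero[of a] norm_ge_zero[of b]]
      unfolding mult.assoc by linarith
    finally show ?thesis .
  qed
  then show "AE x in lebesgue_on \<Omega>. norm (f x \<bullet> g x) \<le> norm ((norm (f x))\<^sup>2 + (norm (g x))\<^sup>2)"
    by (intro AE_I2) (simp add: order_trans[OF _ abs_ge_self])
qed

lemma L2_on_diff:
  fixes f g :: "'a::euclidean_space \<Rightarrow> 'b::euclidean_space"
  assumes "L2_on \<Omega> f" "L2_on \<Omega> g"
  shows "L2_on \<Omega> (\<lambda>x. f x - g x)"
proof -
  have "integrable (lebesgue_on \<Omega>) (\<lambda>x. (norm (f x))\<^sup>2 + (norm (g x))\<^sup>2 - 2 * (f x \<bullet> g x))"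
    using assms L2_on_inner_integrable[OF assms] by (auto simp: L2_on_def)
  moreover have "(norm (f x - g x))\<^sup>2 = (norm (f x))\<^sup>2 + (norm (g x))\<^sup>2 - 2 * (f x \<bullet> g x)" for x
    by (simp add: power2_norm_eq_inner inner_diff inner_commute)
  ultimately show ?thesis
    using assms by (auto simp: L2_on_def intro: borel_measurable_diff)
qed

text \<open>Any two weak gradients of \<open>u\<close> have the same integral against a test function. The components of the
  gradient of a test function are test functions, so the two also agree when paired with that
  gradient. This is all that is needed of the uniqueness of weak gradients.\<close>

lemma weak_gradients_same_pairing:
  assumes "open \<Omega>" and g: "has_H1_gradient \<Omega> u g" and g': "has_H1_gradient \<Omega> u g'"
    and \<eta>: "\<eta> \<in> test_functions \<Omega>"
  shows "(LINT x|lebesgue_on \<Omega>. g x \<bullet> classical_gradient \<eta> x) =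
         (LINT x|lebesgue_on \<Omega>. g' x \<bullet> classical_gradient \<eta> x)"
proof -
  have *: "(LINT x|lebesgue_on \<Omega>. f x \<bullet> classical_gradient \<eta> x) =
      (\<Sum>i\<in>Basis. - (LINT x|lebesgue_on \<Omega>. u x *
        (classical_gradient (\<lambda>x. frechet_derivative \<eta> (at x) i) x \<bullet> i)))"
    if f: "has_H1_gradient \<Omega> u f" for f
  proof -
    have i1: "(LINT x|lebesgue_on \<Omega>. (f x \<bullet> i) * frechet_derivative \<eta> (at x) i) =
        - (LINT x|lebesgue_on \<Omega>. u x *
        (classical_gradient (\<lambda>x. frechet_derivative \<eta> (at x) i) x \<bullet> i))" if "i \<in> Basis" for i
    proof -
      have "(LINT x|lebesgue_on \<Omega>. u x *
          (classical_gradient (\<lambda>x. frechet_derivative \<eta> (at x) i) x \<bullet> i)) =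
        - (LINT x|lebesgue_on \<Omega>. (f x \<bullet> i) * frechet_derivative \<eta> (at x) i)"
        using f test_functions_frechet[OF \<eta>, of i] that unfolding has_H1_gradient_def by blast
      then show ?thesis by simp
    qed
    have int: "integrable (lebesgue_on \<Omega>) (\<lambda>x. (f x \<bullet> i) * frechet_derivative \<eta> (at x) i)"
      if i: "i \<in> Basis" for i
    proof -
      have f2: "L2_on \<Omega> f" using f by (simp add: has_H1_gradient_def)
      have "L2_on \<Omega> (\<lambda>x. frechet_derivative \<eta> (at x) i)"
        using test_function_in_H10(1)[OF assms(1) test_functions_frechet[OF \<eta>, of i]]
        by (simp add: has_H1_gradient_def)
      then have "L2_on \<Omega> (\<lambda>x. frechet_derivative \<eta> (at x) i *\<^sub>R i)"
        using i by (auto simp: L2_on_def norm_mult)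
      from L2_on_inner_integrable[OF f2 this] show ?thesis by (simp add: mult.commute)
    qed
    have "(LINT x|lebesgue_on \<Omega>. f x \<bullet> classical_gradient \<eta> x) =
        (LINT x|lebesgue_on \<Omega>. (\<Sum>i\<in>Basis. (f x \<bullet> i) * frechet_derivative \<eta> (at x) i))"
      by (intro Bochner_Integration.integral_cong refl)
        (simp add: classical_gradient_def inner_sum_right mult.commute)
    also have "\<dots> = (\<Sum>i\<in>Basis. LINT x|lebesgue_on \<Omega>. (f x \<bullet> i) * frechet_derivative \<eta> (at x) i)"
      by (rule Bochner_Integration.integral_sum) (rule int)
    also have "\<dots> = (\<Sum>i\<in>Basis. - (LINT x|lebesgue_on \<Omega>. u x *
        (classical_gradient (\<lambda>x. frechet_derivative \<eta> (at x) i) x \<bullet> i)))"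
      by (rule sum.cong[OF refl]) (rule i1)
    finally show ?thesis .
  qed
  show ?thesis unfolding *[OF g] *[OF g'] ..
qed

text \<open>The gradient \<open>w\<close> of \<open>\<eta>\<close> is close to the weak gradient \<open>g0\<close>, while the bound is wanted for another
  weak gradient \<open>g\<close>. One has \<open>\<integral> |w|\<^sup>2 = \<integral> (w - g0) \<bullet> w + \<integral> g0 \<bullet> w\<close>, where the last integral equals
  \<open>\<integral> g \<bullet> w\<close>. Both terms are estimated by the elementary inequality between the product and the sum
  of squares, with weights \<open>e\<close> and \<open>1\<close>.\<close>

lemma H10_approx_gradient_bound:
  assumes "open \<Omega>" and g: "has_H1_gradient \<Omega> u g" and g0: "has_H1_gradient \<Omega> u g0"
    and \<eta>: "\<eta> \<in> test_functions \<Omega>" and e: "e > 0"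
    and close: "(LINT x|lebesgue_on \<Omega>. (norm (g0 x - classical_gradient \<eta> x))\<^sup>2) \<le> e\<^sup>2"
  shows "(1 - e) * (LINT x|lebesgue_on \<Omega>. (norm (classical_gradient \<eta> x))\<^sup>2) \<le>
    (LINT x|lebesgue_on \<Omega>. (norm (g x))\<^sup>2) + e"
proof -
  let ?w = "classical_gradient \<eta>" and ?M = "lebesgue_on \<Omega>"
  have L: "L2_on \<Omega> g" "L2_on \<Omega> g0" "L2_on \<Omega> ?w"
    using g g0 test_function_in_H10(1)[OF assms(1) \<eta>] by (simp_all add: has_H1_gradient_def)
  have I: "integrable ?M (\<lambda>x. (norm (g x))\<^sup>2)" "integrable ?M (\<lambda>x. (norm (?w x))\<^sup>2)"
    "integrable ?M (\<lambda>x. (norm (g0 x - ?w x))\<^sup>2)"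
    using L L2_on_diff[OF L(2,3)] by (simp_all add: L2_on_def)
  have J: "integrable ?M (\<lambda>x. g x \<bullet> ?w x)" "integrable ?M (\<lambda>x. g0 x \<bullet> ?w x)"
    using L2_on_inner_integrable L by blast+
  have "(LINT x|?M. (norm (?w x))\<^sup>2 - g0 x \<bullet> ?w x) \<le>
      (LINT x|?M. e/2 * (norm (?w x))\<^sup>2 + 1/(2*e) * (norm (g0 x - ?w x))\<^sup>2)"
  proof (rule integral_mono)
    show "integrable ?M (\<lambda>x. (norm (?w x))\<^sup>2 - g0 x \<bullet> ?w x)" using I J by auto
    show "integrable ?M (\<lambda>x. e/2 * (norm (?w x))\<^sup>2 + 1/(2*e) * (norm (g0 x - ?w x))\<^sup>2)"
      using I by auto
    fix x
    let ?a = "norm (?w x)" and ?b = "norm (g0 x - ?w x)"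
    have "(norm (?w x))\<^sup>2 - g0 x \<bullet> ?w x = - ((g0 x - ?w x) \<bullet> ?w x)"
      by (simp add: power2_norm_eq_inner inner_diff_left)
    also have "\<dots> \<le> ?b * ?a"
      using Cauchy_Schwarz_ineq2[of "g0 x - ?w x" "?w x"] by linarith
    also have "?b * ?a \<le> e/2 * ?a\<^sup>2 + 1/(2*e) * ?b\<^sup>2"
    proof -
      have "0 \<le> (e * ?a - ?b)\<^sup>2" by simp
      then have "2 * e * (?b * ?a) \<le> e * e * ?a\<^sup>2 + ?b\<^sup>2"
        by (simp add: power2_eq_square algebra_simps)
      then show ?thesis using e by (simp add: field_simps power2_eq_square)
    qed
    finally show "(norm (?w x))\<^sup>2 - g0 x \<bullet> ?w x \<le> e/2 * ?a\<^sup>2 + 1/(2*e) * ?b\<^sup>2" .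
  qed
  then have 1: "(LINT x|?M. (norm (?w x))\<^sup>2) - (LINT x|?M. g0 x \<bullet> ?w x) \<le>
      e/2 * (LINT x|?M. (norm (?w x))\<^sup>2) + 1/(2*e) * (LINT x|?M. (norm (g0 x - ?w x))\<^sup>2)"
    using I J by simp
  have "(LINT x|?M. g x \<bullet> ?w x) \<le> (LINT x|?M. 1/2 * (norm (g x))\<^sup>2 + 1/2 * (norm (?w x))\<^sup>2)"
  proof (rule integral_mono[OF J(1)])
    show "integrable ?M (\<lambda>x. 1/2 * (norm (g x))\<^sup>2 + 1/2 * (norm (?w x))\<^sup>2)" using I by auto
    fix x
    have "0 \<le> (norm (g x - ?w x))\<^sup>2" by simp
    then show "g x \<bullet> ?w x \<le> 1/2 * (norm (g x))\<^sup>2 + 1/2 * (norm (?w x))\<^sup>2"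
      by (simp add: power2_norm_eq_inner inner_diff inner_commute)
  qed
  then have 2: "(LINT x|?M. g x \<bullet> ?w x) \<le>
      1/2 * (LINT x|?M. (norm (g x))\<^sup>2) + 1/2 * (LINT x|?M. (norm (?w x))\<^sup>2)"
    using I by simp
  have "1/(2*e) * (LINT x|?M. (norm (g0 x - ?w x))\<^sup>2) \<le> 1/(2*e) * e\<^sup>2"
    using close e by (intro mult_left_mono) auto
  then have 3: "1/(2*e) * (LINT x|?M. (norm (g0 x - ?w x))\<^sup>2) \<le> e/2"
    using e by (simp add: power2_eq_square)
  show ?thesis
    using 1 2 3 weak_gradients_same_pairing[OF assms(1) g g0 \<eta>] by (simp add: algebra_simps)
qed

section \<open>The Hardy constant and test functions\<close>

text \<open>For test functions the two integrals of the Hardy quotient may be taken over the whole space, which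
  is convenient for changes of variables. They are extended nonnegative reals, so that no
  integrability has to be checked along the way.\<close>

definition hardy_weight_integral :: "'a::euclidean_space set \<Rightarrow> ('a \<Rightarrow> real) \<Rightarrow> ennreal" where
  "hardy_weight_integral \<Sigma> \<eta> = (\<integral>\<^sup>+x. ennreal ((\<eta> x)\<^sup>2 / (infdist x \<Sigma>)\<^sup>2) \<partial>lborel)"

definition dirichlet_energy :: "('a::euclidean_space \<Rightarrow> real) \<Rightarrow> ennreal" where
  "dirichlet_energy \<eta> = (\<integral>\<^sup>+x. ennreal ((norm (classical_gradient \<eta> x))\<^sup>2) \<partial>lborel)"

lemma test_function_integrals:
  assumes "open \<Omega>" and \<eta>: "\<eta> \<in> test_functions \<Omega>"
  shows "(\<integral>\<^sup>+x. ennreal ((\<eta> x)\<^sup>2 / (infdist x \<Sigma>)\<^sup>2) \<partial>lebesgue_on \<Omega>) = hardy_weight_integral \<Sigma> \<eta>"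
    and "ennreal (LINT x|lebesgue_on \<Omega>. (norm (classical_gradient \<eta> x))\<^sup>2) = dirichlet_energy \<eta>"
proof -
  obtain K where K: "compact K" "K \<subseteq> \<Omega>" "smooth_on UNIV \<eta>" "\<And>x. x \<notin> K \<Longrightarrow> \<eta> x = 0"
    "\<And>x. x \<notin> K \<Longrightarrow> classical_gradient \<eta> x = 0"
    using test_functions_gradientD[OF \<eta>] by metis
  have out: "\<eta> x = 0" "classical_gradient \<eta> x = 0" if "x \<notin> \<Omega>" for x
    using that K(2,4,5) by blast+
  show "(\<integral>\<^sup>+x. ennreal ((\<eta> x)\<^sup>2 / (infdist x \<Sigma>)\<^sup>2) \<partial>lebesgue_on \<Omega>) = hardy_weight_integral \<Sigma> \<eta>"
    unfolding hardy_weight_integral_def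
    by (rule nn_integral_lebesgue_on[OF assms(1)]) (simp add: out)
  have "integrable (lebesgue_on \<Omega>) (\<lambda>x. (norm (classical_gradient \<eta> x))\<^sup>2)"
    using test_function_in_H10(1)[OF assms] by (simp add: has_H1_gradient_def L2_on_def)
  then have "ennreal (LINT x|lebesgue_on \<Omega>. (norm (classical_gradient \<eta> x))\<^sup>2) =
      (\<integral>\<^sup>+x. ennreal ((norm (classical_gradient \<eta> x))\<^sup>2) \<partial>lebesgue_on \<Omega>)"
    by (intro nn_integral_eq_integral[symmetric]) auto
  also have "\<dots> = dirichlet_energy \<eta>"
    unfolding dirichlet_energy_def
    by (rule nn_integral_lebesgue_on[OF assms(1)]) (simp add: out)
  finally show "ennreal (LINT x|lebesgue_on \<Omega>. (norm (classical_gradient \<eta> x))\<^sup>2) = dirichlet_energy \<eta>" .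
qed

lemma hardy_quotient_nonneg: "0 \<le> hardy_quotient \<Omega> \<Sigma> u g"
  by (simp add: hardy_quotient_def Let_def)

lemma infdist_subset_frontier_pos:
  assumes "open \<Omega>" "\<Sigma> \<subseteq> frontier \<Omega>" "\<Sigma> \<noteq> {}" "x \<in> \<Omega>"
  shows "infdist x \<Sigma> > 0"
proof -
  have "closure \<Sigma> \<subseteq> frontier \<Omega>" by (rule closure_minimal[OF assms(2) frontier_closed])
  then have "x \<notin> closure \<Sigma>" using assms(1,4) by (auto simp: frontier_def interior_open)
  then have "infdist x \<Sigma> \<noteq> 0" using in_closure_iff_infdist_zero[OF assms(3)] by blast
  then show ?thesis using infdist_nonneg[of x \<Sigma>] by linarith
qed

lemma hardy_constant_le_test:
  assumes "open \<Omega>" and \<eta>: "\<eta> \<in> test_functions \<Omega>"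
  shows "ennreal (hardy_constant \<Omega> \<Sigma>) * hardy_weight_integral \<Sigma> \<eta> \<le> dirichlet_energy \<eta>"
proof (cases "AE x in lebesgue_on \<Omega>. \<eta> x = 0")
  case True
  then have "(\<integral>\<^sup>+x. ennreal ((\<eta> x)\<^sup>2 / (infdist x \<Sigma>)\<^sup>2) \<partial>lebesgue_on \<Omega>) =
      (\<integral>\<^sup>+x. 0 \<partial>lebesgue_on \<Omega>)"
    by (intro nn_integral_cong_AE) (auto elim: eventually_mono)
  then show ?thesis by (simp add: test_function_integrals(1)[OF assms])
next
  case False
  let ?D = "hardy_weight_integral \<Sigma> \<eta>" and ?E = "LINT x|lebesgue_on \<Omega>. (norm (classical_gradient \<eta> x))\<^sup>2"
  have "hardy_constant \<Omega> \<Sigma> \<le> hardy_quotient \<Omega> \<Sigma> \<eta> (classical_gradient \<eta>)"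
    unfolding hardy_constant_def
    by (rule cInf_lower) (use False test_function_in_H10[OF assms] hardy_quotient_nonneg in
        \<open>auto intro!: bdd_belowI[of _ 0]\<close>)
  also have "\<dots> = (if ?D = \<infinity> then 0 else ?E / enn2real ?D)"
    by (simp only: hardy_quotient_def Let_def test_function_integrals(1)[OF assms])
  finally have le: "hardy_constant \<Omega> \<Sigma> \<le> (if ?D = \<infinity> then 0 else ?E / enn2real ?D)" .
  show ?thesis
  proof (cases "?D = \<infinity> \<or> ?D = 0")
    case True
    then show ?thesis using le by (auto simp: ennreal_neg)
  next
    case False
    then obtain d where d: "?D = ennreal d" "d > 0"
      by (cases ?D) (auto simp: less_le)
    then have "hardy_constant \<Omega> \<Sigma> * d \<le> ?E" using le by (simp add: field_simps)
    then have "ennreal (hardy_constant \<Omega> \<Sigma> * d) \<le> dirichlet_energy \<eta>"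
      unfolding test_function_integrals(2)[OF assms, symmetric] by (rule ennreal_leI)
    then show ?thesis using d by (simp add: ennreal_mult'')
  qed
qed

text \<open>The inequality passes from test functions to the limit \<open>u\<close>: a subsequence of an approximating
  sequence converges almost everywhere, Fatou's lemma controls the left side, and
  \<open>H10_approx_gradient_bound\<close> the right side.\<close>

lemma weighted_integral_le_of_test:
  assumes "open \<Omega>" and u: "u \<in> H10 \<Omega>" and g: "has_H1_gradient \<Omega> u g" and h: "h \<ge> 0"
    and test: "\<And>\<eta>. \<eta> \<in> test_functions \<Omega> \<Longrightarrow>
      ennreal h * hardy_weight_integral \<Sigma> \<eta> \<le> dirichlet_energy \<eta>"
  shows "ennreal h * (\<integral>\<^sup>+x. ennreal ((u x)\<^sup>2 / (infdist x \<Sigma>)\<^sup>2) \<partial>lebesgue_on \<Omega>) \<le>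
    ennreal (LINT x|lebesgue_on \<Omega>. (norm (g x))\<^sup>2)"
proof -
  let ?M = "lebesgue_on \<Omega>" and ?G = "LINT x|lebesgue_on \<Omega>. (norm (g x))\<^sup>2"
  let ?w = "\<lambda>x. 1 / (infdist x \<Sigma>)\<^sup>2"
  obtain g0 where g0: "has_H1_gradient \<Omega> u g0" and approx: "\<And>e. e > 0 \<Longrightarrow> \<exists>\<eta>\<in>test_functions \<Omega>.
      sqrt ((LINT x|?M. (u x - \<eta> x)\<^sup>2) + (LINT x|?M. (norm (g0 x - classical_gradient \<eta> x))\<^sup>2)) < e"
    using u unfolding H10_def by blast
  define e where "e k = inverse (real (Suc k))" for k
  have e0: "e k > 0" for k by (simp add: e_def)
  have e_lim: "e \<longlonglongrightarrow> 0" unfolding e_def by (rule LIMSEQ_inverse_real_of_nat)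
  have e1: "e k \<le> 1" for k by (simp add: e_def inverse_le_1_iff)
  have "\<forall>k. \<exists>\<eta>. \<eta> \<in> test_functions \<Omega> \<and> sqrt ((LINT x|?M. (u x - \<eta> x)\<^sup>2) +
      (LINT x|?M. (norm (g0 x - classical_gradient \<eta> x))\<^sup>2)) < e k"
    using approx[OF e0] by blast
  from choice[OF this] obtain \<eta> where \<eta>': "\<And>k. \<eta> k \<in> test_functions \<Omega> \<and>
      sqrt ((LINT x|?M. (u x - \<eta> k x)\<^sup>2) +
        (LINT x|?M. (norm (g0 x - classical_gradient (\<eta> k) x))\<^sup>2)) < e k" by blast
  have \<eta>: "\<eta> k \<in> test_functions \<Omega>" for k using \<eta>' by blast
  have close: "(LINT x|?M. (u x - \<eta> k x)\<^sup>2) \<le> (e k)\<^sup>2"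
    "(LINT x|?M. (norm (g0 x - classical_gradient (\<eta> k) x))\<^sup>2) \<le> (e k)\<^sup>2" for k
  proof -
    have nn: "0 \<le> (LINT x|?M. (u x - \<eta> k x)\<^sup>2)"
      "0 \<le> (LINT x|?M. (norm (g0 x - classical_gradient (\<eta> k) x))\<^sup>2)" by simp_all
    have "(LINT x|?M. (u x - \<eta> k x)\<^sup>2) +
      (LINT x|?M. (norm (g0 x - classical_gradient (\<eta> k) x))\<^sup>2) \<le> (e k)\<^sup>2"
      using \<eta>'[of k] real_le_lsqrt e0 by (simp add: real_sqrt_less_iff sqrt_le_D less_imp_le)
    then show "(LINT x|?M. (u x - \<eta> k x)\<^sup>2) \<le> (e k)\<^sup>2"
      "(LINT x|?M. (norm (g0 x - classical_gradient (\<eta> k) x))\<^sup>2) \<le> (e k)\<^sup>2"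
      using nn by linarith+
  qed
  have uL: "L2_on \<Omega> u" using g by (simp add: has_H1_gradient_def)
  have \<eta>L: "L2_on \<Omega> (\<eta> k)" for k
    using test_function_in_H10(1)[OF assms(1) \<eta>] by (simp add: has_H1_gradient_def)
  have um: "u \<in> borel_measurable ?M" using uL by (simp add: L2_on_def)
  have \<eta>m: "\<eta> k \<in> borel_measurable ?M" for k using \<eta>L by (simp add: L2_on_def)
  have dm: "(\<lambda>x. infdist x \<Sigma>) \<in> borel_measurable ?M"
    by (intro borel_measurable_lebesgue_on borel_measurable_continuous_onI
        continuous_on_infdist continuous_on_id)
  note [measurable] = um \<eta>m dm
  have intd: "integrable ?M (\<lambda>x. (u x - \<eta> k x)\<^sup>2)" for k
    using L2_on_diff[OF uL \<eta>L] by (simp add: L2_on_def)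
  have e2: "(\<lambda>k. (e k)\<^sup>2) \<longlonglongrightarrow> 0" using tendsto_power[OF e_lim, of 2] by simp
  have "(\<lambda>k. LINT x|?M. norm ((u x - \<eta> k x)\<^sup>2)) \<longlonglongrightarrow> 0"
    by (rule tendsto_sandwich[OF _ _ tendsto_const e2]) (simp_all add: close)
  from tendsto_L1_AE_subseq[OF intd this] obtain r :: "nat \<Rightarrow> nat" where r: "strict_mono r"
    "AE x in ?M. (\<lambda>k. (u x - \<eta> (r k) x)\<^sup>2) \<longlonglongrightarrow> 0" by blast
  \<comment> \<open>The factor \<open>1 - e\<close> that the gradient bound loses is put on the left, where it tends to \<open>1\<close>.\<close>
  define f where "f k x = h * (1 - e (r k)) * (\<eta> (r k) x)\<^sup>2 * ?w x" for k x
  have fm: "(\<lambda>x. ennreal (f k x)) \<in> borel_measurable ?M" for k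
    unfolding f_def by measurable
  have er: "(\<lambda>k. e (r k)) \<longlonglongrightarrow> 0" using LIMSEQ_subseq_LIMSEQ[OF e_lim r(1)] by (simp add: o_def)
  have f_lim: "(\<lambda>k. ennreal (f k x)) \<longlonglongrightarrow> ennreal (h * ((u x)\<^sup>2 / (infdist x \<Sigma>)\<^sup>2))"
    if "(\<lambda>k. (u x - \<eta> (r k) x)\<^sup>2) \<longlonglongrightarrow> 0" for x
  proof -
    have "(\<lambda>k. sqrt ((u x - \<eta> (r k) x)\<^sup>2)) \<longlonglongrightarrow> sqrt 0" using that by (rule tendsto_real_sqrt)
    then have "(\<lambda>k. u x - \<eta> (r k) x) \<longlonglongrightarrow> 0" by (simp add: tendsto_rabs_zero_iff)
    from tendsto_diff[OF tendsto_const[of "u x"] this] have "(\<lambda>k. \<eta> (r k) x) \<longlonglongrightarrow> u x" by simp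
    then have "(\<lambda>k. f k x) \<longlonglongrightarrow> h * (1 - 0) * (u x)\<^sup>2 * ?w x"
      unfolding f_def by (intro tendsto_intros er)
    then show ?thesis by (intro tendsto_ennrealI) simp
  qed
  have f_le: "(\<integral>\<^sup>+x. ennreal (f k x) \<partial>?M) \<le> ennreal (?G + e (r k))" for k
  proof -
    let ?E = "LINT x|?M. (norm (classical_gradient (\<eta> (r k)) x))\<^sup>2"
    have c: "0 \<le> 1 - e (r k)" using e1[of "r k"] by simp
    have "(\<integral>\<^sup>+x. ennreal (f k x) \<partial>?M) = (\<integral>\<^sup>+x. ennreal ((1 - e (r k)) * h) *
        ennreal ((\<eta> (r k) x)\<^sup>2 / (infdist x \<Sigma>)\<^sup>2) \<partial>?M)"
      using c h by (intro nn_integral_cong) (simp add: f_def ennreal_mult[symmetric] mult_ac)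
    also have "\<dots> = ennreal ((1 - e (r k)) * h) * hardy_weight_integral \<Sigma> (\<eta> (r k))"
    proof -
      have "(\<lambda>x. (\<eta> (r k) x)\<^sup>2 * ?w x) \<in> borel_measurable ?M" by measurable
      then show ?thesis
        by (subst nn_integral_cmult) (simp_all add: test_function_integrals(1)[OF assms(1) \<eta>])
    qed
    also have "\<dots> = ennreal (1 - e (r k)) * (ennreal h * hardy_weight_integral \<Sigma> (\<eta> (r k)))"
      using c h by (simp add: ennreal_mult mult.assoc)
    also have "\<dots> \<le> ennreal (1 - e (r k)) * ennreal ?E"
      unfolding test_function_integrals(2)[OF assms(1) \<eta>] by (intro mult_left_mono test \<eta>) simp
    also have "\<dots> = ennreal ((1 - e (r k)) * ?E)" using c by (simp add: ennreal_mult)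
    also have "\<dots> \<le> ennreal (?G + e (r k))"
      by (rule ennreal_leI, rule H10_approx_gradient_bound[OF assms(1) g g0 \<eta> e0 close(2)])
    finally show ?thesis .
  qed
  have "ennreal h * (\<integral>\<^sup>+x. ennreal ((u x)\<^sup>2 / (infdist x \<Sigma>)\<^sup>2) \<partial>?M) =
      (\<integral>\<^sup>+x. ennreal (h * ((u x)\<^sup>2 / (infdist x \<Sigma>)\<^sup>2)) \<partial>?M)"
  proof -
    have "(\<lambda>x. (u x)\<^sup>2 * ?w x) \<in> borel_measurable ?M" by measurable
    then show ?thesis
      using h by (subst nn_integral_cmult[symmetric]) (simp_all add: ennreal_mult[symmetric])
  qed
  also have "\<dots> = (\<integral>\<^sup>+x. liminf (\<lambda>k. ennreal (f k x)) \<partial>?M)"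
  proof (rule nn_integral_cong_AE)
    show "AE x in ?M. ennreal (h * ((u x)\<^sup>2 / (infdist x \<Sigma>)\<^sup>2)) = liminf (\<lambda>k. ennreal (f k x))"
      using r(2)
    proof eventually_elim
      case (elim x)
      show ?case by (rule lim_imp_Liminf[OF _ f_lim[OF elim], symmetric]) simp
    qed
  qed
  also have "\<dots> \<le> liminf (\<lambda>k. \<integral>\<^sup>+x. ennreal (f k x) \<partial>?M)"
    by (rule nn_integral_liminf) (rule fm)
  also have "\<dots> \<le> liminf (\<lambda>k. ennreal (?G + e (r k)))"
    by (rule Liminf_mono) (simp add: f_le)
  also have "\<dots> = ennreal ?G"
  proof (rule lim_imp_Liminf)
    have "(\<lambda>k. ?G + e (r k)) \<longlonglongrightarrow> ?G + 0" by (intro tendsto_intros er)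
    then show "(\<lambda>k. ennreal (?G + e (r k))) \<longlonglongrightarrow> ennreal ?G" by (intro tendsto_ennrealI) simp
  qed simp
  finally show ?thesis .
qed

lemma nonzero_test_function:
  fixes \<Omega> :: "'a::euclidean_space set"
  assumes "open \<Omega>" "\<Omega> \<noteq> {}"
  obtains \<eta> where "\<eta> \<in> test_functions \<Omega>" "\<not> (AE x in lebesgue_on \<Omega>. \<eta> x = 0)"
proof -
  obtain a r where a: "r > 0" "cball a r \<subseteq> \<Omega>" using assms open_contains_cball by blast
  note pos = bump_pos_iff[OF a(1), of a]
  show thesis
  proof (rule that[of "bump a r"])
    show "bump a r \<in> test_functions \<Omega>"
    proof (rule test_functionsI[OF smooth_on_bump compact_cball a(2)])
      show "bump a r x = 0" if "x \<notin> cball a r" for x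
        using that pos[of x] bump_nonneg[of a r x] by (auto simp: less_le)
    qed
    show "\<not> (AE x in lebesgue_on \<Omega>. bump a r x = 0)"
    proof
      assume "AE x in lebesgue_on \<Omega>. bump a r x = 0"
      then have "AE x in lebesgue. x \<in> \<Omega> \<longrightarrow> bump a r x = 0"
        using assms(1) by (simp add: AE_restrict_space_iff)
      then have "AE x in lebesgue. x \<notin> ball a r"
      proof eventually_elim
        case (elim x)
        then show ?case using pos[of x] a(2) ball_subset_cball[of a r] by (metis less_irrefl subsetD)
      qed
      then have "AE x in lborel. x \<notin> ball a r" by (simp add: AE_completion_iff)
      then show False using ball_not_null[OF a(1)] by blast
    qed
  qed
qed

text \<open>The admissible pairs whose weighted integral is infinite have quotient \<open>0\<close>; for them the limit
  inequality forces \<open>h = 0\<close>, since its right side is finite. A nonzero test function guarantees that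
  the infimum is taken over a nonempty set.\<close>

lemma hardy_constant_ge:
  assumes "open \<Omega>" "\<Omega> \<noteq> {}" "\<Sigma> \<subseteq> frontier \<Omega>" "\<Sigma> \<noteq> {}" and h: "h \<ge> 0"
    and test: "\<And>\<eta>. \<eta> \<in> test_functions \<Omega> \<Longrightarrow>
      ennreal h * hardy_weight_integral \<Sigma> \<eta> \<le> dirichlet_energy \<eta>"
  shows "h \<le> hardy_constant \<Omega> \<Sigma>"
  unfolding hardy_constant_def
proof (rule cInf_greatest)
  obtain \<eta> where "\<eta> \<in> test_functions \<Omega>" "\<not> (AE x in lebesgue_on \<Omega>. \<eta> x = 0)"
    using nonzero_test_function[OF assms(1,2)] by blast
  then show "{hardy_quotient \<Omega> \<Sigma> u g |u g. u \<in> H10 \<Omega> \<and> has_H1_gradient \<Omega> u g \<and>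
      \<not> (AE x in lebesgue_on \<Omega>. u x = 0)} \<noteq> {}"
    using test_function_in_H10[OF assms(1)] by blast
next
  fix q assume "q \<in> {hardy_quotient \<Omega> \<Sigma> u g |u g. u \<in> H10 \<Omega> \<and> has_H1_gradient \<Omega> u g \<and>
      \<not> (AE x in lebesgue_on \<Omega>. u x = 0)}"
  then obtain u g where q: "q = hardy_quotient \<Omega> \<Sigma> u g" and u: "u \<in> H10 \<Omega>"
    and g: "has_H1_gradient \<Omega> u g" and nz: "\<not> (AE x in lebesgue_on \<Omega>. u x = 0)" by blast
  let ?M = "lebesgue_on \<Omega>" and ?G = "LINT x|lebesgue_on \<Omega>. (norm (g x))\<^sup>2"
  define D where "D = (\<integral>\<^sup>+x. ennreal ((u x)\<^sup>2 / (infdist x \<Sigma>)\<^sup>2) \<partial>?M)"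
  have le: "ennreal h * D \<le> ennreal ?G"
    unfolding D_def by (rule weighted_integral_le_of_test[OF assms(1) u g h test])
  have q': "q = (if D = \<infinity> then 0 else ?G / enn2real D)"
    by (simp add: q hardy_quotient_def D_def)
  have "D \<noteq> 0"
  proof
    assume "D = 0"
    have m: "(\<lambda>x. (u x)\<^sup>2 / (infdist x \<Sigma>)\<^sup>2) \<in> borel_measurable ?M"
    proof (intro borel_measurable_divide borel_measurable_power)
      show "u \<in> borel_measurable ?M" using g by (simp add: has_H1_gradient_def L2_on_def)
      show "(\<lambda>x. infdist x \<Sigma>) \<in> borel_measurable ?M"
        by (intro borel_measurable_lebesgue_on borel_measurable_continuous_onI
            continuous_on_infdist continuous_on_id)
    qed
    from \<open>D = 0\<close> have "AE x in ?M. ennreal ((u x)\<^sup>2 / (infdist x \<Sigma>)\<^sup>2) = 0"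
      unfolding D_def using m by (subst (asm) nn_integral_0_iff_AE) auto
    then have "AE x in ?M. u x = 0"
    proof (rule lebesgue_on_mono)
      fix x assume x: "ennreal ((u x)\<^sup>2 / (infdist x \<Sigma>)\<^sup>2) = 0" "x \<in> \<Omega>"
      have "(u x)\<^sup>2 / (infdist x \<Sigma>)\<^sup>2 \<ge> 0" by simp
      then have "(u x)\<^sup>2 / (infdist x \<Sigma>)\<^sup>2 = 0" using x(1) by (simp only: ennreal_eq_0_iff)
      then show "u x = 0"
        using infdist_subset_frontier_pos[OF assms(1,3,4) x(2)] by simp
    qed
    then show False using nz by blast
  qed
  show "h \<le> q"
  proof (cases "D = \<infinity>")
    case True
    then have "h = 0" using le h by (auto simp: ennreal_mult_top top_unique split: if_splits)
    then show ?thesis using True by (simp add: q')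
  next
    case False
    then obtain d where d: "D = ennreal d" "d \<ge> 0" by (cases D) auto
    then have "d > 0" using \<open>D \<noteq> 0\<close> by (auto simp: less_le)
    have "ennreal (h * d) \<le> ennreal ?G" using le d h by (simp add: ennreal_mult)
    then have "h * d \<le> ?G" by (subst (asm) ennreal_le_iff) simp_all
    then show ?thesis using \<open>d > 0\<close> d False by (simp add: q' field_simps)
  qed
qed

lemma hardy_constant_nonneg:
  assumes "open \<Omega>" "\<Omega> \<noteq> {}" "\<Sigma> \<subseteq> frontier \<Omega>" "\<Sigma> \<noteq> {}"
  shows "0 \<le> hardy_constant \<Omega> \<Sigma>"
  by (rule hardy_constant_ge[OF assms]) simp_all

section \<open>Transport of the Hardy constant by maps close to the identity\<close>

lemma near_identity_lipschitz_bounds: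
  fixes F :: "'a::real_normed_vector \<Rightarrow> 'a"
  assumes "\<kappa>-lipschitz_on UNIV (\<lambda>x. F x - x)"
  shows "norm (F x - F y) \<le> (1 + \<kappa>) * norm (x - y)"
    and "(1 - \<kappa>) * norm (x - y) \<le> norm (F x - F y)"
proof -
  have *: "norm ((F x - x) - (F y - y)) \<le> \<kappa> * norm (x - y)"
    by (rule lipschitz_on_normD[OF assms]) auto
  have eq: "F x - F y = (x - y) + ((F x - x) - (F y - y))" by simp
  show "norm (F x - F y) \<le> (1 + \<kappa>) * norm (x - y)"
    using norm_triangle_ineq[of "x - y" "(F x - x) - (F y - y)"] * unfolding eq[symmetric]
    by (simp add: algebra_simps)
  show "(1 - \<kappa>) * norm (x - y) \<le> norm (F x - F y)"
    using norm_diff_ineq[of "x - y" "(F x - x) - (F y - y)"] * unfolding eq[symmetric]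
    by (simp add: algebra_simps)
qed

text \<open>The equation \<open>F x = y\<close> is the fixed point equation of the contraction \<open>x \<mapsto> y - (F x - x)\<close>.\<close>

lemma near_identity_inverse:
  fixes F :: "'a::banach \<Rightarrow> 'a"
  assumes lip: "\<kappa>-lipschitz_on UNIV (\<lambda>x. F x - x)" and "\<kappa> < 1"
  obtains G where "\<And>x. G (F x) = x" "\<And>y. F (G y) = y" "(1 / (1 - \<kappa>))-lipschitz_on UNIV G"
    "(\<kappa> / (1 - \<kappa>))-lipschitz_on UNIV (\<lambda>y. G y - y)"
proof -
  note b = near_identity_lipschitz_bounds[OF lip]
  have \<kappa>: "0 \<le> \<kappa>" by (rule lipschitz_on_nonneg[OF lip])
  have inj: "x = y" if "F x = F y" for x y
    using b(2)[of x y] that assms(2) by (simp add: mult_le_0_iff)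
  have "\<exists>x. F x = y" for y
  proof -
    have "\<exists>!x. y - (F x - x) = x"
    proof (rule banach_fix_type[OF \<kappa> assms(2)], intro allI)
      fix x x'
      have "(y - (F x - x)) - (y - (F x' - x')) = - ((F x - x) - (F x' - x'))" by simp
      then have "dist (y - (F x - x)) (y - (F x' - x')) = dist (F x - x) (F x' - x')"
        by (simp only: dist_norm norm_minus_cancel)
      then show "dist (y - (F x - x)) (y - (F x' - x')) \<le> \<kappa> * dist x x'"
        using lipschitz_onD[OF lip UNIV_I UNIV_I, of x x'] by simp
    qed
    then obtain x where "y - (F x - x) = x" by blast
    then show ?thesis by (intro exI[of _ x]) (simp add: algebra_simps)
  qed
  then have FG: "F (inv F y) = y" for y by (intro f_inv_into_f) (metis rangeI)
  have GF: "inv F (F x) = x" for x using inj FG by blast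
  have lipG: "norm (inv F x - inv F y) \<le> 1 / (1 - \<kappa>) * norm (x - y)" for x y
    using b(2)[of "inv F x" "inv F y"] assms(2) by (simp add: FG field_simps)
  show thesis
  proof (rule that[OF GF FG])
    show "(1 / (1 - \<kappa>))-lipschitz_on UNIV (inv F)"
      using lipG assms(2) by (intro lipschitz_onI) (simp_all add: dist_norm)
    show "(\<kappa> / (1 - \<kappa>))-lipschitz_on UNIV (\<lambda>y. inv F y - y)"
    proof (rule lipschitz_onI)
      fix x y
      have "(inv F x - x) - (inv F y - y) = - ((F (inv F x) - inv F x) - (F (inv F y) - inv F y))"
        by (simp add: FG)
      then have "norm ((inv F x - x) - (inv F y - y)) =
          norm ((F (inv F x) - inv F x) - (F (inv F y) - inv F y))"
        by (simp only: norm_minus_cancel)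
      also have "\<dots> \<le> \<kappa> * norm (inv F x - inv F y)"
        by (rule lipschitz_on_normD[OF lip]) auto
      also have "\<dots> \<le> \<kappa> * (1 / (1 - \<kappa>) * norm (x - y))"
        by (rule mult_left_mono[OF lipG \<kappa>])
      finally show "dist (inv F x - x) (inv F y - y) \<le> \<kappa> / (1 - \<kappa>) * dist x y"
        by (simp add: dist_norm)
    qed (use \<kappa> assms(2) in simp)
  qed
qed

lemma derivative_norm_le_lipschitz:
  assumes "(f has_derivative f') (at x)" and lip: "\<And>y. norm (f y - f x) \<le> L * norm (y - x)"
  shows "norm (f' v) \<le> L * norm v"
proof (cases "v = 0")
  case True
  then show ?thesis using linear_0[OF has_derivative_linear[OF assms(1)]] by simp
next
  case False
  have "norm (f' v) \<le> L * norm v + e" if "e > 0" for e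
  proof -
    define e' where "e' = e / norm v"
    have e': "e' > 0" "e' * norm v = e" using that False by (auto simp: e'_def)
    obtain d where d: "d > 0" "\<And>y. norm (y - x) < d \<Longrightarrow> norm (f y - f x - f' (y - x)) \<le> e' * norm (y - x)"
      using assms(1) e'(1) unfolding has_derivative_at_alt by blast
    define t where "t = d / (2 * norm v)"
    have t: "t > 0" using d(1) False by (simp add: t_def)
    have "norm (t *\<^sub>R v) < d" using d(1) False t by (simp add: t_def)
    then have *: "norm (f (x + t *\<^sub>R v) - f x - f' (t *\<^sub>R v)) \<le> e' * norm (t *\<^sub>R v)"
      using d(2)[of "x + t *\<^sub>R v"] by simp
    have "norm (f' (t *\<^sub>R v)) \<le> norm (f (x + t *\<^sub>R v) - f x) + norm (f (x + t *\<^sub>R v) - f x - f' (t *\<^sub>R v))"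
      using norm_triangle_ineq4[of "f (x + t *\<^sub>R v) - f x" "f (x + t *\<^sub>R v) - f x - f' (t *\<^sub>R v)"] by simp
    also have "\<dots> \<le> L * norm (t *\<^sub>R v) + e' * norm (t *\<^sub>R v)"
      using lip[of "x + t *\<^sub>R v"] * by simp
    also have "f' (t *\<^sub>R v) = t *\<^sub>R f' v"
      by (rule linear_cmul[OF has_derivative_linear[OF assms(1)]])
    finally have "t * norm (f' v) \<le> t * (L * norm v + e' * norm v)"
      using t by (simp add: algebra_simps)
    then show ?thesis using t e'(2) by simp
  qed
  then show ?thesis by (rule field_le_epsilon)
qed

text \<open>The chain rule is tested against the gradient of the composite itself, which turns the bound on
  the derivative of \<open>Y\<close> into one for its adjoint.\<close>

lemma norm_classical_gradient_compose_le:
  fixes Y :: "'a::euclidean_space \<Rightarrow> 'a"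
  assumes \<eta>: "smooth_on UNIV \<eta>" and Y: "smooth_on UNIV Y"
    and lip: "\<And>x y. norm (Y x - Y y) \<le> L * norm (x - y)" and "L \<ge> 0"
  shows "norm (classical_gradient (\<lambda>x. \<eta> (Y x)) x) \<le> L * norm (classical_gradient \<eta> (Y x))"
proof -
  let ?g = "classical_gradient (\<lambda>x. \<eta> (Y x)) x" and ?h = "classical_gradient \<eta> (Y x)"
  note dY = smooth_on_has_derivative[OF Y UNIV_I, of x]
  note d\<eta> = smooth_on_has_derivative[OF \<eta> UNIV_I, of "Y x"]
  have chain: "((\<lambda>x. \<eta> (Y x)) has_derivative
      (\<lambda>v. frechet_derivative \<eta> (at (Y x)) (frechet_derivative Y (at x) v))) (at x)"
    by (rule has_derivative_compose[OF dY d\<eta>])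
  have diff: "(\<lambda>x. \<eta> (Y x)) differentiable (at x)" "\<eta> differentiable (at (Y x))"
    using chain d\<eta> by (auto simp: differentiable_def)
  have "?g \<bullet> ?g = ?h \<bullet> frechet_derivative Y (at x) ?g"
    unfolding classical_gradient_inner[OF diff(1)] classical_gradient_inner[OF diff(2)]
    using fun_cong[OF frechet_derivative_at[OF chain], of ?g] by simp
  also have "\<dots> \<le> norm ?h * norm (frechet_derivative Y (at x) ?g)" by (rule norm_cauchy_schwarz)
  also have "\<dots> \<le> norm ?h * (L * norm ?g)"
    by (intro mult_left_mono derivative_norm_le_lipschitz[OF dY] lip) simp
  finally have "norm ?g * norm ?g \<le> norm ?g * (L * norm ?h)"
    by (simp add: power2_norm_eq_inner[symmetric] power2_eq_square mult_ac)
  then show ?thesis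
    using assms(4) by (cases "norm ?g = 0") (auto simp: mult_le_cancel_left)
qed

lemma infdist_image_ge:
  assumes "A \<noteq> {}" "\<And>a. a \<in> A \<Longrightarrow> m * dist x a \<le> dist (F x) (F a)" "m > 0"
  shows "m * infdist x A \<le> infdist (F x) (F ` A)"
proof -
  have "m * infdist x A \<le> dist (F x) b" if b: "b \<in> F ` A" for b
  proof -
    obtain a where a: "a \<in> A" "b = F a" using b by blast
    have "m * infdist x A \<le> m * dist x a"
      using infdist_le[OF a(1)] assms(3) by (intro mult_left_mono) auto
    then show ?thesis using assms(2)[OF a(1)] a(2) by simp
  qed
  then show ?thesis
    using assms(1) by (subst infdist_notempty) (auto intro!: cINF_greatest)
qed

text \<open>Let \<open>\<eta>\<close> vanish outside the compact set \<open>K\<close>, and let the \<open>\<delta>\<close>-neighbourhood of \<open>K\<close> lie in \<open>\<Omega>\<close>. The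
  function \<open>v\<close> is \<open>\<eta> \<circ> Y\<close>, where \<open>Y\<close> is a mollification of \<open>F\<close> with \<open>|Y - F| \<le> \<kappa> \<delta>/2\<close>. This is less than \<open>\<delta>\<close>, so
  points that \<open>Y\<close> maps into \<open>K\<close> are mapped into \<open>\<Omega>\<close> by \<open>F\<close> and hence lie in \<open>\<Omega>\<close>. It is also at most
  \<open>\<kappa>\<close> times the distance from \<open>K\<close> to \<open>F ` A\<close>, so replacing \<open>F x\<close> by \<open>Y x\<close> costs only another factor
  \<open>1 + \<kappa>\<close> in the weight.\<close>

lemma test_function_transfer:
  fixes \<Omega> A :: "'a::euclidean_space set" and F :: "'a \<Rightarrow> 'a"
  assumes \<Omega>: "open \<Omega>" and A: "A \<noteq> {}" "A \<subseteq> frontier \<Omega>" "F ` A \<subseteq> frontier \<Omega>"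
    and lip: "\<kappa>-lipschitz_on UNIV (\<lambda>x. F x - x)" and \<kappa>: "\<kappa> < 1"
    and F\<Omega>: "\<And>x. F x \<in> \<Omega> \<Longrightarrow> x \<in> \<Omega>" and \<eta>: "\<eta> \<in> test_functions \<Omega>"
  obtains v where "v \<in> test_functions \<Omega>"
    "dirichlet_energy v \<le> ennreal ((1 + \<kappa>)\<^sup>2 * (1 / (1 - \<kappa>)) ^ DIM('a)) * dirichlet_energy \<eta>"
    "hardy_weight_integral (F ` A) \<eta> \<le>
      ennreal ((1 + \<kappa>) ^ DIM('a) * ((1 + \<kappa>) / (1 - \<kappa>))\<^sup>2) * hardy_weight_integral A v"
proof -
  obtain K where K: "compact K" "K \<subseteq> \<Omega>" "smooth_on UNIV \<eta>" "\<And>x. x \<notin> K \<Longrightarrow> \<eta> x = 0"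
    using test_functionsD[OF \<eta>] by metis
  have \<kappa>0: "0 \<le> \<kappa>" by (rule lipschitz_on_nonneg[OF lip])
  obtain \<delta> where \<delta>: "\<delta> > 0" "(\<Union>x\<in>K. ball x \<delta>) \<subseteq> \<Omega>"
    by (rule compact_subset_open_imp_ball_epsilon_subset[OF K(1) \<Omega> K(2)])
  have dK: "\<delta> \<le> infdist y (F ` A)" if "y \<in> K" for y
  proof -
    have "\<delta> \<le> dist y b" if "b \<in> F ` A" for b
    proof (rule ccontr)
      assume "\<not> \<delta> \<le> dist y b"
      then have "b \<in> ball y \<delta>" by simp
      then have "b \<in> \<Omega>" using \<delta>(2) \<open>y \<in> K\<close> by blast
      then show False using that A(3) \<Omega> by (auto simp: frontier_def interior_open)
    qed
    then show ?thesis using A(1) by (subst infdist_notempty) (auto intro!: cINF_greatest)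
  qed
  obtain Z where Z: "smooth_on UNIV Z" "\<kappa>-lipschitz_on UNIV Z"
    "\<And>x. norm (Z x - (F x - x)) \<le> \<kappa> * (\<delta>/2)"
    using lipschitz_mollification[OF lip, of "\<delta>/2"] \<delta>(1) by auto
  define Y where "Y x = x + Z x" for x
  have Ylip: "\<kappa>-lipschitz_on UNIV (\<lambda>x. Y x - x)" using Z(2) by (simp add: Y_def)
  note Yb = near_identity_lipschitz_bounds[OF Ylip] and Fb = near_identity_lipschitz_bounds[OF lip]
  have Ysm: "smooth_on UNIV Y"
    unfolding Y_def[abs_def]
    by (intro smooth_on_add smooth_on_bounded_linear bounded_linear_ident Z(1) open_UNIV)
  have YF: "dist (Y x) (F x) \<le> \<kappa> * (\<delta>/2)" for x
    using Z(3)[of x] by (simp add: Y_def dist_norm algebra_simps)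
  obtain G where G: "\<And>x. G (Y x) = x" "\<And>y. Y (G y) = y" "(1 / (1 - \<kappa>))-lipschitz_on UNIV G"
    by (rule near_identity_inverse[OF Ylip \<kappa>]) blast
  have Ylip': "(1 + \<kappa>)-lipschitz_on UNIV Y"
    using Yb(1) \<kappa>0 by (intro lipschitz_onI) (simp_all add: dist_norm)
  have Ycont: "continuous_on UNIV Y" and Gcont: "continuous_on UNIV G"
    using lipschitz_on_continuous_on Ylip' G(3) by blast+
  have YK: "x \<in> \<Omega>" if "Y x \<in> K" for x
  proof -
    have "\<kappa> * (\<delta>/2) < \<delta>" using \<kappa> \<kappa>0 \<delta>(1) mult_right_mono[of \<kappa> 1 "\<delta>/2"] by simp
    then have "F x \<in> ball (Y x) \<delta>" using YF[of x] by simp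
    then show ?thesis using F\<Omega> \<delta>(2) that by blast
  qed
  define v where "v x = \<eta> (Y x)" for x
  show thesis
  proof (rule that)
    have "compact (G ` K)" using Gcont K(1) by (meson compact_continuous_image continuous_on_subset subset_UNIV)
    moreover have "G ` K \<subseteq> \<Omega>" using YK G(2) by auto
    moreover have "v x = 0" if "x \<notin> G ` K" for x
      using that K(4)[of "Y x"] G(1)[of x] by (force simp: v_def)
    moreover have "smooth_on UNIV v"
      unfolding v_def[abs_def] by (rule smooth_on_compose[OF open_UNIV open_UNIV _ K(3) Ysm]) simp
    ultimately show "v \<in> test_functions \<Omega>" by (intro test_functionsI)
  next
    let ?E = "\<lambda>y. ennreal ((norm (classical_gradient \<eta> y))\<^sup>2)"
    have Em: "?E \<in> borel_measurable borel"
      using borel_measurable_continuous_onI[OF continuous_on_classical_gradient[OF K(3)]] by measurable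
    have "dirichlet_energy v \<le> (\<integral>\<^sup>+x. ennreal ((1 + \<kappa>)\<^sup>2) * ?E (Y x) \<partial>lborel)"
      unfolding dirichlet_energy_def
    proof (rule nn_integral_mono)
      fix x
      have "norm (classical_gradient v x) \<le> (1 + \<kappa>) * norm (classical_gradient \<eta> (Y x))"
        unfolding v_def[abs_def]
        by (rule norm_classical_gradient_compose_le[OF K(3) Ysm Yb(1)]) (use \<kappa>0 in simp)
      then have "(norm (classical_gradient v x))\<^sup>2 \<le> ((1 + \<kappa>) * norm (classical_gradient \<eta> (Y x)))\<^sup>2"
        by (intro power_mono) auto
      then show "ennreal ((norm (classical_gradient v x))\<^sup>2) \<le> ennreal ((1 + \<kappa>)\<^sup>2) * ?E (Y x)"
        by (simp add: ennreal_mult[symmetric] power_mult_distrib ennreal_leI)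
    qed
    also have "\<dots> = ennreal ((1 + \<kappa>)\<^sup>2) * (\<integral>\<^sup>+x. ?E (Y x) \<partial>lborel)"
      by (rule nn_integral_cmult) (use measurable_compose[OF borel_measurable_continuous_onI[OF Ycont] Em] in simp)
    also have "\<dots> \<le> ennreal ((1 + \<kappa>)\<^sup>2) * (ennreal ((1 / (1 - \<kappa>)) ^ DIM('a)) * dirichlet_energy \<eta>)"
      unfolding dirichlet_energy_def
      by (intro mult_left_mono nn_integral_lipschitz_le[OF Ycont G(3) G(1,2) Em]) simp
    also have "\<dots> = ennreal ((1 + \<kappa>)\<^sup>2 * (1 / (1 - \<kappa>)) ^ DIM('a)) * dirichlet_energy \<eta>"
      using \<kappa> by (subst ennreal_mult) (simp_all add: mult.assoc)
    finally show "dirichlet_energy v \<le>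
      ennreal ((1 + \<kappa>)\<^sup>2 * (1 / (1 - \<kappa>)) ^ DIM('a)) * dirichlet_energy \<eta>" .
  next
    let ?B = "F ` A"
    let ?h = "\<lambda>y. ennreal ((\<eta> y)\<^sup>2 / (infdist y ?B)\<^sup>2)"
    let ?k = "\<lambda>x. ennreal ((v x)\<^sup>2 / (infdist x A)\<^sup>2)"
    have \<eta>m[measurable]: "\<eta> \<in> borel_measurable borel" and Ym[measurable]: "Y \<in> borel_measurable borel"
      by (rule borel_measurable_continuous_onI smooth_on_continuous_on K Ycont)+
    have dm[measurable]: "(\<lambda>y. infdist y S) \<in> borel_measurable borel" for S :: "'a set"
      by (intro borel_measurable_continuous_onI continuous_on_infdist continuous_on_id)
    have vm[measurable]: "v \<in> borel_measurable borel" unfolding v_def[abs_def] by measurable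
    have hm: "?h \<in> borel_measurable borel" by measurable
    have km: "?k \<in> borel_measurable lborel" by measurable
    have pt: "?h (Y x) \<le> ennreal (((1 + \<kappa>) / (1 - \<kappa>))\<^sup>2) * ?k x" for x
    proof (cases "Y x \<in> K")
      case True
      have "(1 - \<kappa>) * infdist x A \<le> infdist (F x) ?B"
        using Fb(2) \<kappa> by (intro infdist_image_ge A(1)) (simp_all add: dist_norm)
      also have "\<dots> \<le> infdist (Y x) ?B + dist (F x) (Y x)" by (rule infdist_triangle)
      also have "\<dots> \<le> infdist (Y x) ?B + \<kappa> * \<delta>"
        using YF[of x] mult_nonneg_nonneg[OF \<kappa>0 less_imp_le[OF \<delta>(1)]] by (simp add: dist_commute)
      also have "\<dots> \<le> infdist (Y x) ?B + \<kappa> * infdist (Y x) ?B"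
        using dK[OF True] \<kappa>0 by (intro add_left_mono mult_left_mono)
      finally have "(1 - \<kappa>) * infdist x A \<le> (1 + \<kappa>) * infdist (Y x) ?B"
        by (simp add: algebra_simps)
      then have "((1 - \<kappa>) * infdist x A)\<^sup>2 \<le> ((1 + \<kappa>) * infdist (Y x) ?B)\<^sup>2"
        using \<kappa> infdist_nonneg[of x A] by (intro power_mono mult_nonneg_nonneg) auto
      then have sq: "(1 - \<kappa>)\<^sup>2 * (infdist x A)\<^sup>2 \<le> (1 + \<kappa>)\<^sup>2 * (infdist (Y x) ?B)\<^sup>2"
        by (simp add: power_mult_distrib)
      have dY: "infdist (Y x) ?B > 0" using dK[OF True] \<delta>(1) by linarith
      have dx: "(infdist x A)\<^sup>2 > 0"
        using infdist_subset_frontier_pos[OF \<Omega> A(2,1) YK[OF True]] by simp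
      have "(\<eta> (Y x))\<^sup>2 / (infdist (Y x) ?B)\<^sup>2 \<le>
          (((1 + \<kappa>) / (1 - \<kappa>))\<^sup>2) * ((v x)\<^sup>2 / (infdist x A)\<^sup>2)"
      proof -
        have "(1 - \<kappa>)\<^sup>2 * (infdist x A)\<^sup>2 * (v x)\<^sup>2 \<le> (1 + \<kappa>)\<^sup>2 * (infdist (Y x) ?B)\<^sup>2 * (v x)\<^sup>2"
          by (rule mult_right_mono[OF sq]) simp
        then show ?thesis
          using dx dY \<kappa> by (simp add: v_def power_divide field_simps)
      qed
      then show ?thesis by (simp add: ennreal_mult[symmetric] ennreal_leI)
    qed (simp add: K(4))
    \<comment> \<open>Here the change of variables is used in the opposite direction, with \<open>G\<close> as the map and \<open>Y\<close> as its inverse.\<close>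
    have "hardy_weight_integral ?B \<eta> = (\<integral>\<^sup>+y. (\<lambda>x. ?h (Y x)) (G y) \<partial>lborel)"
      by (simp add: hardy_weight_integral_def G(2))
    also have "\<dots> \<le> ennreal ((1 + \<kappa>) ^ DIM('a)) * (\<integral>\<^sup>+x. ?h (Y x) \<partial>lborel)"
      by (rule nn_integral_lipschitz_le[OF Gcont Ylip' G(2,1)]) measurable
    also have "(\<integral>\<^sup>+x. ?h (Y x) \<partial>lborel) \<le> (\<integral>\<^sup>+x. ennreal (((1 + \<kappa>) / (1 - \<kappa>))\<^sup>2) * ?k x \<partial>lborel)"
      by (rule nn_integral_mono) (rule pt)
    also have "\<dots> = ennreal (((1 + \<kappa>) / (1 - \<kappa>))\<^sup>2) * hardy_weight_integral A v"
      unfolding hardy_weight_integral_def by (rule nn_integral_cmult[OF km])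
    finally show "hardy_weight_integral ?B \<eta> \<le>
      ennreal ((1 + \<kappa>) ^ DIM('a) * ((1 + \<kappa>) / (1 - \<kappa>))\<^sup>2) * hardy_weight_integral A v"
      using \<kappa>0 by (subst ennreal_mult) (simp_all add: mult.assoc mult_left_mono)
  qed
qed

lemma one_plus_power_le:
  fixes t :: real
  assumes "0 \<le> t" "t \<le> 1" shows "(1 + t) ^ N \<le> 1 + 3 ^ N * t"
proof (induction N)
  case (Suc N)
  have "(1 + t) ^ Suc N \<le> (1 + t) * (1 + 3 ^ N * t)"
    using mult_left_mono[OF Suc, of "1 + t"] assms by simp
  also have "\<dots> = 1 + (1 + 3 ^ N + 3 ^ N * t) * t" by (simp add: algebra_simps)
  also have "\<dots> \<le> 1 + 3 ^ Suc N * t"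
  proof (intro add_left_mono mult_right_mono assms(1))
    have "(1::real) \<le> 3 ^ N" by simp
    moreover have "(3::real) ^ N * t \<le> 3 ^ N * 1" using assms(2) by (intro mult_left_mono) simp_all
    ultimately show "1 + 3 ^ N + 3 ^ N * t \<le> 3 ^ Suc N" unfolding power_Suc by linarith
  qed
  finally show ?case .
qed (use assms in simp)

text \<open>With \<open>R = (1 + \<kappa>)/(1 - \<kappa>)\<close> the constants of \<open>test_function_transfer\<close> multiply to at most
  \<open>R\<^bsup>n+4\<^esup>\<close>, where \<open>n\<close> is the dimension. For \<open>\<kappa> \<le> 1/4\<close> one has \<open>R \<le> 1 + 4 \<kappa>\<close> with \<open>4 \<kappa> \<le> 1\<close>, which
  makes this power linear in \<open>\<kappa>\<close>.\<close>

lemma hardy_constant_transfer: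
  fixes \<Omega> A :: "'a::euclidean_space set" and F :: "'a \<Rightarrow> 'a"
  assumes \<Omega>: "open \<Omega>" "\<Omega> \<noteq> {}" and A: "A \<noteq> {}" "A \<subseteq> frontier \<Omega>" "F ` A \<subseteq> frontier \<Omega>"
    and lip: "\<kappa>-lipschitz_on UNIV (\<lambda>x. F x - x)" and \<kappa>: "\<kappa> \<le> 1/4"
    and F\<Omega>: "\<And>x. F x \<in> \<Omega> \<Longrightarrow> x \<in> \<Omega>"
  shows "hardy_constant \<Omega> A \<le> (1 + 4 * 3 ^ (DIM('a) + 4) * \<kappa>) * hardy_constant \<Omega> (F ` A)"
proof -
  let ?n = "DIM('a)" and ?H = "hardy_constant \<Omega> A"
  define R where "R = (1 + \<kappa>) / (1 - \<kappa>)"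
  have \<kappa>0: "0 \<le> \<kappa>" by (rule lipschitz_on_nonneg[OF lip])
  have R1: "1 \<le> R" "1 + \<kappa> \<le> R" "R \<le> 1 + 4 * \<kappa>"
  proof -
    show "1 \<le> R" using \<kappa> \<kappa>0 by (simp add: R_def field_simps)
    have "(1 + \<kappa>) * (1 - \<kappa>) \<le> 1 + \<kappa>" using \<kappa>0 by (simp add: algebra_simps)
    then show "1 + \<kappa> \<le> R" using \<kappa> by (simp add: R_def field_simps)
    have "\<kappa> * (4 * \<kappa>) \<le> \<kappa> * 1" using \<kappa> \<kappa>0 by (intro mult_left_mono) auto
    then have "1 + \<kappa> \<le> (1 + 4 * \<kappa>) * (1 - \<kappa>)" using \<kappa>0 by (simp add: algebra_simps)
    then show "R \<le> 1 + 4 * \<kappa>" using \<kappa> by (simp add: R_def divide_le_eq)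
  qed
  have H0: "0 \<le> ?H" by (rule hardy_constant_nonneg[OF \<Omega> A(2,1)])
  have "?H / R ^ (?n + 4) \<le> hardy_constant \<Omega> (F ` A)"
  proof (rule hardy_constant_ge[OF \<Omega> A(3)])
    show "F ` A \<noteq> {}" using A(1) by simp
    show "0 \<le> ?H / R ^ (?n + 4)" using H0 R1 by simp
    fix \<eta> assume \<eta>: "\<eta> \<in> test_functions \<Omega>"
    obtain v where v: "v \<in> test_functions \<Omega>"
      "dirichlet_energy v \<le> ennreal ((1 + \<kappa>)\<^sup>2 * (1 / (1 - \<kappa>)) ^ ?n) * dirichlet_energy \<eta>"
      "hardy_weight_integral (F ` A) \<eta> \<le>
        ennreal ((1 + \<kappa>) ^ ?n * ((1 + \<kappa>) / (1 - \<kappa>))\<^sup>2) * hardy_weight_integral A v"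
      using test_function_transfer[OF \<Omega>(1) A lip _ F\<Omega> \<eta>] \<kappa> by force
    let ?a = "(1 + \<kappa>) ^ ?n * R\<^sup>2" and ?b = "(1 + \<kappa>)\<^sup>2 * (1 / (1 - \<kappa>)) ^ ?n"
    have ab: "0 \<le> ?a" "0 \<le> ?b" using \<kappa>0 \<kappa> by simp_all
    have "?a * ?b = R ^ ?n * (R\<^sup>2 * (1 + \<kappa>)\<^sup>2)"
      by (simp add: R_def power_divide power_one_over field_simps)
    also have "\<dots> \<le> R ^ ?n * (R\<^sup>2 * R\<^sup>2)"
      using R1 \<kappa>0 by (intro mult_left_mono power_mono) auto
    also have "\<dots> = R ^ (?n + 4)" by (simp add: power_add power2_eq_square power4_eq_xxxx)
    finally have abR: "?a * ?b \<le> R ^ (?n + 4)" .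
    have "ennreal ?H * hardy_weight_integral (F ` A) \<eta> \<le>
        ennreal ?H * (ennreal ?a * hardy_weight_integral A v)"
      unfolding R_def by (intro mult_left_mono v(3)) simp
    also have "\<dots> = ennreal ?a * (ennreal ?H * hardy_weight_integral A v)"
      by (simp add: mult_ac)
    also have "\<dots> \<le> ennreal ?a * dirichlet_energy v"
      by (intro mult_left_mono hardy_constant_le_test[OF \<Omega>(1) v(1)]) simp
    also have "\<dots> \<le> ennreal ?a * (ennreal ?b * dirichlet_energy \<eta>)"
      by (intro mult_left_mono v(2)) simp
    also have "\<dots> = ennreal (?a * ?b) * dirichlet_energy \<eta>"
      by (subst ennreal_mult[OF ab]) (rule mult.assoc[symmetric])
    also have "\<dots> \<le> ennreal (R ^ (?n + 4)) * dirichlet_energy \<eta>"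
      by (intro mult_right_mono ennreal_leI abR) simp
    finally have main: "ennreal ?H * hardy_weight_integral (F ` A) \<eta> \<le>
        ennreal (R ^ (?n + 4)) * dirichlet_energy \<eta>" .
    let ?r = "1 / R ^ (?n + 4)"
    have r: "0 \<le> ?r" "?r * R ^ (?n + 4) = 1" using R1 by simp_all
    have "ennreal (?H / R ^ (?n + 4)) * hardy_weight_integral (F ` A) \<eta> =
        ennreal ?r * (ennreal ?H * hardy_weight_integral (F ` A) \<eta>)"
      using r H0 by (simp add: ennreal_mult[symmetric] mult.assoc[symmetric])
    also have "\<dots> \<le> ennreal ?r * (ennreal (R ^ (?n + 4)) * dirichlet_energy \<eta>)"
      by (intro mult_left_mono main) simp
    also have "\<dots> = ennreal (?r * R ^ (?n + 4)) * dirichlet_energy \<eta>"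
      using r R1 by (subst ennreal_mult) (simp_all add: mult.assoc)
    also have "\<dots> = dirichlet_energy \<eta>" unfolding r(2) by simp
    finally show "ennreal (?H / R ^ (?n + 4)) * hardy_weight_integral (F ` A) \<eta> \<le> dirichlet_energy \<eta>" .
  qed
  then have "?H \<le> R ^ (?n + 4) * hardy_constant \<Omega> (F ` A)"
    using R1 by (simp add: field_simps)
  also have "\<dots> \<le> (1 + 4 * 3 ^ (?n + 4) * \<kappa>) * hardy_constant \<Omega> (F ` A)"
  proof (rule mult_right_mono)
    have "R ^ (?n + 4) \<le> (1 + 4 * \<kappa>) ^ (?n + 4)" using R1 by (intro power_mono) auto
    also have "\<dots> \<le> 1 + 3 ^ (?n + 4) * (4 * \<kappa>)"
      using \<kappa> \<kappa>0 by (intro one_plus_power_le) auto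
    finally show "R ^ (?n + 4) \<le> 1 + 4 * 3 ^ (?n + 4) * \<kappa>" by (simp add: mult_ac)
    show "0 \<le> hardy_constant \<Omega> (F ` A)"
      by (rule hardy_constant_nonneg[OF \<Omega> A(3)]) (use A(1) in simp)
  qed
  finally show ?thesis .
qed

section \<open>The C1 norm on the boundary\<close>

lemma C1_derivative_bound:
  fixes F :: "'a::euclidean_space \<Rightarrow> 'b::real_normed_vector"
  assumes F: "higher_differentiable_on U F 1" and K: "compact K" "K \<subseteq> U"
  obtains B where "B \<ge> 0" "\<And>x v. x \<in> K \<Longrightarrow> norm (frechet_derivative F (at x) v) \<le> B * norm v"
proof -
  have "\<exists>b. \<forall>x\<in>K. norm (frechet_derivative F (at x) i) \<le> b" for i
  proof -
    have "continuous_on U (\<lambda>x. frechet_derivative F (at x) i)" using F by simp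
    then have "compact ((\<lambda>x. frechet_derivative F (at x) i) ` K)"
      using K by (meson compact_continuous_image continuous_on_subset)
    then show ?thesis
      using compact_imp_bounded by (force simp: bounded_iff)
  qed
  then have "\<forall>i. \<exists>b. \<forall>x\<in>K. norm (frechet_derivative F (at x) i) \<le> b" by blast
  from choice[OF this] obtain b where b: "\<And>i x. x \<in> K \<Longrightarrow> norm (frechet_derivative F (at x) i) \<le> b i"
    by blast
  show thesis
  proof (rule that)
    show "0 \<le> (\<Sum>i\<in>Basis. \<bar>b i\<bar>)" by (intro sum_nonneg) simp
    fix x v assume x: "x \<in> K"
    have lin: "linear (frechet_derivative F (at x))"
      using F K x by (intro linear_frechet_derivative) auto
    have "frechet_derivative F (at x) v = frechet_derivative F (at x) (\<Sum>i\<in>Basis. (v \<bullet> i) *\<^sub>R i)"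
      by (simp add: euclidean_representation)
    also have "\<dots> = (\<Sum>i\<in>Basis. (v \<bullet> i) *\<^sub>R frechet_derivative F (at x) i)"
      by (simp add: linear_sum[OF lin] linear_cmul[OF lin])
    finally have "norm (frechet_derivative F (at x) v) \<le>
        (\<Sum>i\<in>Basis. norm ((v \<bullet> i) *\<^sub>R frechet_derivative F (at x) i))"
      by (simp only: norm_sum)
    also have "\<dots> \<le> (\<Sum>i\<in>Basis. norm v * \<bar>b i\<bar>)"
    proof (rule sum_mono)
      fix i :: 'a assume "i \<in> Basis"
      have "norm (frechet_derivative F (at x) i) \<le> \<bar>b i\<bar>" using b[OF x, of i] by linarith
      then show "norm ((v \<bullet> i) *\<^sub>R frechet_derivative F (at x) i) \<le> norm v * \<bar>b i\<bar>"
        using Basis_le_norm[OF \<open>i \<in> Basis\<close>, of v] by (simp add: mult_mono)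
    qed
    also have "\<dots> = (\<Sum>i\<in>Basis. \<bar>b i\<bar>) * norm v" by (simp add: sum_distrib_left[symmetric])
    finally show "norm (frechet_derivative F (at x) v) \<le> (\<Sum>i\<in>Basis. \<bar>b i\<bar>) * norm v" .
  qed
qed

lemma C1_onE:
  assumes "C1_on M f" "p \<in> M"
  obtains U F where "open U" "p \<in> U" "higher_differentiable_on U F 1" "\<And>x. x \<in> M \<inter> U \<Longrightarrow> F x = f x"
proof -
  have "\<exists>U F. open U \<and> p \<in> U \<and> higher_differentiable_on U F 1 \<and> (\<forall>x\<in>M \<inter> U. F x = f x)"
    using assms unfolding C1_on_def by (rule bspec)
  then obtain U F where *: "open U \<and> p \<in> U \<and> higher_differentiable_on U F 1 \<and> (\<forall>x\<in>M \<inter> U. F x = f x)"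
    by (elim exE)
  show thesis by (rule that[of U F]) (use * in blast)+
qed

lemma curve_through_derivative:
  assumes U: "open U" and F: "higher_differentiable_on U F 1"
    and FX: "\<And>x. x \<in> M \<inter> U \<Longrightarrow> F x = X x" and q: "q \<in> U" and c: "curve_through M q v c"
  shows "((\<lambda>t. X (c t)) has_vector_derivative frechet_derivative F (at q) v) (at 0)"
proof -
  let ?F' = "frechet_derivative F (at q)"
  obtain e where e: "e > 0" "c ` {-e<..<e} \<subseteq> M" "smooth_on {-e<..<e} c" and c0: "c 0 = q"
    and dc: "(c has_vector_derivative v) (at 0)" using c unfolding curve_through_def by blast
  have dF: "(F has_derivative ?F') (at q)"
    using higher_differentiable_on_SucD(1)[of U F 0 q] F q by simp
  have "((\<lambda>t. F (c t)) has_derivative (\<lambda>t. ?F' (t *\<^sub>R v))) (at 0)"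
    by (rule has_derivative_compose[OF dc[unfolded has_vector_derivative_def]]) (simp add: c0 dF)
  then have "((\<lambda>t. F (c t)) has_vector_derivative ?F' v) (at 0)"
    by (simp add: has_vector_derivative_def linear_cmul[OF has_derivative_linear[OF dF]])
  then show ?thesis
  proof (rule has_vector_derivative_transform_within_open)
    show "open ({-e<..<e} \<inter> c -` U)"
      by (rule continuous_open_preimage[OF smooth_on_continuous_on[OF e(3)] _ U]) simp
    show "0 \<in> {-e<..<e} \<inter> c -` U" using e(1) c0 q by simp
    show "F (c t) = X (c t)" if "t \<in> {-e<..<e} \<inter> c -` U" for t
      using FX[of "c t"] e(2) that by blast
  qed
qed

text \<open>A local \<open>C\<^sup>1\<close> extension \<open>F\<close> of \<open>X\<close> has the same derivative as \<open>X\<close> along each curve in \<open>M\<close>, so the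
  definite description in the tangential derivative denotes the derivative of \<open>F\<close>.\<close>

lemma tangential_derivative_eq:
  assumes U: "open U" and F: "higher_differentiable_on U F 1"
    and FX: "\<And>x. x \<in> M \<inter> U \<Longrightarrow> F x = X x" and q: "q \<in> U" and v: "v \<in> tangent_space M q"
  shows "tangential_derivative M X q v = frechet_derivative F (at q) v"
  unfolding tangential_derivative_def
proof (rule the_equality)
  note D = curve_through_derivative[where X=X, OF U F FX q]
  show "\<exists>c. curve_through M q v c \<and>
      ((\<lambda>t. X (c t)) has_vector_derivative frechet_derivative F (at q) v) (at 0)"
    using v D unfolding tangent_space_def by blast
  fix w assume "\<exists>c. curve_through M q v c \<and> ((\<lambda>t. X (c t)) has_vector_derivative w) (at 0)"
  then obtain c where "curve_through M q v c" "((\<lambda>t. X (c t)) has_vector_derivative w) (at 0)" by blast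
  then show "w = frechet_derivative F (at q) v" using D vector_derivative_unique_at by blast
qed

lemma compact_locally_bounded_imp_bounded:
  fixes S :: "'a::topological_space \<Rightarrow> real set"
  assumes M: "compact M" and loc: "\<And>p. p \<in> M \<Longrightarrow> \<exists>U B. open U \<and> p \<in> U \<and> (\<forall>q\<in>M \<inter> U. \<forall>y\<in>S q. y \<le> B)"
  shows "\<exists>B. \<forall>q\<in>M. \<forall>y\<in>S q. y \<le> B"
proof -
  have "\<forall>p. \<exists>UB. p \<in> M \<longrightarrow> open (fst UB) \<and> p \<in> fst UB \<and> (\<forall>q\<in>M \<inter> fst UB. \<forall>y\<in>S q. y \<le> snd UB)"
    using loc by simp
  from choice[OF this] obtain UB where UB: "\<And>p. p \<in> M \<Longrightarrow> open (fst (UB p))" "\<And>p. p \<in> M \<Longrightarrow> p \<in> fst (UB p)"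
    "\<And>p q y. p \<in> M \<Longrightarrow> q \<in> M \<Longrightarrow> q \<in> fst (UB p) \<Longrightarrow> y \<in> S q \<Longrightarrow> y \<le> snd (UB p)"
    by blast
  obtain C where C: "C \<subseteq> M" "finite C" "M \<subseteq> (\<Union>p\<in>C. fst (UB p))"
  proof (rule compactE_image[OF M, of M "\<lambda>p. fst (UB p)"])
    show "M \<subseteq> (\<Union>p\<in>M. fst (UB p))" using UB(2) by blast
  qed (use UB(1) in blast)+
  show ?thesis
  proof (intro exI ballI)
    fix q y assume q: "q \<in> M" "y \<in> S q"
    then obtain p where p: "p \<in> C" "q \<in> fst (UB p)" using C(3) by blast
    have "y \<le> snd (UB p)" using UB(3)[of p q y] p C(1) q by blast
    also have "\<dots> \<le> \<bar>snd (UB p)\<bar>" by simp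
    also have "\<dots> \<le> (\<Sum>p\<in>C. \<bar>snd (UB p)\<bar>)" by (rule member_le_sum[OF p(1) _ C(2)]) simp
    finally show "y \<le> (\<Sum>p\<in>C. \<bar>snd (UB p)\<bar>)" .
  qed
qed

lemma tangent_space_scaleR:
  assumes "v \<in> tangent_space M p" shows "s *\<^sub>R v \<in> tangent_space M p"
proof -
  obtain c where "curve_through M p v c" using assms by (auto simp: tangent_space_def)
  then obtain e where e: "e > 0" "c ` {-e<..<e} \<subseteq> M" "smooth_on {-e<..<e} c" and c0: "c 0 = p"
    and dc: "(c has_vector_derivative v) (at 0)" unfolding curve_through_def by blast
  define d where "d = e / (\<bar>s\<bar> + 1)"
  have d: "d > 0" using e(1) by (simp add: d_def add_nonneg_pos)
  have sub: "(\<lambda>t. s * t) ` {-d<..<d} \<subseteq> {-e<..<e}"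
  proof
    fix y assume "y \<in> (\<lambda>t. s * t) ` {-d<..<d}"
    then obtain t where t': "t \<in> {-d<..<d}" and y: "y = s * t" by blast
    have t: "\<bar>t\<bar> < d" using t' by auto
    have "\<bar>y\<bar> \<le> (\<bar>s\<bar> + 1) * \<bar>t\<bar>" using y by (simp add: abs_mult distrib_right)
    also have "\<dots> < (\<bar>s\<bar> + 1) * d" using t by (intro mult_strict_left_mono) auto
    also have "\<dots> = e" by (simp add: d_def add_nonneg_pos pos_add_strict)
    finally show "y \<in> {-e<..<e}" by auto
  qed
  have "curve_through M p (s *\<^sub>R v) (\<lambda>t. c (s * t))"
    unfolding curve_through_def
  proof (intro conjI exI[of _ d])
    show "c (s * 0) = p" using c0 by simp
    have "((\<lambda>t. s * t) has_vector_derivative s) (at 0)"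
      by (auto intro!: derivative_eq_intros simp: has_vector_derivative_def)
    from vector_diff_chain_at[OF this, of c v] dc
    show "((\<lambda>t. c (s * t)) has_vector_derivative s *\<^sub>R v) (at 0)" by (simp add: o_def)
    show "smooth_on {-d<..<d} (\<lambda>t. c (s * t))"
      by (rule smooth_on_compose[OF _ _ sub e(3)])
        (auto intro: smooth_on_bounded_linear bounded_linear_mult_right)
    show "(\<lambda>t. c (s * t)) ` {-d<..<d} \<subseteq> M" using sub e(2) by fast
  qed (rule d)
  then show ?thesis by (auto simp: tangent_space_def)
qed

text \<open>The suprema in the norm are meaningful only once the sets are known to be bounded; this follows
  locally from a \<open>C\<^sup>1\<close> extension and globally from compactness. The bound for unit tangent
  vectors extends to all tangent vectors by scaling.\<close>

lemma C1_norm_bounds: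
  fixes M :: "'a::euclidean_space set" and X :: "'a \<Rightarrow> 'b::real_normed_vector"
  assumes M: "compact M" "M \<noteq> {}" and X: "C1_on M X"
  shows "0 \<le> C1_norm M X"
    and "\<And>p. p \<in> M \<Longrightarrow> norm (X p) \<le> C1_norm M X"
    and "\<And>p v. p \<in> M \<Longrightarrow> v \<in> tangent_space M p \<Longrightarrow>
      norm (tangential_derivative M X p v) \<le> C1_norm M X * norm v"
proof -
  define T where "T = {norm (tangential_derivative M X p v) |p v. p \<in> M \<and> v \<in> tangent_space M p \<and> norm v \<le> 1}"
  \<comment> \<open>The values and the derivatives are bounded together, by a single covering argument.\<close>
  define S where "S q = insert (norm (X q))
      {norm (tangential_derivative M X q v) |v. v \<in> tangent_space M q \<and> norm v \<le> 1}" for q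
  have locS: "\<exists>U B. open U \<and> p \<in> U \<and> (\<forall>q\<in>M \<inter> U. \<forall>y\<in>S q. y \<le> B)" if p: "p \<in> M" for p
  proof -
    obtain U F where U: "open U" "p \<in> U" and F: "higher_differentiable_on U F 1"
      and FX: "\<And>x. x \<in> M \<inter> U \<Longrightarrow> F x = X x" by (rule C1_onE[OF X p]) blast
    obtain r where r: "r > 0" "cball p r \<subseteq> U" using U open_contains_cball by blast
    obtain b where b: "b \<ge> 0" "\<And>x v. x \<in> cball p r \<Longrightarrow> norm (frechet_derivative F (at x) v) \<le> b * norm v"
      by (rule C1_derivative_bound[OF F compact_cball r(2)]) blast
    have "continuous_on U F" using higher_differentiable_on_lower[of U F 0] F by simp
    then have "compact (F ` cball p r)"
      using r(2) by (meson compact_continuous_image compact_cball continuous_on_subset)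
    then obtain a where a: "\<And>x. x \<in> cball p r \<Longrightarrow> norm (F x) \<le> a"
      using compact_imp_bounded by (force simp: bounded_iff)
    show ?thesis
    proof (intro exI[of _ "ball p r"] exI[of _ "max a b"] conjI ballI)
      fix q y assume q: "q \<in> M \<inter> ball p r" and y: "y \<in> S q"
      have qU: "q \<in> cball p r" "q \<in> U" using q r(2) by auto
      from y consider "y = norm (X q)" | v where "y = norm (tangential_derivative M X q v)"
        "v \<in> tangent_space M q" "norm v \<le> 1" unfolding S_def by blast
      then show "y \<le> max a b"
      proof cases
        case 1
        then show ?thesis using a[OF qU(1)] FX[of q] q qU by simp
      next
        case 2
        have "y = norm (frechet_derivative F (at q) v)"
          unfolding 2(1) using tangential_derivative_eq[OF U(1) F FX qU(2) 2(2)] by simp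
        also have "\<dots> \<le> b * norm v" by (rule b(2)[OF qU(1)])
        also have "\<dots> \<le> b * 1" using b(1) 2(3) by (rule mult_left_mono[rotated])
        finally show ?thesis by simp
      qed
    qed (use r in auto)
  qed
  from compact_locally_bounded_imp_bounded[OF M(1) locS]
  obtain B where B': "\<forall>q\<in>M. \<forall>y\<in>S q. y \<le> B" by blast
  have B: "norm (X q) \<le> B" "v \<in> tangent_space M q \<Longrightarrow> norm v \<le> 1 \<Longrightarrow>
      norm (tangential_derivative M X q v) \<le> B" if "q \<in> M" for q v
    by (rule B'[rule_format, OF that]; force simp: S_def)+
  have bT: "bdd_above T" unfolding T_def by (rule bdd_aboveI[of _ B]) (use B in blast)
  have bX: "bdd_above ((\<lambda>p. norm (X p)) ` M)" by (rule bdd_aboveI[of _ B]) (use B in blast)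
  have lin: "tangential_derivative M X p (s *\<^sub>R v) = s *\<^sub>R tangential_derivative M X p v"
    if p: "p \<in> M" and v: "v \<in> tangent_space M p" for p v s
  proof -
    obtain U F where U: "open U" "p \<in> U" and F: "higher_differentiable_on U F 1"
      and FX: "\<And>x. x \<in> M \<inter> U \<Longrightarrow> F x = X x" by (rule C1_onE[OF X p]) blast
    have eq: "tangential_derivative M X p v = frechet_derivative F (at p) v"
      if "v \<in> tangent_space M p" for v
      by (rule tangential_derivative_eq[OF U(1) F _ U(2) that]) (rule FX)
    have lin: "linear (frechet_derivative F (at p))"
      using F U by (intro linear_frechet_derivative) auto
    have "tangential_derivative M X p (s *\<^sub>R v) = frechet_derivative F (at p) (s *\<^sub>R v)"
      by (rule eq[OF tangent_space_scaleR[OF v]])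
    also have "\<dots> = s *\<^sub>R frechet_derivative F (at p) v" by (rule linear_cmul[OF lin])
    also have "frechet_derivative F (at p) v = tangential_derivative M X p v" by (rule eq[OF v, symmetric])
    finally show ?thesis .
  qed
  have zero: "0 \<in> tangent_space M p \<and> tangential_derivative M X p 0 = 0" if "p \<in> M" for p
  proof -
    have "curve_through M p 0 (\<lambda>t. p)"
      using that by (auto simp: curve_through_def intro!: exI[of _ 1] smooth_on_const)
    then have "0 \<in> tangent_space M p" by (auto simp: tangent_space_def)
    then show ?thesis using lin[OF that, of 0 0] by simp
  qed
  have N: "C1_norm M X = (SUP p\<in>M. norm (X p)) + Sup T" by (simp add: C1_norm_def T_def)
  obtain p0 where p0: "p0 \<in> M" using M(2) by blast
  have SX: "norm (X p) \<le> (SUP p\<in>M. norm (X p))" if "p \<in> M" for p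
    by (rule cSUP_upper[OF that bX])
  have ST: "norm (tangential_derivative M X p v) \<le> Sup T"
    if "p \<in> M" "v \<in> tangent_space M p" "norm v \<le> 1" for p v
    by (rule cSup_upper[OF _ bT]) (use that in \<open>auto simp: T_def\<close>)
  have SX0: "0 \<le> (SUP p\<in>M. norm (X p))" using SX[OF p0] norm_ge_zero order_trans by blast
  have ST0: "0 \<le> Sup T" using ST[OF p0, of 0] zero[OF p0] by simp
  show "0 \<le> C1_norm M X" using SX0 ST0 N by simp
  show "norm (X p) \<le> C1_norm M X" if "p \<in> M" for p using SX[OF that] ST0 N by simp
  show "norm (tangential_derivative M X p v) \<le> C1_norm M X * norm v"
    if p: "p \<in> M" and v: "v \<in> tangent_space M p" for p v
  proof (cases "v = 0")
    case False
    define w where "w = (1 / norm v) *\<^sub>R v"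
    have w: "w \<in> tangent_space M p" "norm w \<le> 1" "v = norm v *\<^sub>R w"
      using False by (simp_all add: w_def tangent_space_scaleR[OF v])
    have "norm (tangential_derivative M X p v) = norm v * norm (tangential_derivative M X p w)"
      using lin[OF p w(1), of "norm v"] w(3) by simp
    also have "\<dots> \<le> norm v * C1_norm M X"
      using ST[OF p w(1,2)] SX0 N by (intro mult_left_mono) auto
    finally show ?thesis by (simp add: mult.commute)
  qed (use zero[OF p] in simp)
qed

text \<open>Translated in time, \<open>c\<close> becomes a curve through each of its points, so the derivative of \<open>X \<circ> c\<close> is
  the tangential derivative of \<open>X\<close> in the direction of the velocity.\<close>

lemma curve_increment_bound:
  fixes M :: "'a::euclidean_space set" and X :: "'a \<Rightarrow> 'b::real_normed_vector"
  assumes X: "C1_on M X" and c: "smooth_on UNIV c"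
    and cM: "\<And>t. t \<in> {0..1} \<Longrightarrow> \<exists>e>0. c ` {t-e<..<t+e} \<subseteq> M"
    and dc: "\<And>t. t \<in> {0..1} \<Longrightarrow> (c has_vector_derivative c' t) (at t)"
    and bnd: "\<And>t. t \<in> {0..1} \<Longrightarrow> c' t \<in> tangent_space M (c t) \<Longrightarrow>
      norm (tangential_derivative M X (c t) (c' t)) \<le> B"
  shows "norm (X (c 1) - X (c 0)) \<le> B"
proof -
  have der: "\<exists>w. ((\<lambda>t. X (c t)) has_vector_derivative w) (at t) \<and> norm w \<le> B" if t: "t \<in> {0..1}" for t
  proof -
    obtain e where e: "e > 0" "c ` {t-e<..<t+e} \<subseteq> M" using cM[OF t] by blast
    have curve: "curve_through M (c t) (c' t) (\<lambda>s. c (t + s))"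
      unfolding curve_through_def
    proof (intro conjI exI[of _ e])
      have "((\<lambda>s. t + s) has_vector_derivative 1) (at 0)"
        by (auto intro!: derivative_eq_intros simp: has_vector_derivative_def)
      from vector_diff_chain_at[OF this, of c "c' t"] dc[OF t]
      show "((\<lambda>s. c (t + s)) has_vector_derivative c' t) (at 0)" by (simp add: o_def)
      have "smooth_on UNIV (\<lambda>s. t + s)"
        by (rule smooth_on_add[OF open_UNIV smooth_on_const[OF open_UNIV]
              smooth_on_bounded_linear[OF open_UNIV bounded_linear_ident]])
      then have "smooth_on UNIV (\<lambda>s. c (t + s))"
        by (rule smooth_on_compose[OF open_UNIV open_UNIV subset_UNIV c])
      then show "smooth_on {-e<..<e} (\<lambda>s. c (t + s))" by (rule smooth_on_subset) simp
      show "(\<lambda>s. c (t + s)) ` {-e<..<e} \<subseteq> M" using e(2) by force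
    qed (use e(1) in simp_all)
    have ct: "c t \<in> M" using e by auto
    obtain U F where U: "open U" "c t \<in> U" and F: "higher_differentiable_on U F 1"
      and FX: "\<And>x. x \<in> M \<inter> U \<Longrightarrow> F x = X x" by (rule C1_onE[OF X ct]) blast
    have tan: "c' t \<in> tangent_space M (c t)" using curve by (auto simp: tangent_space_def)
    let ?w = "tangential_derivative M X (c t) (c' t)"
    have "((\<lambda>s. X (c (t + s))) has_vector_derivative ?w) (at 0)"
      using curve_through_derivative[where X=X, OF U(1) F FX U(2) curve]
        tangential_derivative_eq[where X=X and M=M, OF U(1) F FX U(2) tan] by simp
    moreover have "((\<lambda>s. s - t) has_vector_derivative 1) (at t)"
      by (auto intro!: derivative_eq_intros simp: has_vector_derivative_def)
    ultimately have "((\<lambda>s. X (c s)) has_vector_derivative ?w) (at t)"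
      using vector_diff_chain_at[of "\<lambda>s. s - t" 1 t "\<lambda>s. X (c (t + s))" ?w] by (simp add: o_def)
    then show ?thesis using bnd[OF t tan] by blast
  qed
  then have "\<forall>t\<in>{0..1}. \<exists>w. ((\<lambda>t. X (c t)) has_vector_derivative w) (at t) \<and> norm w \<le> B"
    by blast
  from bchoice[OF this] obtain w where
    w: "\<And>t. t \<in> {0..1} \<Longrightarrow> ((\<lambda>t. X (c t)) has_vector_derivative w t) (at t)"
    "\<And>t. t \<in> {0..1} \<Longrightarrow> norm (w t) \<le> B" by blast
  have "norm (X (c 1) - X (c 0)) \<le> B * norm (1 - 0 :: real)"
  proof (rule differentiable_bound[where S="{0..1}" and f="\<lambda>t. X (c t)" and f'="\<lambda>t h. h *\<^sub>R w t"])
    show "((\<lambda>t. X (c t)) has_derivative (\<lambda>h. h *\<^sub>R w t)) (at t within {0..1})" if "t \<in> {0..1}" for t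
      using w(1)[OF that] has_derivative_at_withinI unfolding has_vector_derivative_def by blast
    show "onorm (\<lambda>h. h *\<^sub>R w t) \<le> B" if "t \<in> {0..1}" for t
      by (rule onorm_le) (use w(2)[OF that] in \<open>simp add: mult.commute[of B] mult_left_mono\<close>)
  qed simp_all
  then show ?thesis by simp
qed

section \<open>Boundary charts and the Lipschitz estimate on the boundary\<close>

definition graph_proj :: "'a::euclidean_space \<Rightarrow> 'a \<Rightarrow> 'a" where
  "graph_proj \<nu> x = x - (x \<bullet> \<nu>) *\<^sub>R \<nu>"

definition boundary_chart :: "'a::euclidean_space set \<Rightarrow> 'a \<Rightarrow> real \<Rightarrow> 'a \<Rightarrow> ('a \<Rightarrow> real) \<Rightarrow> bool" where
  "boundary_chart \<Omega> p r \<nu> \<gamma> \<longleftrightarrow> r > 0 \<and> norm \<nu> = 1 \<and> smooth_on UNIV \<gamma> \<and>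
     \<Omega> \<inter> ball p r = {x \<in> ball p r. \<gamma> (graph_proj \<nu> x) < x \<bullet> \<nu>}"

text \<open>The retraction of the coordinate cylinder onto the graph along the direction \<open>\<nu>\<close>.\<close>

definition graph_lift :: "'a::euclidean_space \<Rightarrow> ('a \<Rightarrow> real) \<Rightarrow> 'a \<Rightarrow> 'a" where
  "graph_lift \<nu> \<gamma> x = graph_proj \<nu> x + \<gamma> (graph_proj \<nu> x) *\<^sub>R \<nu>"

lemma smooth_boundary_chart:
  assumes "smooth_boundary \<Omega>" "p \<in> frontier \<Omega>"
  obtains r \<nu> \<gamma> where "boundary_chart \<Omega> p r \<nu> \<gamma>"
  using assms unfolding smooth_boundary_def boundary_chart_def graph_proj_def by blast

lemma graph_proj_simps:
  assumes "norm \<nu> = 1"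
  shows "graph_proj \<nu> (graph_proj \<nu> x) = graph_proj \<nu> x"
    and "graph_proj \<nu> (x + s *\<^sub>R \<nu>) = graph_proj \<nu> x"
    and "graph_proj \<nu> x \<bullet> \<nu> = 0" and "(x + s *\<^sub>R \<nu>) \<bullet> \<nu> = x \<bullet> \<nu> + s"
proof -
  have \<nu>: "\<nu> \<bullet> \<nu> = 1" using assms by (simp add: norm_eq_1)
  show p0: "graph_proj \<nu> x \<bullet> \<nu> = 0" by (simp add: graph_proj_def inner_diff_left \<nu>)
  show "graph_proj \<nu> (graph_proj \<nu> x) = graph_proj \<nu> x"
    using p0 by (simp add: graph_proj_def[of \<nu> "graph_proj \<nu> x"])
  show s: "(x + s *\<^sub>R \<nu>) \<bullet> \<nu> = x \<bullet> \<nu> + s" by (simp add: inner_add_left \<nu>)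
  show "graph_proj \<nu> (x + s *\<^sub>R \<nu>) = graph_proj \<nu> x"
    by (simp add: graph_proj_def s scaleR_add_left)
qed

lemma smooth_on_graph_proj: "smooth_on UNIV (graph_proj \<nu>)"
  by (rule smooth_on_bounded_linear)
    (auto simp: graph_proj_def[abs_def] intro!: bounded_linear_sub bounded_linear_ident
      bounded_linear_scaleR_const bounded_linear_inner_left)

text \<open>Points above the graph belong to the open set \<open>\<Omega>\<close>, points below have a neighbourhood disjoint from
  \<open>\<Omega>\<close>, and points on the graph are limits of points above them.\<close>

lemma frontier_in_chart:
  assumes \<Omega>: "open \<Omega>" and ch: "boundary_chart \<Omega> p r \<nu> \<gamma>" and x: "x \<in> ball p r"
  shows "x \<in> frontier \<Omega> \<longleftrightarrow> \<gamma> (graph_proj \<nu> x) = x \<bullet> \<nu>"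
proof -
  have \<nu>: "norm \<nu> = 1" and \<gamma>: "smooth_on UNIV \<gamma>"
    and graph: "\<Omega> \<inter> ball p r = {x \<in> ball p r. \<gamma> (graph_proj \<nu> x) < x \<bullet> \<nu>}"
    using ch by (auto simp: boundary_chart_def)
  have in\<Omega>: "y \<in> \<Omega> \<longleftrightarrow> \<gamma> (graph_proj \<nu> y) < y \<bullet> \<nu>" if "y \<in> ball p r" for y
    using graph that by blast
  have cont: "continuous_on UNIV (\<lambda>x. \<gamma> (graph_proj \<nu> x))"
    by (rule continuous_on_compose2[OF smooth_on_continuous_on[OF \<gamma>]
          smooth_on_continuous_on[OF smooth_on_graph_proj]]) simp
  show ?thesis
  proof
    assume f: "x \<in> frontier \<Omega>"
    then have notin: "x \<notin> \<Omega>" and cl: "x \<in> closure \<Omega>"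
      using \<Omega> by (auto simp: frontier_def interior_open)
    have "\<not> x \<bullet> \<nu> < \<gamma> (graph_proj \<nu> x)"
    proof
      assume less: "x \<bullet> \<nu> < \<gamma> (graph_proj \<nu> x)"
      have "open ({y. y \<bullet> \<nu> < \<gamma> (graph_proj \<nu> y)} \<inter> ball p r)"
        by (intro open_Int open_ball open_Collect_less cont continuous_intros)
      moreover have "({y. y \<bullet> \<nu> < \<gamma> (graph_proj \<nu> y)} \<inter> ball p r) \<inter> \<Omega> = {}"
      proof (rule equals0I)
        fix y assume "y \<in> ({y. y \<bullet> \<nu> < \<gamma> (graph_proj \<nu> y)} \<inter> ball p r) \<inter> \<Omega>"
        then show False using in\<Omega>[of y] by simp
      qed
      ultimately have "({y. y \<bullet> \<nu> < \<gamma> (graph_proj \<nu> y)} \<inter> ball p r) \<inter> closure \<Omega> = {}"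
        by (simp only: open_Int_closure_eq_empty)
      then show False using cl less x by blast
    qed
    then show "\<gamma> (graph_proj \<nu> x) = x \<bullet> \<nu>" using in\<Omega>[OF x] notin by linarith
  next
    assume eq: "\<gamma> (graph_proj \<nu> x) = x \<bullet> \<nu>"
    then have "x \<notin> \<Omega>" using in\<Omega>[OF x] by simp
    moreover have "x \<in> closure \<Omega>"
      unfolding closure_approachable
    proof (intro allI impI)
      fix e :: real assume e: "e > 0"
      define t where "t = min e (r - dist p x) / 2"
      have t: "t > 0" "t < e" "t < r - dist p x" using e x by (auto simp: t_def)
      have d: "dist (x + t *\<^sub>R \<nu>) x = t" using t \<nu> by (simp add: dist_norm)
      then have "x + t *\<^sub>R \<nu> \<in> ball p r"
        using t(3) dist_triangle[of p "x + t *\<^sub>R \<nu>" x] by (simp add: dist_commute)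
      then have "x + t *\<^sub>R \<nu> \<in> \<Omega>"
        using in\<Omega> eq t(1) by (simp add: graph_proj_simps[OF \<nu>])
      then show "\<exists>y\<in>\<Omega>. dist y x < e" using d t(2) by metis
    qed
    ultimately show "x \<in> frontier \<Omega>" using \<Omega> by (simp add: frontier_def interior_open)
  qed
qed

lemma smooth_on_graph_lift:
  assumes "smooth_on UNIV \<gamma>" shows "smooth_on UNIV (graph_lift \<nu> \<gamma>)"
proof -
  have "smooth_on UNIV (\<lambda>x. \<gamma> (graph_proj \<nu> x))"
    by (rule smooth_on_compose[OF open_UNIV open_UNIV subset_UNIV assms smooth_on_graph_proj])
  then show ?thesis
    unfolding graph_lift_def[abs_def]
    by (intro smooth_on_add smooth_on_scaleR smooth_on_const smooth_on_graph_proj open_UNIV)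
qed

text \<open>Two boundary points near \<open>p\<close> are joined by the lift to the graph of the segment between them. The
  speed of this curve is at most a constant times their distance, and that constant depends on the
  chart only. This is why \<open>X\<close> and \<open>N\<close> are quantified after \<open>r'\<close> and \<open>B\<close>.\<close>

lemma C1_increment_in_chart:
  fixes \<Omega> :: "'a::euclidean_space set"
  assumes \<Omega>: "open \<Omega>" and p: "p \<in> frontier \<Omega>" and ch: "boundary_chart \<Omega> p r \<nu> \<gamma>"
  shows "\<exists>r' B. r' > 0 \<and> B \<ge> 0 \<and> (\<forall>(X :: 'a \<Rightarrow> 'a) N. C1_on (frontier \<Omega>) X \<longrightarrow>
    (\<forall>q v. q \<in> frontier \<Omega> \<longrightarrow> v \<in> tangent_space (frontier \<Omega>) q \<longrightarrow>
      norm (tangential_derivative (frontier \<Omega>) X q v) \<le> N * norm v) \<longrightarrow> N \<ge> 0 \<longrightarrow>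
    (\<forall>q1\<in>frontier \<Omega> \<inter> ball p r'. \<forall>q2\<in>frontier \<Omega> \<inter> ball p r'.
      norm (X q2 - X q1) \<le> N * B * norm (q2 - q1)))"
proof -
  let ?M = "frontier \<Omega>" and ?T = "graph_lift \<nu> \<gamma>"
  have r: "r > 0" and \<nu>: "norm \<nu> = 1" and \<gamma>: "smooth_on UNIV \<gamma>"
    using ch by (auto simp: boundary_chart_def)
  note T = smooth_on_graph_lift[OF \<gamma>, of \<nu>]
  have TM: "?T x \<in> ?M" if "?T x \<in> ball p r" for x
    unfolding frontier_in_chart[OF \<Omega> ch that]
    by (simp add: graph_lift_def graph_proj_simps[OF \<nu>])
  have Tid: "?T x = x" if "x \<in> ?M" "x \<in> ball p r" for x
    using frontier_in_chart[OF \<Omega> ch that(2)] that(1) by (simp add: graph_lift_def graph_proj_def)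
  have Tp: "?T p = p" using Tid[OF p] r by simp
  have "isCont ?T p"
    using smooth_on_continuous_on[OF T] by (simp add: continuous_on_eq_continuous_at)
  then obtain d where d: "d > 0" "\<And>x. dist x p < d \<Longrightarrow> dist (?T x) p < r"
    using r Tp unfolding continuous_at_eps_delta by metis
  define r' where "r' = min r d"
  have r': "r' > 0" "r' \<le> r" using r d(1) by (auto simp: r'_def)
  have Tb: "?T x \<in> ?M" if "x \<in> ball p r'" for x
    using TM[of x] d(2)[of x] that by (simp add: r'_def dist_commute)
  have "higher_differentiable_on UNIV ?T 1" using T unfolding smooth_on_def by blast
  then obtain B where B: "B \<ge> 0"
    "\<And>x v. x \<in> cball p r' \<Longrightarrow> norm (frechet_derivative ?T (at x) v) \<le> B * norm v"
    by (rule C1_derivative_bound[OF _ compact_cball subset_UNIV]) blast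
  show ?thesis
  proof (rule exI[of _ r'], rule exI[of _ B], intro conjI r'(1) B(1) allI impI ballI)
    fix X :: "'a \<Rightarrow> 'a" and N q1 q2
    assume X: "C1_on ?M X" and N: "\<forall>q v. q \<in> ?M \<longrightarrow> v \<in> tangent_space ?M q \<longrightarrow>
        norm (tangential_derivative ?M X q v) \<le> N * norm v" "N \<ge> 0"
      and q: "q1 \<in> ?M \<inter> ball p r'" "q2 \<in> ?M \<inter> ball p r'"
    define a where "a t = q1 + t *\<^sub>R (q2 - q1)" for t :: real
    define c where "c t = ?T (a t)" for t
    have ac: "a = (\<lambda>t. q1 + t *\<^sub>R (q2 - q1))" by (simp add: a_def[abs_def])
    have a_in: "a t \<in> ball p r'" if "t \<in> {0..1}" for t
    proof -
      have "a t = (1 - t) *\<^sub>R q1 + t *\<^sub>R q2" by (simp add: a_def algebra_simps)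
      then show ?thesis using convexD[OF convex_ball[of p r'], of q1 q2 "1 - t" t] q that by simp
    qed
    have a_sm: "smooth_on UNIV a"
      unfolding ac
      by (rule smooth_on_add[OF open_UNIV smooth_on_const[OF open_UNIV]
            smooth_on_bounded_linear[OF open_UNIV bounded_linear_scaleR_left]])
    have c_sm: "smooth_on UNIV c"
      unfolding c_def[abs_def] by (rule smooth_on_compose[OF open_UNIV open_UNIV subset_UNIV T a_sm])
    have c01: "c 0 = q1" "c 1 = q2" using q Tid r' by (auto simp: c_def a_def)
    have "norm (X (c 1) - X (c 0)) \<le> N * (B * norm (q2 - q1))"
    proof (rule curve_increment_bound[OF X c_sm])
      fix t :: real assume t: "t \<in> {0..1}"
      have "open (a -` ball p r')"
        using smooth_on_continuous_on[OF a_sm] by (intro open_vimage open_ball)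
      then obtain e where e: "e > 0" "ball t e \<subseteq> a -` ball p r'"
        using a_in[OF t] open_contains_ball by (metis vimageI)
      have "c ` {t-e<..<t+e} \<subseteq> ?M"
      proof
        fix y assume "y \<in> c ` {t-e<..<t+e}"
        then obtain s where s: "s \<in> {t-e<..<t+e}" "y = c s" by blast
        then have "s \<in> ball t e" by (auto simp: dist_real_def)
        then show "y \<in> ?M" using e(2) Tb s(2) by (auto simp: c_def)
      qed
      then show "\<exists>e>0. c ` {t-e<..<t+e} \<subseteq> ?M" using e(1) by blast
      have da: "(a has_vector_derivative (q2 - q1)) (at t)"
        unfolding ac by (auto intro!: derivative_eq_intros simp: has_vector_derivative_def)
      note dT = smooth_on_has_derivative[OF T UNIV_I, of "a t"]
      have "((\<lambda>t. ?T (a t)) has_derivative (\<lambda>h. frechet_derivative ?T (at (a t)) (h *\<^sub>R (q2 - q1)))) (at t)"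
        by (rule has_derivative_compose[OF da[unfolded has_vector_derivative_def] dT])
      then show "(c has_vector_derivative frechet_derivative ?T (at (a t)) (q2 - q1)) (at t)"
        by (simp add: has_vector_derivative_def c_def[abs_def] linear_cmul[OF has_derivative_linear[OF dT]])
      assume tan: "frechet_derivative ?T (at (a t)) (q2 - q1) \<in> tangent_space ?M (c t)"
      have "norm (tangential_derivative ?M X (c t) (frechet_derivative ?T (at (a t)) (q2 - q1))) \<le>
          N * norm (frechet_derivative ?T (at (a t)) (q2 - q1))"
        using N(1) tan Tb[OF a_in[OF t]] by (simp add: c_def)
      also have "\<dots> \<le> N * (B * norm (q2 - q1))"
        using a_in[OF t] ball_subset_cball[of p r'] by (intro mult_left_mono B(2) N(2)) blast
      finally show "norm (tangential_derivative ?M X (c t) (frechet_derivative ?T (at (a t)) (q2 - q1))) \<le>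
          N * (B * norm (q2 - q1))" .
    qed
    then show "norm (X q2 - X q1) \<le> N * B * norm (q2 - q1)" by (simp add: c01 mult.assoc)
  qed
qed

text \<open>Finitely many charts cover the boundary. Points closer than a Lebesgue number \<open>e\<close> of the
  covering lie in a common chart; for the others \<open>2 N \<le> (2/e) N |x - y|\<close> suffices, \<open>N\<close> being the norm.\<close>

lemma frontier_C1_lipschitz:
  fixes \<Omega> :: "'a::euclidean_space set"
  assumes \<Omega>: "open \<Omega>" "bounded \<Omega>" "smooth_boundary \<Omega>" "frontier \<Omega> \<noteq> {}"
  obtains C where "C > 0" "\<And>X :: 'a \<Rightarrow> 'a. C1_on (frontier \<Omega>) X \<Longrightarrow>
    (C * C1_norm (frontier \<Omega>) X)-lipschitz_on (frontier \<Omega>) X"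
proof -
  let ?M = "frontier \<Omega>"
  define P where "P p r B \<longleftrightarrow> r > 0 \<and> B \<ge> 0 \<and> (\<forall>X :: 'a \<Rightarrow> 'a. C1_on ?M X \<longrightarrow>
    (\<forall>q1\<in>?M \<inter> ball p r. \<forall>q2\<in>?M \<inter> ball p r. norm (X q2 - X q1) \<le> C1_norm ?M X * B * norm (q2 - q1)))"
    for p r B
  have M: "compact ?M" using \<Omega>(2) by (simp add: compact_frontier_bounded)
  have "\<exists>rB. p \<in> ?M \<longrightarrow> P p (fst rB) (snd rB)" for p
  proof (cases "p \<in> ?M")
    case True
    obtain r \<nu> \<gamma> where ch: "boundary_chart \<Omega> p r \<nu> \<gamma>" by (rule smooth_boundary_chart[OF \<Omega>(3) True])
    obtain r' B where rB: "r' > 0" "B \<ge> 0" and *: "\<forall>(X :: 'a \<Rightarrow> 'a) N. C1_on ?M X \<longrightarrow>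
      (\<forall>q v. q \<in> ?M \<longrightarrow> v \<in> tangent_space ?M q \<longrightarrow>
        norm (tangential_derivative ?M X q v) \<le> N * norm v) \<longrightarrow> N \<ge> 0 \<longrightarrow>
      (\<forall>q1\<in>?M \<inter> ball p r'. \<forall>q2\<in>?M \<inter> ball p r'. norm (X q2 - X q1) \<le> N * B * norm (q2 - q1))"
      using C1_increment_in_chart[OF \<Omega>(1) True ch] by (elim exE conjE) blast
    have "P p r' B"
      unfolding P_def
    proof (intro conjI rB allI impI)
      fix X :: "'a \<Rightarrow> 'a" assume X: "C1_on ?M X"
      note b = C1_norm_bounds[OF M \<Omega>(4) X]
      show "\<forall>q1\<in>?M \<inter> ball p r'. \<forall>q2\<in>?M \<inter> ball p r'.
          norm (X q2 - X q1) \<le> C1_norm ?M X * B * norm (q2 - q1)"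
        by (rule *[THEN spec, THEN spec, THEN mp, THEN mp, THEN mp, OF X _ b(1)]) (use b(3) in blast)
    qed
    then show ?thesis by (intro exI[of _ "(r', B)"]) simp
  qed simp
  then have "\<forall>p. \<exists>rB. p \<in> ?M \<longrightarrow> P p (fst rB) (snd rB)" by blast
  from choice[OF this] obtain rB where rB: "\<And>p. p \<in> ?M \<Longrightarrow> P p (fst (rB p)) (snd (rB p))" by blast
  let ?b = "\<lambda>p. ball p (fst (rB p))"
  obtain D where D: "D \<subseteq> ?M" "finite D" "?M \<subseteq> (\<Union>p\<in>D. ?b p)"
  proof (rule compactE_image[OF M, of ?M ?b])
    show "?M \<subseteq> (\<Union>p\<in>?M. ?b p)" using rB by (auto simp: P_def)
  qed auto
  obtain e where e: "e > 0" "\<And>x. x \<in> ?M \<Longrightarrow> \<exists>G\<in>?b ` D. ball x e \<subseteq> G"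
    by (rule Heine_Borel_lemma[OF M, of "?b ` D"]) (use D(3) in auto)
  define C where "C = (\<Sum>p\<in>D. \<bar>snd (rB p)\<bar>) + 2 / e"
  show thesis
  proof (rule that)
    show C: "C > 0" using e(1) by (simp add: C_def add_nonneg_pos sum_nonneg)
    fix X :: "'a \<Rightarrow> 'a" assume X: "C1_on ?M X"
    note b = C1_norm_bounds[OF M \<Omega>(4) X]
    let ?N = "C1_norm ?M X"
    show "(C * ?N)-lipschitz_on ?M X"
    proof (rule lipschitz_onI)
      show "0 \<le> C * ?N" using C b(1) by simp
      fix x y assume xy: "x \<in> ?M" "y \<in> ?M"
      show "dist (X x) (X y) \<le> C * ?N * dist x y"
      proof (cases "dist x y < e")
        case True
        obtain p where p: "p \<in> D" "ball x e \<subseteq> ?b p" using e(2)[OF xy(1)] by blast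
        have "x \<in> ball x e" "y \<in> ball x e" using True e(1) by auto
        then have "x \<in> ?b p" "y \<in> ?b p" using p(2) by blast+
        then have "norm (X x - X y) \<le> ?N * snd (rB p) * norm (x - y)"
          using rB[of p] p(1) D(1) X xy unfolding P_def by blast
        also have "\<dots> \<le> ?N * C * norm (x - y)"
        proof (intro mult_right_mono mult_left_mono b(1))
          have "snd (rB p) \<le> \<bar>snd (rB p)\<bar>" by simp
          also have "\<dots> \<le> (\<Sum>p\<in>D. \<bar>snd (rB p)\<bar>)" by (rule member_le_sum[OF p(1) _ D(2)]) simp
          also have "\<dots> \<le> C" using e(1) by (simp add: C_def)
          finally show "snd (rB p) \<le> C" .
        qed simp
        finally show ?thesis by (simp add: dist_norm mult.commute)
      next
        case False
        have "dist (X x) (X y) \<le> norm (X x) + norm (X y)" by (simp add: dist_norm norm_triangle_ineq4)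
        also have "\<dots> \<le> 2 * ?N" using b(2)[OF xy(1)] b(2)[OF xy(2)] by simp
        also have "\<dots> = 2 / e * ?N * e" using e(1) by simp
        also have "\<dots> \<le> C * ?N * dist x y"
          using False e(1) b(1) C by (intro mult_mono) (auto simp: C_def sum_nonneg)
        finally show ?thesis .
      qed
    qed
  qed
qed

section \<open>Extension to a homeomorphism that preserves the domain\<close>

text \<open>The extension is the infimum over \<open>p \<in> M\<close> of the \<open>L\<close>-Lipschitz functions \<open>x \<mapsto> f p + L dist x p\<close>. On
  \<open>M\<close> none of them lies below \<open>f\<close>, since \<open>f\<close> is \<open>L\<close>-Lipschitz there, and the one with \<open>p = x\<close> attains it.\<close>

lemma mcshane_extension:
  fixes f :: "'a::metric_space \<Rightarrow> real"
  assumes lip: "L-lipschitz_on M f" and M: "M \<noteq> {}"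
  obtains g where "L-lipschitz_on UNIV g" "\<And>x. x \<in> M \<Longrightarrow> g x = f x"
proof -
  have L: "L \<ge> 0" by (rule lipschitz_on_nonneg[OF lip])
  define g where "g x = (INF p\<in>M. f p + L * dist x p)" for x
  obtain p0 where p0: "p0 \<in> M" using M by blast
  have bdd: "bdd_below ((\<lambda>p. f p + L * dist x p) ` M)" for x
  proof (rule bdd_belowI2)
    fix p assume p: "p \<in> M"
    have "f p0 - f p \<le> L * dist p0 p" using lipschitz_onD[OF lip p0 p] by (simp add: dist_real_def)
    also have "\<dots> \<le> L * (dist x p0 + dist x p)"
      using L dist_triangle2[of p0 p x] by (intro mult_left_mono) (simp_all add: dist_commute)
    finally show "f p0 - L * dist x p0 \<le> f p + L * dist x p" by (simp add: algebra_simps)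
  qed
  have le: "g x \<le> f p + L * dist x p" if "p \<in> M" for x p
    unfolding g_def by (rule cINF_lower[OF bdd that])
  have ge: "a \<le> g x" if "\<And>p. p \<in> M \<Longrightarrow> a \<le> f p + L * dist x p" for a x
    unfolding g_def using M that by (rule cINF_greatest)
  have step: "g x \<le> g y + L * dist x y" for x y
  proof -
    have "g x - L * dist x y \<le> g y"
    proof (rule ge)
      fix p assume p: "p \<in> M"
      have "g x \<le> f p + L * dist x p" by (rule le[OF p])
      also have "L * dist x p \<le> L * (dist x y + dist y p)"
        using L dist_triangle by (intro mult_left_mono)
      finally show "g x - L * dist x y \<le> f p + L * dist y p" by (simp add: algebra_simps)
    qed
    then show ?thesis by simp
  qed
  show thesis
  proof (rule that)
    show "L-lipschitz_on UNIV g"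
    proof (rule lipschitz_onI[OF _ L])
      show "dist (g x) (g y) \<le> L * dist x y" for x y
        using step[of x y] step[of y x] by (simp add: dist_real_def dist_commute abs_le_iff)
    qed
    fix x assume x: "x \<in> M"
    have "f x \<le> g x"
    proof (rule ge)
      fix p assume "p \<in> M"
      from lipschitz_onD[OF lip x this] show "f x \<le> f p + L * dist x p"
        by (simp add: dist_real_def abs_le_iff)
    qed
    then show "g x = f x" using le[OF x, of x] by simp
  qed
qed

text \<open>Each coordinate is extended separately; the dimension in the constant comes from summing the
  coordinates.\<close>

lemma mcshane_extension_euclidean:
  fixes X :: "'a::metric_space \<Rightarrow> 'b::euclidean_space"
  assumes lip: "L-lipschitz_on M X" and M: "M \<noteq> {}"
  obtains Z where "(real DIM('b) * L)-lipschitz_on UNIV Z" "\<And>x. x \<in> M \<Longrightarrow> Z x = X x"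
proof -
  have L: "L \<ge> 0" by (rule lipschitz_on_nonneg[OF lip])
  have "\<exists>g. L-lipschitz_on UNIV g \<and> (\<forall>x\<in>M. g x = X x \<bullet> i)" if i: "i \<in> Basis" for i
  proof -
    have "L-lipschitz_on M (\<lambda>x. X x \<bullet> i)"
    proof (rule lipschitz_onI[OF _ L])
      fix x y assume xy: "x \<in> M" "y \<in> M"
      have "dist (X x \<bullet> i) (X y \<bullet> i) \<le> norm (X x - X y)"
        using Basis_le_norm[OF i, of "X x - X y"] by (simp add: dist_real_def inner_diff_left)
      then show "dist (X x \<bullet> i) (X y \<bullet> i) \<le> L * dist x y"
        using lipschitz_onD[OF lip xy] by (simp add: dist_norm)
    qed
    from mcshane_extension[OF this M] show ?thesis by metis
  qed
  then have "\<forall>i\<in>Basis. \<exists>g. L-lipschitz_on UNIV g \<and> (\<forall>x\<in>M. g x = X x \<bullet> i)" by blast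
  from bchoice[OF this] obtain g where g: "\<And>i. i \<in> Basis \<Longrightarrow> L-lipschitz_on UNIV (g i)"
    "\<And>i x. i \<in> Basis \<Longrightarrow> x \<in> M \<Longrightarrow> g i x = X x \<bullet> i" by blast
  define Z where "Z x = (\<Sum>i\<in>Basis. g i x *\<^sub>R i)" for x
  show thesis
  proof (rule that)
    show "(real DIM('b) * L)-lipschitz_on UNIV Z"
    proof (rule lipschitz_onI)
      fix x y
      have "dist (Z x) (Z y) = norm (\<Sum>i\<in>Basis. (g i x - g i y) *\<^sub>R i)"
        by (simp add: Z_def dist_norm sum_subtractf scaleR_diff_left)
      also have "\<dots> \<le> (\<Sum>i\<in>(Basis::'b set). norm ((g i x - g i y) *\<^sub>R i))" by (rule norm_sum)
      also have "\<dots> \<le> (\<Sum>i\<in>(Basis::'b set). L * dist x y)"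
      proof (rule sum_mono)
        fix i :: 'b assume i: "i \<in> Basis"
        show "norm ((g i x - g i y) *\<^sub>R i) \<le> L * dist x y"
          using lipschitz_onD[OF g(1)[OF i], of x y] i by (simp add: dist_real_def)
      qed
      finally show "dist (Z x) (Z y) \<le> real DIM('b) * L * dist x y" by (simp add: mult.assoc)
    qed (use L in simp)
    show "Z x = X x" if "x \<in> M" for x
      using that by (simp add: Z_def g(2) euclidean_representation)
  qed
qed

text \<open>Shearing along \<open>\<nu>\<close> straightens the graph, so the part of \<open>\<Omega>\<close> near \<open>p\<close> lies in the image of a half
  ball, which is convex.\<close>

lemma connected_near_boundary_point:
  assumes p: "p \<in> frontier \<Omega>" and ch: "boundary_chart \<Omega> p r \<nu> \<gamma>"
  obtains r' W where "r' > 0" "connected W" "W \<subseteq> \<Omega>" "\<Omega> \<inter> ball p r' \<subseteq> W"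
proof -
  have r: "r > 0" and \<nu>: "norm \<nu> = 1" and \<gamma>: "smooth_on UNIV \<gamma>"
    and graph: "\<Omega> \<inter> ball p r = {x \<in> ball p r. \<gamma> (graph_proj \<nu> x) < x \<bullet> \<nu>}"
    using ch by (auto simp: boundary_chart_def)
  note P = graph_proj_simps[OF \<nu>]
  have in\<Omega>: "y \<in> \<Omega> \<longleftrightarrow> \<gamma> (graph_proj \<nu> y) < y \<bullet> \<nu>" if "y \<in> ball p r" for y
    using graph that by blast
  define up where "up x = x + \<gamma> (graph_proj \<nu> x) *\<^sub>R \<nu>" for x
  define down where "down x = x + (- \<gamma> (graph_proj \<nu> x)) *\<^sub>R \<nu>" for x
  have ud: "up (down x) = x" for x by (simp only: up_def down_def P(2)) simp
  have cont\<gamma>: "continuous_on UNIV (\<lambda>x. \<gamma> (graph_proj \<nu> x))"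
    by (rule continuous_on_compose2[OF smooth_on_continuous_on[OF \<gamma>]
          smooth_on_continuous_on[OF smooth_on_graph_proj]]) simp
  have c_up: "continuous_on UNIV up" and c_down: "continuous_on UNIV down"
    unfolding up_def[abs_def] down_def[abs_def] by (intro continuous_intros cont\<gamma>)+
  have "isCont up (down p)" using c_up by (simp add: continuous_on_eq_continuous_at)
  then obtain s where s: "s > 0" "\<And>y. dist y (down p) < s \<Longrightarrow> dist (up y) (up (down p)) < r"
    using r unfolding continuous_at_eps_delta by metis
  have "isCont down p" using c_down by (simp add: continuous_on_eq_continuous_at)
  then obtain d where d: "d > 0" "\<And>x. dist x p < d \<Longrightarrow> dist (down x) (down p) < s"
    using s(1) unfolding continuous_at_eps_delta by metis
  define H where "H = ball (down p) s \<inter> {y. \<nu> \<bullet> y > 0}"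
  show thesis
  proof (rule that[of "min r d" "up ` H"])
    show "min r d > 0" using r d(1) by simp
    have "convex H" unfolding H_def by (intro convex_Int convex_ball convex_halfspace_gt)
    then show "connected (up ` H)"
      using c_up by (intro connected_continuous_image convex_connected) (auto intro: continuous_on_subset)
    show "up ` H \<subseteq> \<Omega>"
    proof
      fix x assume "x \<in> up ` H"
      then obtain y where y: "y \<in> ball (down p) s" "\<nu> \<bullet> y > 0" "x = up y" by (auto simp: H_def)
      have "x \<in> ball p r" using s(2)[of y] y(1,3) by (simp add: ud dist_commute)
      moreover have "\<gamma> (graph_proj \<nu> x) < x \<bullet> \<nu>"
        using y(2) by (simp only: y(3) up_def P(2,4)) (simp add: inner_commute)
      ultimately show "x \<in> \<Omega>" using in\<Omega> by blast
    qed
    show "\<Omega> \<inter> ball p (min r d) \<subseteq> up ` H"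
    proof
      fix x assume x: "x \<in> \<Omega> \<inter> ball p (min r d)"
      then have "down x \<in> ball (down p) s" using d(2)[of x] by (simp add: dist_commute)
      moreover have "\<gamma> (graph_proj \<nu> x) < x \<bullet> \<nu>" using in\<Omega>[of x] x by simp
      then have "\<nu> \<bullet> down x > 0"
        using P(4)[of x "- \<gamma> (graph_proj \<nu> x)"] by (simp add: down_def inner_commute)
      ultimately have "down x \<in> H" by (simp add: H_def)
      then show "x \<in> up ` H" using ud[of x] image_eqI by metis
    qed
  qed
qed

text \<open>Every component of the bounded set \<open>\<Omega>\<close> has a boundary point, hence it meets, and then contains, one
  of the connected pieces of finitely many charts that cover the boundary. Distinct components
  contain distinct pieces.\<close>

lemma finite_components_smooth_boundary:
  fixes \<Omega> :: "'a::euclidean_space set"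
  assumes \<Omega>: "open \<Omega>" "bounded \<Omega>" "smooth_boundary \<Omega>"
  shows "finite (components \<Omega>)"
proof -
  let ?M = "frontier \<Omega>"
  have M: "compact ?M" using \<Omega>(2) by (simp add: compact_frontier_bounded)
  have "\<exists>rW. p \<in> ?M \<longrightarrow> fst rW > (0::real) \<and> connected (snd rW) \<and> snd rW \<subseteq> \<Omega> \<and> \<Omega> \<inter> ball p (fst rW) \<subseteq> snd rW" for p
  proof (cases "p \<in> ?M")
    case True
    obtain r \<nu> \<gamma> where ch: "boundary_chart \<Omega> p r \<nu> \<gamma>" by (rule smooth_boundary_chart[OF \<Omega>(3) True])
    obtain r' W where "r' > 0" "connected W" "W \<subseteq> \<Omega>" "\<Omega> \<inter> ball p r' \<subseteq> W"
      by (rule connected_near_boundary_point[OF True ch])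
    then show ?thesis by (intro exI[of _ "(r', W)"]) simp
  qed simp
  then have "\<forall>p. \<exists>rW. p \<in> ?M \<longrightarrow> fst rW > (0::real) \<and> connected (snd rW) \<and> snd rW \<subseteq> \<Omega> \<and> \<Omega> \<inter> ball p (fst rW) \<subseteq> snd rW"
    by blast
  from choice[OF this] obtain rW where rW: "\<And>p. p \<in> ?M \<Longrightarrow> fst (rW p) > (0::real) \<and> connected (snd (rW p)) \<and>
    snd (rW p) \<subseteq> \<Omega> \<and> \<Omega> \<inter> ball p (fst (rW p)) \<subseteq> snd (rW p)" by blast
  let ?b = "\<lambda>p. ball p (fst (rW p))"
  obtain D where D: "D \<subseteq> ?M" "finite D" "?M \<subseteq> (\<Union>p\<in>D. ?b p)"
  proof (rule compactE_image[OF M, of ?M ?b])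
    show "?M \<subseteq> (\<Union>p\<in>?M. ?b p)" using rW by auto
  qed auto
  have "\<exists>p. p \<in> D \<and> snd (rW p) \<noteq> {} \<and> snd (rW p) \<subseteq> U" if U: "U \<in> components \<Omega>" for U
  proof -
    have Un: "U \<noteq> {}" "U \<subseteq> \<Omega>" using U in_components_nonempty in_components_subset by blast+
    then have "U \<noteq> UNIV" using \<Omega>(2) bounded_subset not_bounded_UNIV by metis
    then have "frontier U \<noteq> {}" using Un(1) by (simp add: frontier_eq_empty)
    then obtain q where q: "q \<in> frontier U" by blast
    then have "q \<in> ?M" using frontier_of_components_subset[OF U] by blast
    then obtain p where p: "p \<in> D" "q \<in> ?b p" using D(3) by blast
    have "?b p \<inter> closure U \<noteq> {}" using q p(2) by (auto simp: frontier_def)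
    then have "?b p \<inter> U \<noteq> {}" using open_Int_closure_eq_empty[OF open_ball] by metis
    then obtain x where x: "x \<in> ?b p" "x \<in> U" by blast
    have rWp: "connected (snd (rW p))" "snd (rW p) \<subseteq> \<Omega>" "\<Omega> \<inter> ?b p \<subseteq> snd (rW p)"
      using rW[of p] p(1) D(1) by blast+
    have xW: "x \<in> snd (rW p)" using rWp(3) x Un(2) by blast
    then have "snd (rW p) \<subseteq> U"
      using components_maximal[OF U rWp(1,2)] x(2) by blast
    then show ?thesis using p(1) xW by blast
  qed
  then have "\<forall>U\<in>components \<Omega>. \<exists>p. p \<in> D \<and> snd (rW p) \<noteq> {} \<and> snd (rW p) \<subseteq> U" by blast
  from bchoice[OF this] obtain k where
    k: "\<And>U. U \<in> components \<Omega> \<Longrightarrow> k U \<in> D \<and> snd (rW (k U)) \<noteq> {} \<and> snd (rW (k U)) \<subseteq> U" by blast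
  have "inj_on k (components \<Omega>)"
  proof (rule inj_onI)
    fix U V assume UV: "U \<in> components \<Omega>" "V \<in> components \<Omega>" "k U = k V"
    then have "U \<inter> V \<noteq> {}" using k[OF UV(1)] k[OF UV(2)] by auto
    then show "U = V" using components_eq[OF UV(1,2)] by blast
  qed
  moreover have "k ` components \<Omega> \<subseteq> D" using k by blast
  ultimately show ?thesis using D(2) by (meson inj_on_finite)
qed

text \<open>In each of the finitely many components a point is chosen, and \<open>\<rho>\<close> is so small that these points
  stay in \<open>\<Omega>\<close>; the displacement at such a point is controlled by the one at a fixed boundary point
  \<open>p0\<close> and the Lipschitz constant. The image of a component is connected and avoids the boundary, so
  it cannot leave \<open>\<Omega>\<close>.\<close>

lemma near_identity_preserves_domain:
  fixes \<Omega> :: "'a::euclidean_space set"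
  assumes \<Omega>: "open \<Omega>" "bounded \<Omega>" "smooth_boundary \<Omega>" "frontier \<Omega> \<noteq> {}"
  obtains \<rho> where "\<rho> > 0" "\<And>F \<kappa>. inj F \<Longrightarrow> \<kappa>-lipschitz_on UNIV (\<lambda>x. F x - x) \<Longrightarrow>
    F ` frontier \<Omega> = frontier \<Omega> \<Longrightarrow> (\<And>p. p \<in> frontier \<Omega> \<Longrightarrow> norm (F p - p) \<le> \<rho>) \<Longrightarrow> \<kappa> \<le> \<rho> \<Longrightarrow>
    F ` \<Omega> \<subseteq> \<Omega>"
proof -
  obtain p0 where p0: "p0 \<in> frontier \<Omega>" using \<Omega>(4) by blast
  define pt where "pt U = (SOME x. x \<in> U)" for U :: "'a set"
  have pt: "pt U \<in> U" if "U \<in> components \<Omega>" for U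
    unfolding pt_def using in_components_nonempty[OF that] by (simp add: some_in_eq)
  define Q where "Q = pt ` components \<Omega>"
  have fin: "finite Q" unfolding Q_def by (intro finite_imageI finite_components_smooth_boundary \<Omega>)
  have "Q \<subseteq> \<Omega>" using pt in_components_subset by (fastforce simp: Q_def)
  then obtain s where s: "s > 0" "(\<Union>x\<in>Q. ball x s) \<subseteq> \<Omega>"
    by (rule compact_subset_open_imp_ball_epsilon_subset[OF finite_imp_compact[OF fin] \<Omega>(1)])
  define d where "d = (\<Sum>x\<in>Q. norm (x - p0))"
  have d: "norm (x - p0) \<le> d" if "x \<in> Q" for x
    unfolding d_def by (rule member_le_sum[OF that _ fin]) simp
  have d0: "0 \<le> d" by (simp add: d_def sum_nonneg)
  define \<rho> where "\<rho> = (s / 2) / (1 + d)"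
  have \<rho>: "\<rho> > 0" "\<rho> + \<rho> * d < s"
  proof -
    show "\<rho> > 0" using s(1) d0 by (simp add: \<rho>_def)
    have "1 + d \<noteq> 0" using d0 by simp
    then have "\<rho> * (1 + d) = s / 2" unfolding \<rho>_def by (rule nonzero_eq_divide_eq[THEN iffD1, OF _ refl])
    then show "\<rho> + \<rho> * d < s" using s(1) by (simp add: distrib_left)
  qed
  show thesis
  proof (rule that[OF \<rho>(1)])
    fix F \<kappa>
    assume inj: "inj F" and lip: "\<kappa>-lipschitz_on UNIV (\<lambda>x. F x - x)"
      and FM: "F ` frontier \<Omega> = frontier \<Omega>" and small: "\<And>p. p \<in> frontier \<Omega> \<Longrightarrow> norm (F p - p) \<le> \<rho>"
      and \<kappa>: "\<kappa> \<le> \<rho>"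
    have cont: "continuous_on UNIV F"
      using continuous_on_add[OF lipschitz_on_continuous_on[OF lip] continuous_on_id] by simp
    have disj: "frontier \<Omega> \<inter> \<Omega> = {}" using \<Omega>(1) by (auto simp: frontier_def interior_open)
    have "F ` U \<subseteq> \<Omega>" if U: "U \<in> components \<Omega>" for U
    proof -
      let ?x = "pt U"
      have xQ: "?x \<in> Q" using U by (simp add: Q_def)
      have "norm (F ?x - ?x) \<le> norm (F p0 - p0) + norm ((F ?x - ?x) - (F p0 - p0))"
        using norm_triangle_ineq[of "F p0 - p0" "(F ?x - ?x) - (F p0 - p0)"] by simp
      also have "\<dots> \<le> \<rho> + \<kappa> * norm (?x - p0)"
        by (intro add_mono small p0 lipschitz_on_normD[OF lip]) auto
      also have "\<dots> \<le> \<rho> + \<rho> * d"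
        using \<kappa> d[OF xQ] \<rho>(1) by (intro add_left_mono mult_mono) auto
      finally have "F ?x \<in> ball ?x s" using \<rho>(2) by (simp add: dist_norm norm_minus_commute)
      then have "F ?x \<in> F ` U \<inter> \<Omega>" using s(2) xQ pt[OF U] by blast
      moreover have "F ` U \<inter> frontier \<Omega> = {}"
      proof -
        have "U \<inter> frontier \<Omega> = {}" using in_components_subset[OF U] disj by blast
        then show ?thesis using inj FM by (metis image_Int image_empty)
      qed
      moreover have "connected (F ` U)"
        by (rule connected_continuous_image[OF continuous_on_subset[OF cont] in_components_connected[OF U]]) simp
      ultimately show ?thesis using connected_Int_frontier[of "F ` U" \<Omega>] by blast
    qed
    then show "F ` \<Omega> \<subseteq> \<Omega>" using Union_components[of \<Omega>] by blast
  qed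
qed

lemma C1_on_displacement:
  assumes "C1_on M \<phi>" shows "C1_on M (\<lambda>x. \<phi> x - x)"
  unfolding C1_on_def
proof
  fix p assume p: "p \<in> M"
  obtain U F where U: "open U" "p \<in> U" "higher_differentiable_on U F 1" "\<And>x. x \<in> M \<inter> U \<Longrightarrow> F x = \<phi> x"
    by (rule C1_onE[OF assms p]) blast
  have "higher_differentiable_on U (\<lambda>x. F x + - x) 1"
    by (intro higher_differentiable_on_add U
        higher_differentiable_on_bounded_linear bounded_linear_minus bounded_linear_ident)
  then show "\<exists>U F. open U \<and> p \<in> U \<and> higher_differentiable_on U F 1 \<and> (\<forall>x\<in>M \<inter> U. F x = \<phi> x - x)"
    using U by (intro exI[of _ U] exI[of _ "\<lambda>x. F x + - x"]) (simp del: higher_differentiable_on.simps One_nat_def)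
qed

section \<open>Stability of the Hardy constant\<close>

theorem theorem5p1:
  fixes \<Omega> \<Sigma> :: "'a::euclidean_space set"
  assumes "open \<Omega>" and "bounded \<Omega>"
    and "smooth_boundary \<Omega>" and "frontier \<Omega> \<noteq> {}"
    and "\<Sigma> \<subseteq> frontier \<Omega>" and "\<Sigma> \<noteq> {}"
  shows "\<exists>\<epsilon>>0. \<exists>c>0. \<forall>\<phi>\<in>C1_diffeos (frontier \<Omega>).
           C1_norm (frontier \<Omega>) (\<lambda>x. \<phi> x - x) < \<epsilon> \<longrightarrow>
           \<bar>hardy_constant \<Omega> (\<phi> ` \<Sigma>) - hardy_constant \<Omega> \<Sigma>\<bar>
             \<le> c * hardy_constant \<Omega> \<Sigma> * C1_norm (frontier \<Omega>) (\<lambda>x. \<phi> x - x)"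
proof -
  let ?M = "frontier \<Omega>" and ?n = "DIM('a)"
  have \<Omega>ne: "\<Omega> \<noteq> {}" using assms(4) by auto
  have M: "compact ?M" using assms(2) by (simp add: compact_frontier_bounded)
  obtain C where C: "C > 0" "\<And>X :: 'a \<Rightarrow> 'a. C1_on ?M X \<Longrightarrow> (C * C1_norm ?M X)-lipschitz_on ?M X"
    by (rule frontier_C1_lipschitz[OF assms(1-4)]) blast
  obtain \<rho> where \<rho>: "\<rho> > 0" "\<And>F \<kappa>. inj F \<Longrightarrow> \<kappa>-lipschitz_on UNIV (\<lambda>x. F x - x) \<Longrightarrow>
    F ` ?M = ?M \<Longrightarrow> (\<And>p. p \<in> ?M \<Longrightarrow> norm (F p - p) \<le> \<rho>) \<Longrightarrow> \<kappa> \<le> \<rho> \<Longrightarrow> F ` \<Omega> \<subseteq> \<Omega>"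
    by (rule near_identity_preserves_domain[OF assms(1-4)]) blast
  \<comment> \<open>With norm \<open>N\<close> the Lipschitz constant of the displacement is \<open>\<kappa> = m N\<close>, and that of the inverse is at
    most \<open>2 \<kappa>\<close>. The choice of \<open>\<epsilon>\<close> keeps both at most \<open>1/4\<close> and \<open>\<rho>\<close>, and \<open>N\<close> at most \<open>\<rho>\<close>.\<close>
  define m where "m = real ?n * C"
  have m: "m > 0" using C(1) by (simp add: m_def)
  define c0 where "c0 = (4 :: real) * 3 ^ (?n + 4)"
  have c0: "c0 > 0" by (simp add: c0_def)
  define K where "K = 2 * c0 * (1 + c0)"
  have K: "K > 0" using c0 by (simp add: K_def)
  define \<epsilon> where "\<epsilon> = min \<rho> (min (1 / (8 * m)) (\<rho> / (2 * m)))"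
  have \<epsilon>: "\<epsilon> > 0" using \<rho>(1) m by (simp add: \<epsilon>_def)
  show ?thesis
  proof (rule exI[of _ \<epsilon>], intro conjI \<epsilon>, rule exI[of _ "K * m"], intro conjI ballI impI)
    show "K * m > 0" using K m by simp
    fix \<phi> assume \<phi>: "\<phi> \<in> C1_diffeos ?M" and small: "C1_norm ?M (\<lambda>x. \<phi> x - x) < \<epsilon>"
    define X where "X x = \<phi> x - x" for x
    define N where "N = C1_norm ?M X"
    have \<phi>M: "\<phi> ` ?M = ?M" using \<phi> by (simp add: C1_diffeos_def bij_betw_def)
    have X: "C1_on ?M X"
      unfolding X_def using \<phi> by (intro C1_on_displacement) (simp add: C1_diffeos_def)
    note b = C1_norm_bounds[OF M assms(4) X, folded N_def]
    have N: "N < \<epsilon>" using small by (simp add: N_def X_def[abs_def])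
    obtain Z where Z: "(real ?n * (C * N))-lipschitz_on UNIV Z" "\<And>x. x \<in> ?M \<Longrightarrow> Z x = X x"
      unfolding N_def by (rule mcshane_extension_euclidean[OF C(2)[OF X] assms(4)]) blast
    define \<kappa> where "\<kappa> = m * N"
    have \<kappa>: "0 \<le> \<kappa>" "\<kappa> \<le> 1/8" "2 * \<kappa> \<le> \<rho>" "N \<le> \<rho>"
    proof -
      show "0 \<le> \<kappa>" using m b(1) by (simp add: \<kappa>_def)
      have "N < 1 / (8 * m)" "N < \<rho> / (2 * m)" "N < \<rho>" using N by (simp_all add: \<epsilon>_def)
      then show "\<kappa> \<le> 1/8" "2 * \<kappa> \<le> \<rho>" "N \<le> \<rho>"
        using m by (simp_all add: \<kappa>_def field_simps)
    qed
    define F where "F x = x + Z x" for x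
    have lipF: "\<kappa>-lipschitz_on UNIV (\<lambda>x. F x - x)"
      using Z(1) by (simp add: F_def \<kappa>_def m_def mult.assoc)
    have F\<phi>: "F x = \<phi> x" if "x \<in> ?M" for x using Z(2)[OF that] by (simp add: F_def X_def)
    have FM: "F ` ?M = ?M" using \<phi>M F\<phi> by (simp cong: image_cong)
    have F\<Sigma>: "F ` \<Sigma> = \<phi> ` \<Sigma>" using assms(5) F\<phi> by (intro image_cong) auto
    define \<kappa>' where "\<kappa>' = \<kappa> / (1 - \<kappa>)"
    have \<kappa>': "\<kappa>' \<le> 2 * \<kappa>" "\<kappa>' \<le> 1/4" "0 \<le> \<kappa>'"
    proof -
      have "\<kappa> * (2 * \<kappa>) \<le> \<kappa> * 1" using \<kappa> by (intro mult_left_mono) auto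
      then show "\<kappa>' \<le> 2 * \<kappa>" using \<kappa> by (simp add: \<kappa>'_def divide_le_eq algebra_simps)
      then show "\<kappa>' \<le> 1/4" using \<kappa>(2) by simp
      show "0 \<le> \<kappa>'" using \<kappa> by (simp add: \<kappa>'_def)
    qed
    obtain G where G: "\<And>x. G (F x) = x" "\<And>y. F (G y) = y"
      "\<kappa>'-lipschitz_on UNIV (\<lambda>y. G y - y)"
      unfolding \<kappa>'_def by (rule near_identity_inverse[OF lipF]) (use \<kappa>(2) in auto)
    have inj: "inj F" "inj G" using G(1,2) by (metis injI)+
    have GM: "G ` ?M = ?M"
    proof -
      have "G ` F ` ?M = ?M" by (simp add: image_image G(1))
      then show ?thesis by (simp add: FM)
    qed
    have F\<Omega>: "F ` \<Omega> \<subseteq> \<Omega>"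
    proof (rule \<rho>(2)[OF inj(1) lipF FM])
      show "norm (F p - p) \<le> \<rho>" if "p \<in> ?M" for p
        using b(2)[OF that] \<kappa>(4) Z(2)[OF that] by (simp add: F_def)
    qed (use \<kappa> in simp)
    have G\<Omega>: "G ` \<Omega> \<subseteq> \<Omega>"
    proof (rule \<rho>(2)[OF inj(2) G(3) GM])
      show "norm (G p - p) \<le> \<rho>" if "p \<in> ?M" for p
      proof -
        obtain q where q: "q \<in> ?M" "p = F q" using \<open>p \<in> ?M\<close> FM by blast
        have "G p = q" "p = q + X q"
          using G(1)[of q] Z(2)[OF q(1)] by (simp_all add: q(2)) (simp add: F_def)
        then have "norm (G p - p) = norm (X q)" by simp
        then show ?thesis using b(2)[OF q(1)] \<kappa>(4) by simp
      qed
    qed (use \<kappa> \<kappa>' in simp)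
    let ?H = "hardy_constant \<Omega> \<Sigma>" and ?H' = "hardy_constant \<Omega> (\<phi> ` \<Sigma>)"
    have \<Sigma>': "\<phi> ` \<Sigma> \<noteq> {}" "\<phi> ` \<Sigma> \<subseteq> ?M" using assms(5,6) \<phi>M by auto
    have H0: "0 \<le> ?H" by (rule hardy_constant_nonneg[OF assms(1) \<Omega>ne assms(5,6)])
    have 1: "?H \<le> (1 + c0 * \<kappa>) * ?H'"
    proof -
      have "hardy_constant \<Omega> \<Sigma> \<le> (1 + 4 * 3 ^ (?n + 4) * \<kappa>) * hardy_constant \<Omega> (F ` \<Sigma>)"
      proof (rule hardy_constant_transfer[OF assms(1) \<Omega>ne assms(6,5) _ lipF])
        show "F ` \<Sigma> \<subseteq> ?M" using \<Sigma>'(2) F\<Sigma> by simp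
        show "x \<in> \<Omega>" if "F x \<in> \<Omega>" for x using G\<Omega> G(1)[of x] that by force
      qed (use \<kappa> in simp)
      then show ?thesis by (simp add: F\<Sigma> c0_def)
    qed
    have 2: "?H' \<le> (1 + c0 * \<kappa>') * ?H"
    proof -
      have G\<Sigma>: "G ` \<phi> ` \<Sigma> = \<Sigma>" unfolding F\<Sigma>[symmetric] by (simp add: image_image G(1))
      have "?H' \<le> (1 + 4 * 3 ^ (?n + 4) * \<kappa>') * hardy_constant \<Omega> (G ` \<phi> ` \<Sigma>)"
      proof (rule hardy_constant_transfer[OF assms(1) \<Omega>ne \<Sigma>' _ G(3)])
        show "G ` \<phi> ` \<Sigma> \<subseteq> ?M" using assms(5) G\<Sigma> by simp
        show "x \<in> \<Omega>" if "G x \<in> \<Omega>" for x using F\<Omega> G(2)[of x] that by force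
      qed (use \<kappa>' in simp)
      then show ?thesis by (simp add: G\<Sigma> c0_def)
    qed
    have upper: "?H' - ?H \<le> K * \<kappa> * ?H"
    proof -
      have "c0 * \<kappa>' \<le> K * \<kappa>"
      proof -
        have "c0 * \<kappa>' \<le> c0 * (2 * \<kappa>)" using \<kappa>' c0 by simp
        also have "\<dots> \<le> 2 * c0 * (1 + c0) * \<kappa>" using c0 \<kappa>(1) by (simp add: algebra_simps)
        finally show ?thesis by (simp add: K_def)
      qed
      then have "c0 * \<kappa>' * ?H \<le> K * \<kappa> * ?H" using H0 by (rule mult_right_mono)
      then show ?thesis using 2 by (simp add: algebra_simps)
    qed
    \<comment> \<open>The bound in this direction involves the perturbed constant, which is first estimated by the upper bound.\<close>
    have lower: "?H - ?H' \<le> K * \<kappa> * ?H"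
    proof -
      have "?H - ?H' \<le> c0 * \<kappa> * ?H'" using 1 by (simp add: algebra_simps)
      also have "\<dots> \<le> c0 * \<kappa> * ((1 + c0 * \<kappa>') * ?H)" using 2 c0 \<kappa>(1) by (intro mult_left_mono) auto
      also have "\<dots> \<le> c0 * \<kappa> * ((1 + c0) * ?H)"
      proof -
        have "c0 * \<kappa>' \<le> c0 * 1" using \<kappa>' c0 by (intro mult_left_mono) auto
        then show ?thesis using H0 c0 \<kappa>(1) by (intro mult_left_mono mult_right_mono) auto
      qed
      also have "\<dots> \<le> K * \<kappa> * ?H"
      proof -
        have "0 \<le> c0 * \<kappa> * ((1 + c0) * ?H)" using c0 \<kappa>(1) H0 by simp
        moreover have "K * \<kappa> * ?H = 2 * (c0 * \<kappa> * ((1 + c0) * ?H))"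
          by (simp add: K_def mult_ac)
        ultimately show ?thesis by linarith
      qed
      finally show ?thesis .
    qed
    have "\<bar>?H' - ?H\<bar> \<le> K * \<kappa> * ?H" using upper lower by (simp add: abs_le_iff)
    also have "\<dots> = K * m * ?H * C1_norm ?M (\<lambda>x. \<phi> x - x)"
      by (simp add: \<kappa>_def N_def X_def[abs_def])
    finally show "\<bar>?H' - ?H\<bar> \<le> K * m * ?H * C1_norm ?M (\<lambda>x. \<phi> x - x)" .
  qed
qed

end
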